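(* The weak solution $(Y(t):t\in[0,T])$ of the stochastic Cauchy problem $\mathrm dY(t)=AY(t)\,\mathrm dt+B\,\mathrm dL(t)$, $Y(0)=y_0$, is stochastically continuous, i.e. $Y(s)\to Y(t)$ in probability in $V$ as $s\to t$, for every $t\in[0,T]$.
   Context: Let $(\Omega,\mathcal F,P)$ be a probability space and $U,V$ separable real Hilbert spaces; $A$ generates a strongly continuous semigroup $(T(t))_{t\ge0}$ on $V$, $B\in\mathcal L(U,V)$, $y_0\in V$. A cylindrical Lévy process $L$ in $U$ is a family $(L(t))_{t\ge0}$ of linear continuous maps $U\to L^0_P(\Omega;\mathbb R)$ such that for all $u_1,\dots,u_n\in U$ the process $((L(t)u_1,\dots,L(t)u_n))_{t\ge0}$ is a Lévy process in $\mathbb R^n$. A $V$-valued process $Y$ is weakly Bochner regular if $t\mapsto\langle Y(t),g(t)\rangle$ is integrable on $[0,T]$ a.s. for each $g\in C([0,T];V)$ and $\int_0^T\langle Y(s),g_n(s)\rangle\,\mathrm ds\to0$ in probability whenever $g_n\in C([0,T];V)$, $\|g_n\|_\infty\to0$. A $V$-valued progressively measurable process $(Y(t))_{t\in[0,T]}$ is a weak solution if it is weakly Bochner regular and for every $v\in\mathcal D(A^* )$ and $t\in[0,T]$, a.s., $\langle Y(t),v\rangle=\langle y_0,v\rangle+\int_0^t\langle Y(s),A^*v\rangle\,\mathrm ds+L(t)(B^*v)$. *)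

theory Defs
  imports "HOL-Analysis.Analysis" "HOL-Probability.Probability"
begin

definition conv_in_prob ::
  "'w measure \<Rightarrow> ('i \<Rightarrow> 'w \<Rightarrow> 'b::metric_space) \<Rightarrow> ('w \<Rightarrow> 'b) \<Rightarrow> 'i filter \<Rightarrow> bool" where
  "conv_in_prob M X Y F \<longleftrightarrow>
     (\<forall>e>0. ((\<lambda>i. measure M {\<omega> \<in> space M. dist (X i \<omega>) (Y \<omega>) > e}) \<longlongrightarrow> 0) F)"

text \<open>A vector in R^n is a function nat => real restricted to the index set I = {..<n}.
  Levy process (Applebaum): X(0) = 0 a.s., independent and stationary increments,
  stochastically continuous.\<close>

definition levy_process_Rn ::
  "'w measure \<Rightarrow> nat set \<Rightarrow> (real \<Rightarrow> 'w \<Rightarrow> nat \<Rightarrow> real) \<Rightarrow> bool" where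
  "levy_process_Rn M I X \<longleftrightarrow>
     (\<forall>t\<ge>0. (\<lambda>\<omega>. restrict (X t \<omega>) I) \<in> M \<rightarrow>\<^sub>M PiM I (\<lambda>_. borel)) \<and>
     (AE \<omega> in M. \<forall>i\<in>I. X 0 \<omega> i = 0) \<and>
     (\<forall>(ts :: nat \<Rightarrow> real) (m::nat). 0 \<le> ts 0 \<and> (\<forall>k<m. ts k \<le> ts (Suc k)) \<longrightarrow>
        prob_space.indep_vars M (\<lambda>_. PiM I (\<lambda>_. borel))
          (\<lambda>k \<omega>. \<lambda>i\<in>I. X (ts (Suc k)) \<omega> i - X (ts k) \<omega> i) {..<m}) \<and>
     (\<forall>s t. 0 \<le> s \<and> s \<le> t \<longrightarrow>
        distr M (PiM I (\<lambda>_. borel)) (\<lambda>\<omega>. \<lambda>i\<in>I. X t \<omega> i - X s \<omega> i) =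
        distr M (PiM I (\<lambda>_. borel)) (\<lambda>\<omega>. \<lambda>i\<in>I. X (t - s) \<omega> i)) \<and>
     (\<forall>t\<ge>0. \<forall>e>0.
        ((\<lambda>s. measure M {\<omega> \<in> space M. sqrt (\<Sum>i\<in>I. (X s \<omega> i - X t \<omega> i)\<^sup>2) > e}) \<longlongrightarrow> 0)
          (at t within {0..}))"

text \<open>L t u is a real random variable (a representative of an element of L^0).
  L t : U -> L^0 is linear (a.s.) and continuous (w.r.t. convergence in probability);
  for all u_1,...,u_n the process (L t u_1, ..., L t u_n) is a Levy process in R^n.\<close>

definition cylindrical_levy ::
  "'w measure \<Rightarrow> (real \<Rightarrow> 'u::real_normed_vector \<Rightarrow> 'w \<Rightarrow> real) \<Rightarrow> bool" where
  "cylindrical_levy M L \<longleftrightarrow>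
     (\<forall>t\<ge>0. \<forall>u. L t u \<in> borel_measurable M) \<and>
     (\<forall>t\<ge>0. \<forall>a b u v. AE \<omega> in M. L t (a *\<^sub>R u + b *\<^sub>R v) \<omega> = a * L t u \<omega> + b * L t v \<omega>) \<and>
     (\<forall>t\<ge>0. \<forall>us u. us \<longlonglongrightarrow> u \<longrightarrow> conv_in_prob M (\<lambda>n. L t (us n)) (L t u) sequentially) \<and>
     (\<forall>(n::nat) (us :: nat \<Rightarrow> 'u). levy_process_Rn M {..<n} (\<lambda>t \<omega> i. L t (us i) \<omega>))"

definition c0_semigroup :: "(real \<Rightarrow> ('v::real_normed_vector \<Rightarrow>\<^sub>L 'v)) \<Rightarrow> bool" where
  "c0_semigroup S \<longleftrightarrow>
     S 0 = id_blinfun \<and>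
     (\<forall>s t. 0 \<le> s \<and> 0 \<le> t \<longrightarrow> S (s + t) = S s o\<^sub>L S t) \<and>
     (\<forall>v. ((\<lambda>t. blinfun_apply (S t) v) \<longlongrightarrow> v) (at_right 0))"

definition generates ::
  "'v set \<Rightarrow> ('v \<Rightarrow> 'v) \<Rightarrow> (real \<Rightarrow> ('v::real_normed_vector \<Rightarrow>\<^sub>L 'v)) \<Rightarrow> bool" where
  "generates DA A S \<longleftrightarrow>
     c0_semigroup S \<and>
     DA = {v. \<exists>w. ((\<lambda>h. (1 / h) *\<^sub>R (blinfun_apply (S h) v - v)) \<longlongrightarrow> w) (at_right 0)} \<and>
     (\<forall>v\<in>DA. ((\<lambda>h. (1 / h) *\<^sub>R (blinfun_apply (S h) v - v)) \<longlongrightarrow> A v) (at_right 0))"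

definition adj_dom :: "'v set \<Rightarrow> ('v \<Rightarrow> 'v) \<Rightarrow> ('v::real_inner) set" where
  "adj_dom DA A = {v. \<exists>w. \<forall>x\<in>DA. inner (A x) v = inner x w}"

definition adj_op :: "'v set \<Rightarrow> ('v \<Rightarrow> 'v) \<Rightarrow> ('v::real_inner) \<Rightarrow> 'v" where
  "adj_op DA A v = (THE w. \<forall>x\<in>DA. inner (A x) v = inner x w)"

definition progressive ::
  "'w measure \<Rightarrow> (real \<Rightarrow> 'w measure) \<Rightarrow> real \<Rightarrow> (real \<Rightarrow> 'w \<Rightarrow> 'v::topological_space) \<Rightarrow> bool" where
  "progressive M F T Y \<longleftrightarrow>
     filtration (space M) F \<and> (\<forall>t. sets (F t) \<subseteq> sets M) \<and>
     (\<forall>t\<in>{0..T}. (\<lambda>(s, \<omega>). Y s \<omega>) \<in> (restrict_space borel {0..t} \<Otimes>\<^sub>M F t) \<rightarrow>\<^sub>M borel)"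

definition weakly_bochner_regular ::
  "'w measure \<Rightarrow> real \<Rightarrow> (real \<Rightarrow> 'w \<Rightarrow> 'v::real_inner) \<Rightarrow> bool" where
  "weakly_bochner_regular M T Y \<longleftrightarrow>
     (\<forall>g. continuous_on {0..T} g \<longrightarrow>
        (AE \<omega> in M. set_integrable lborel {0..T} (\<lambda>s. inner (Y s \<omega>) (g s)))) \<and>
     (\<forall>gs :: nat \<Rightarrow> real \<Rightarrow> 'v.
        (\<forall>n. continuous_on {0..T} (gs n)) \<and>
        (\<lambda>n. Sup ((\<lambda>s. norm (gs n s)) ` {0..T})) \<longlonglongrightarrow> 0 \<longrightarrow>
        conv_in_prob M (\<lambda>n \<omega>. LINT s:{0..T}|lborel. inner (Y s \<omega>) (gs n s)) (\<lambda>_. 0) sequentially)"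

definition weak_solution ::
  "'w measure \<Rightarrow> (real \<Rightarrow> 'w measure) \<Rightarrow> real \<Rightarrow> 'v set \<Rightarrow> ('v \<Rightarrow> 'v) \<Rightarrow> ('u::real_inner \<Rightarrow>\<^sub>L 'v)
    \<Rightarrow> (real \<Rightarrow> 'u \<Rightarrow> 'w \<Rightarrow> real) \<Rightarrow> 'v \<Rightarrow> (real \<Rightarrow> 'w \<Rightarrow> 'v::real_inner) \<Rightarrow> bool" where
  "weak_solution M F T DA A B L y0 Y \<longleftrightarrow>
     progressive M F T Y \<and> weakly_bochner_regular M T Y \<and>
     (\<forall>v\<in>adj_dom DA A. \<forall>t\<in>{0..T}.
        AE \<omega> in M. inner (Y t \<omega>) v =
          inner y0 v + (LINT s:{0..t}|lborel. inner (Y s \<omega>) (adj_op DA A v))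
          + L t (adjoint (blinfun_apply B) v) \<omega>)"

end

theory Submission
  imports Defs
begin

text \<open>
  Put \<open>R s h = Y (s + h) - S h (Y s)\<close>. Testing the weak equation against time-dependent functions that
  approximate the orbit of a vector under the adjoint semigroup expresses \<open>R s h\<close> through the increments
  of the noise on \<open>{s..s + h}\<close>, so its law does not depend on \<open>s\<close>. Hence a bounded quantity measuring the
  size of \<open>R s h\<close> equals its average over \<open>s\<close>, and the average tends to \<open>0\<close> as \<open>h\<close> does, because the
  paths of \<open>Y\<close> are measurable (continuity of translations in measure) and \<open>S h x\<close> tends to \<open>x\<close>. This
  gives continuity from the right. From the left one needs moreover that \<open>(S h - 1) (Y (t - h))\<close> is small;
  splitting \<open>Y (t - h) = R s r + S r (Y s)\<close> with \<open>s + r = t - h\<close>, replacing the law of \<open>R s r\<close> by that of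
  \<open>R 0 r\<close> and averaging over \<open>s\<close> reduces this to dominated convergence.
\<close>

subsection \<open>Riesz representation and adjoints\<close>

text \<open>The noise is cylindrical: \<open>l t v\<close> is a scalar variable for each fixed
  \<open>t\<close> and \<open>v\<close>, determined up to a null set that depends on both, and there
  is no vector-valued process against which the semigroup could be integrated. Hence the test
  functions are finite sums of scalar functions of time multiplied by vectors of
  \<open>adj_dom DA A\<close>: up to limits of Riemann sums they see finitely many real Levy
  processes at finitely many times. The orbit under the adjoint semigroup is run backwards, since
  its time derivative is then minus the adjoint generator and the drift cancels; it is smoothed,
  since an arbitrary orbit need not stay in the adjoint domain. The cancellation is only
  approximate, and the defect is \<open>Y\<close> integrated against a uniformly small continuous
  function, which is exactly what weak Bochner regularity controls. What is compared in this way are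
  characteristic functions of scalar products; \<open>psi\<close>, a Gaussian function of the norm,
  is a mean of cosines and leads from them to a quantity that detects convergence in probability in
  norm.\<close>

lemma riesz_representation:
  fixes f :: "'a::{real_inner,complete_space} \<Rightarrow> real"
  assumes "bounded_linear f"
  shows "\<exists>w. \<forall>x. f x = x \<bullet> w"
proof -
  interpret f: bounded_linear f by fact
  obtain K where K: "\<And>x. norm (f x) \<le> norm x * K" using f.bounded by blast
  \<comment> \<open>The representing vector is the minimiser of this functional.\<close>
  define p where "p x = x \<bullet> x - 2 * f x" for x
  have lb: "p x \<ge> - K\<^sup>2" for x
  proof -
    have "f x \<le> norm x * K" using K[of x] by simp
    moreover have "0 \<le> (norm x - K)\<^sup>2" by simp
    ultimately show ?thesis unfolding p_def by (simp add: power2_diff flip: power2_norm_eq_inner)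
  qed
  define m where "m = Inf (range p)"
  have bdd: "bdd_below (range p)" using lb by (intro bdd_belowI[of _ "- K\<^sup>2"]) auto
  have m_le: "m \<le> p x" for x unfolding m_def by (rule cInf_lower[OF _ bdd]) simp
  have "\<exists>x. p x < m + 1 / Suc n" for n
    using cInf_lessD[of "range p" "m + 1 / Suc n"] unfolding m_def by auto
  then obtain X where X: "\<And>n. p (X n) < m + 1 / Suc n" by metis
  \<comment> \<open>The parallelogram identity, with \<open>f\<close> linear. The value of
    \<open>p\<close> at a midpoint is at least \<open>m\<close>, so two nearly minimal points are
    close to each other; this makes the minimising sequence \<open>X\<close> Cauchy.\<close>
  have par: "norm (x - y) ^ 2 = 2 * p x + 2 * p y - 4 * p ((1/2) *\<^sub>R (x + y))" for x y
    unfolding p_def power2_norm_eq_inner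
    by (simp add: f.add f.scaleR inner_add_left inner_add_right inner_diff_left inner_diff_right
        inner_commute algebra_simps)
  have d: "norm (X i - X j) ^ 2 < 2 / Suc i + 2 / Suc j" for i j
    using par[of "X i" "X j"] X[of i] X[of j] m_le[of "(1/2) *\<^sub>R (X i + X j)"] by simp
  have "Cauchy X"
  proof (rule metric_CauchyI)
    fix e :: real assume e: "e > 0"
    obtain N :: nat where N: "N > 4 / e\<^sup>2" using reals_Archimedean2 by blast
    have "dist (X i) (X j) < e" if "i \<ge> N" "j \<ge> N" for i j
    proof -
      have "N > 0" using N e by (metis divide_pos_pos less_trans of_nat_0_less_iff zero_less_numeral zero_less_power)
      have "2 / real (Suc i) \<le> 2 / N" "2 / real (Suc j) \<le> 2 / N" using that \<open>N > 0\<close>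
        by (auto intro!: divide_left_mono)
      moreover have "4 / N < e\<^sup>2" using N \<open>N > 0\<close> e by (simp add: field_simps)
      ultimately have "norm (X i - X j) ^ 2 < e ^ 2" using d[of i j] by simp
      then show ?thesis using e by (simp add: dist_norm power_less_imp_less_base)
    qed
    then show "\<exists>N. \<forall>i\<ge>N. \<forall>j\<ge>N. dist (X i) (X j) < e" by blast
  qed
  then obtain w where w: "X \<longlonglongrightarrow> w" using Cauchy_convergent convergent_def by blast
  have "(\<lambda>n. p (X n)) \<longlonglongrightarrow> p w" unfolding p_def
    by (intro tendsto_intros w f.tendsto)
  moreover have "(\<lambda>n. m + 1 / Suc n) \<longlonglongrightarrow> m + 0"
    by (intro tendsto_intros LIMSEQ_Suc[OF lim_1_over_n])
  ultimately have pw: "p w \<le> m"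
    using X by (intro LIMSEQ_le[of "\<lambda>n. p (X n)" _ "\<lambda>n. m + 1 / Suc n"]) (auto intro: less_imp_le)
  have "f y = y \<bullet> w" for y
  proof (cases "y = 0")
    case False
    \<comment> \<open>\<open>p (w + t *\<^sub>R y) - p w\<close> is a quadratic polynomial in
      \<open>t\<close>, taken here at its vertex, where its value is minus
      \<open>t * t * (y \<bullet> y)\<close>; minimality of \<open>w\<close> then leaves only
      \<open>t = 0\<close>.\<close>
    define t where "t = (f y - y \<bullet> w) / (y \<bullet> y)"
    have yy: "y \<bullet> y > 0" using False by simp
    have ty: "t * (y \<bullet> y) = f y - y \<bullet> w" using yy by (simp add: t_def)
    have "p w \<le> p (w + t *\<^sub>R y)" using pw m_le order_trans by blast
    then have "0 \<le> 2 * t * (y \<bullet> w - f y) + t * (t * (y \<bullet> y))"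
      by (simp add: p_def f.add f.scaleR inner_add_left inner_add_right inner_commute algebra_simps)
    moreover have "y \<bullet> w - f y = - (t * (y \<bullet> y))" using ty by simp
    ultimately have "t * t * (y \<bullet> y) \<le> 0" by simp
    then have "t = 0" using yy by (auto simp: mult_le_0_iff)
    then show ?thesis using ty by simp
  qed (simp add: f.zero)
  then show ?thesis by blast
qed

text \<open>\<open>adjoint\<close> is a Hilbert choice among all functions that satisfy this
  identity; Riesz supplies, for every \<open>y\<close>, the value that such a function must
  take.\<close>

lemma inner_adjoint:
  fixes f :: "'a::{real_inner,complete_space} \<Rightarrow> 'b::real_inner"
  assumes "bounded_linear f"
  shows "x \<bullet> adjoint f y = f x \<bullet> y"
proof -
  have "\<exists>w. \<forall>x. f x \<bullet> y = x \<bullet> w" for y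
    by (rule riesz_representation) (intro bounded_linear_compose[OF bounded_linear_inner_left assms])
  then obtain g where "\<forall>x y. f x \<bullet> y = x \<bullet> g y" by metis
  then have "\<exists>g. \<forall>x y. f x \<bullet> y = x \<bullet> g y" by blast
  then have "\<forall>x y. f x \<bullet> y = x \<bullet> adjoint f y" unfolding adjoint_def by (rule someI_ex)
  then show ?thesis by simp
qed

text \<open>Integrals below are taken of scalar functions only, so vector identities and bounds are
  proved after testing with an arbitrary \<open>v\<close>. This lemma, with the witness
  \<open>v = x\<close>, and \<open>eq_if_inner_eq\<close> remove the test vector again.\<close>

lemma inner_le_imp_norm_le:
  fixes x :: "'a::real_inner"
  assumes "\<And>v. x \<bullet> v \<le> K * norm v" "K \<ge> 0"
  shows "norm x \<le> K"
proof (cases "x = 0")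
  case False
  have "norm x * norm x \<le> K * norm x" using assms(1)[of x] by (simp add: dot_square_norm power2_eq_square)
  then show ?thesis using False by simp
qed (use assms in simp)

lemma eq_if_inner_eq:
  fixes x y :: "'a::real_inner"
  assumes "\<And>v. x \<bullet> v = y \<bullet> v"
  shows "x = y"
proof -
  have "(x - y) \<bullet> (x - y) = 0" using assms[of "x - y"] by (simp add: inner_diff_left)
  then show ?thesis by simp
qed

subsection \<open>Strongly continuous semigroups\<close>

text \<open>The gliding hump: each \<open>X (Suc n)\<close> moves \<open>X n\<close> by at most \<open>3\<^sup>-\<^sup>n\<close> in a direction where the
  \<open>n\<close>-th operator is nearly as large as its norm; the sign is chosen to avoid cancellation.\<close>

lemma uniform_boundedness_sequence:
  fixes F :: "nat \<Rightarrow> ('a::{real_normed_vector,complete_space}) \<Rightarrow>\<^sub>L ('b::real_normed_vector)"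
  assumes "\<And>x. \<exists>C. \<forall>n. norm (F n x) \<le> C"
  shows "\<exists>n. norm (F n) < 4 ^ n"
proof (rule ccontr)
  assume "\<nexists>n. norm (F n) < 4 ^ n"
  then have big: "norm (F n) \<ge> 4 ^ n" for n by (simp add: not_less)
  have step: "\<exists>y. norm (y - x) \<le> (1/3) ^ n \<and> norm (F n y) \<ge> (2/3) * (1/3) ^ n * norm (F n)" for x n
  proof -
    have "\<exists>z. norm (F n z) > (2/3) * norm (F n) * norm z"
    proof (rule ccontr)
      assume "\<not> ?thesis"
      then have "norm (F n z) \<le> (2/3) * norm (F n) * norm z" for z by (simp add: not_less)
      then have "norm (F n) \<le> (2/3) * norm (F n)" by (intro norm_blinfun_bound) auto
      moreover have "norm (F n) > 0" using big[of n] by (meson less_le_trans zero_less_numeral zero_less_power)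
      ultimately show False by simp
    qed
    then obtain z where z: "norm (F n z) > (2/3) * norm (F n) * norm z" by blast
    have z0: "z \<noteq> 0" using z by auto
    define d where "d = ((1/3) ^ n / norm z) *\<^sub>R z"
    have nd: "norm d = (1/3) ^ n" using z0 by (simp add: d_def)
    have Fd: "norm (F n d) \<ge> (2/3) * (1/3) ^ n * norm (F n)"
    proof -
      have "(2/3) * (1/3) ^ n * norm (F n) = ((1/3) ^ n / norm z) * ((2/3) * norm (F n) * norm z)"
        using z0 by simp
      also have "\<dots> \<le> ((1/3) ^ n / norm z) * norm (F n z)" using z by (intro mult_left_mono) auto
      also have "\<dots> = norm (F n d)" by (simp add: d_def blinfun.scaleR_right)
      finally show ?thesis .
    qed
    have "norm (F n d) + norm (F n d) = norm (F n (x + d) - F n (x - d))"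
      by (simp add: blinfun.add_right blinfun.diff_right flip: scaleR_2) 
    also have "\<dots> \<le> norm (F n (x + d)) + norm (F n (x - d))" by (rule norm_triangle_ineq4)
    finally consider "norm (F n (x + d)) \<ge> norm (F n d)" | "norm (F n (x - d)) \<ge> norm (F n d)" by linarith
    then show ?thesis
    proof cases
      case 1 then show ?thesis using Fd nd by (intro exI[of _ "x + d"]) auto
    next
      case 2 then show ?thesis using Fd nd by (intro exI[of _ "x - d"]) auto
    qed
  qed
  define X where "X = rec_nat 0 (\<lambda>n x. SOME y. norm (y - x) \<le> (1/3) ^ n \<and> norm (F n y) \<ge> (2/3) * (1/3) ^ n * norm (F n))"
  have X: "norm (X (Suc n) - X n) \<le> (1/3) ^ n \<and> norm (F n (X (Suc n))) \<ge> (2/3) * (1/3) ^ n * norm (F n)" for n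
    unfolding X_def using someI_ex[OF step[of "X n" n]] by (simp add: X_def)
  \<comment> \<open>Partial sums of a geometric series: all later moves add up to at most
    \<open>(1/2) * (1/3) ^ n\<close>, against a gain of \<open>(2/3) * (1/3) ^ n\<close> times the
    operator norm in step \<open>n\<close>.\<close>
  have tail: "norm (X (Suc n + k) - X (Suc n)) \<le> (1/2) * (1/3) ^ n - (1/2) * (1/3) ^ (n + k)" for n k
  proof (induction k)
    case (Suc k)
    have "norm (X (Suc n + Suc k) - X (Suc n)) \<le> norm (X (Suc n + Suc k) - X (Suc n + k)) + norm (X (Suc n + k) - X (Suc n))"
      by norm
    also have "norm (X (Suc n + Suc k) - X (Suc n + k)) \<le> (1/3) ^ (Suc n + k)"
      using X[of "Suc n + k"] by simp
    finally show ?case using Suc by simp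
  qed simp
  have "Cauchy X"
  proof (rule metric_CauchyI)
    fix e :: real assume "e > 0"
    then obtain n where n: "(1/3) ^ n < e" using real_arch_pow_inv[of e "1/3"] by auto
    have *: "norm (X m - X (Suc n)) < e / 2" if "m \<ge> Suc n" for m
    proof -
      from le_Suc_ex[OF that] obtain k where m: "m = Suc n + k" ..
      have "(1/3::real) ^ (n + k) > 0" by simp
      then show ?thesis using tail[of n k] n unfolding m by linarith
    qed
    have "dist (X i) (X j) < e" if "i \<ge> Suc n" "j \<ge> Suc n" for i j
      using *[OF that(1)] *[OF that(2)] unfolding dist_norm by norm
    then show "\<exists>N. \<forall>i\<ge>N. \<forall>j\<ge>N. dist (X i) (X j) < e" by blast
  qed
  then obtain x where x: "X \<longlonglongrightarrow> x" using Cauchy_convergent convergent_def by blast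
  have lim: "norm (x - X (Suc n)) \<le> (1/2) * (1/3) ^ n" for n
  proof (rule LIMSEQ_le_const2)
    show "(\<lambda>k. norm (X (k + Suc n) - X (Suc n))) \<longlonglongrightarrow> norm (x - X (Suc n))"
      by (intro tendsto_intros LIMSEQ_ignore_initial_segment x)
    have "norm (X (k + Suc n) - X (Suc n)) \<le> (1/2) * (1/3) ^ n" for k
    proof -
      have "(1/3::real) ^ (n + k) > 0" by simp
      then show ?thesis using tail[of n k] unfolding add.commute[of k] by linarith
    qed
    then show "\<exists>N. \<forall>k\<ge>N. norm (X (k + Suc n) - X (Suc n)) \<le> (1/2) * (1/3) ^ n" by blast
  qed
  obtain C where C: "\<And>n. norm (F n x) \<le> C" using assms by blast
  \<comment> \<open>What survives of the gain is 2/3 - 1/2 = 1/6, and a norm of at least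
    \<open>4 ^ n\<close> against a step of \<open>(1/3) ^ n\<close> gives the ratio 4/3; any base
    above 3 would do in place of 4.\<close>
  have "(1/6) * (4/3) ^ n \<le> C" for n
  proof -
    have "norm (F n (x - X (Suc n))) \<le> norm (F n) * norm (x - X (Suc n))" by (rule norm_blinfun)
    also have "\<dots> \<le> norm (F n) * ((1/2) * (1/3) ^ n)" using lim by (intro mult_left_mono) auto
    finally have "(2/3) * (1/3) ^ n * norm (F n) - norm (F n) * ((1/2) * (1/3) ^ n)
        \<le> norm (F n (X (Suc n))) - norm (F n (x - X (Suc n)))" using X[of n] by linarith
    also have "\<dots> \<le> norm (F n x)" unfolding blinfun.diff_right by norm
    also have "\<dots> \<le> C" by (rule C)
    finally have "(1/6) * ((1/3) ^ n * norm (F n)) \<le> C" by (simp add: algebra_simps)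
    moreover have "(1/3) ^ n * 4 ^ n \<le> (1/3) ^ n * norm (F n)" using big by (intro mult_left_mono) auto
    moreover have "(1/3) ^ n * 4 ^ n = (4/3::real) ^ n" by (simp flip: power_mult_distrib)
    ultimately show ?thesis by linarith
  qed
  then have small: "(4/3) ^ n \<le> 6 * C" for n by (simp add: field_simps)
  obtain n where "6 * C < (4/3) ^ n" using real_arch_pow[of "4/3" "6 * C"] by auto
  then show False using small[of n] by simp
qed

locale semigroup =
  fixes S :: "real \<Rightarrow> ('v::{real_inner,complete_space}) \<Rightarrow>\<^sub>L 'v"
  assumes c0: "c0_semigroup S"
begin

lemma S_0 [simp]: "S 0 x = x"
  using c0 by (simp add: c0_semigroup_def)

lemma S_add: "s \<ge> 0 \<Longrightarrow> t \<ge> 0 \<Longrightarrow> S (s + t) x = S s (S t x)"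
  using c0 by (simp add: c0_semigroup_def)

lemma S_right_0: "((\<lambda>t. S t x) \<longlongrightarrow> x) (at_right 0)"
  using c0 by (simp add: c0_semigroup_def)

text \<open>Otherwise there are times \<open>t n\<close> tending to 0 with operator norms above
  \<open>4 ^ n\<close>, although \<open>S (t n) x\<close> tends to \<open>x\<close> and is therefore
  bounded for every \<open>x\<close>; uniform boundedness forbids this.\<close>

lemma S_bounded_near_0: "\<exists>d>0. \<exists>K. \<forall>t\<in>{0..d}. norm (S t) \<le> K"
proof (rule ccontr)
  assume neg: "\<not> ?thesis"
  have "\<exists>t\<in>{0<..1 / Suc n}. norm (S t) > 4 ^ n" for n
  proof -
    \<comment> \<open>Exceeding \<open>norm (S 0)\<close> as well rules out \<open>t = 0\<close>, a
      point that the filter \<open>at_right 0\<close> does not see.\<close>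
    have "\<exists>t\<in>{0..1 / Suc n}. norm (S t) > max (4 ^ n) (norm (S 0))" using neg
      by (metis linorder_not_less of_nat_0_less_iff zero_less_Suc zero_less_divide_1_iff)
    then show ?thesis by (metis atLeastAtMost_iff greaterThanAtMost_iff max_less_iff_conj order_less_irrefl order_less_le)
  qed
  then obtain t where t: "\<And>n. t n \<in> {0<..1 / Suc n}" "\<And>n. norm (S (t n)) > 4 ^ n" by metis
  have "t \<longlonglongrightarrow> 0"
    using t(1) by (intro tendsto_sandwich[OF _ _ tendsto_const LIMSEQ_Suc[OF lim_1_over_n]]) (auto intro!: always_eventually less_imp_le)
  then have "filterlim t (at_right 0) sequentially"
    using t(1) by (auto simp: filterlim_at less_imp_neq[THEN not_sym] intro!: always_eventually)
  then have "(\<lambda>n. S (t n) x) \<longlonglongrightarrow> x" for x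
    using S_right_0 filterlim_compose by blast
  then have "\<exists>C. \<forall>n. norm (S (t n) x) \<le> C" for x
    by (meson BseqD convergentI convergent_imp_Bseq)
  then have "\<exists>n. norm (S (t n)) < 4 ^ n" by (rule uniform_boundedness_sequence)
  then show False using t(2) by (meson less_asym)
qed

lemma S_bounded: "\<exists>K. \<forall>t\<in>{0..b}. norm (S t) \<le> K"
proof -
  obtain d K where d: "d > 0" and K: "\<And>t. t \<in> {0..d} \<Longrightarrow> norm (S t) \<le> K"
    using S_bounded_near_0 by blast
  have "\<exists>K. \<forall>t\<in>{0..real n * d}. norm (S t) \<le> K" for n
  proof (induction n)
    case (Suc n)
    then obtain K' where K': "\<And>t. t \<in> {0..real n * d} \<Longrightarrow> norm (S t) \<le> K'" by blast
    have "norm (S t) \<le> max K (K * K')" if t: "t \<in> {0..real (Suc n) * d}" for t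
    proof (cases "t \<le> d")
      case True then show ?thesis using K t by (simp add: le_max_iff_disj)
    next
      case False
      have "S t = S d o\<^sub>L S (t - d)"
        by (rule blinfun_eqI) (use S_add[of d "t - d"] False d in simp)
      then have "norm (S t) \<le> norm (S d) * norm (S (t - d))" by (simp add: norm_blinfun_compose)
      also have "\<dots> \<le> K * K'" using K[of d] K'[of "t - d"] t False d
        by (intro mult_mono) (auto simp: algebra_simps intro: order_trans[OF norm_ge_zero])
      finally show ?thesis by simp
    qed
    then show ?case by blast
  qed (use K d in auto)
  moreover obtain n :: nat where "b / d < n" using reals_Archimedean2 by blast
  ultimately show ?thesis using d
    by (metis atLeastAtMost_iff less_imp_le order_trans pos_divide_less_eq)
qed



text \<open>Factoring out the operator at the earlier time leaves a bound in which only
  \<open>t - s\<close> occurs, so that right-continuity at 0 gives continuity from both sides at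
  every time.\<close>

lemma S_norm_diff_le:
  assumes K: "\<And>r. r \<in> {0..b} \<Longrightarrow> norm (S r) \<le> K" and "0 \<le> s" "s \<le> t" "s \<le> b"
  shows "norm (S t x - S s x) \<le> K * norm (S (t - s) x - x)"
proof -
  have "S t x - S s x = S s (S (t - s) x - x)"
    using S_add[of s "t - s" x] assms by (simp add: blinfun.diff_right)
  also have "norm \<dots> \<le> norm (S s) * norm (S (t - s) x - x)" by (rule norm_blinfun)
  also have "\<dots> \<le> K * norm (S (t - s) x - x)" using assms by (intro mult_right_mono) auto
  finally show ?thesis .
qed

lemma S_near_0:
  assumes "e > 0"
  obtains d where "d > 0" "\<And>r. 0 \<le> r \<Longrightarrow> r < d \<Longrightarrow> norm (S r x - x) < e"
proof -
  have "\<forall>\<^sub>F r in at_right 0. dist (S r x) x < e" using S_right_0 assms by (rule tendstoD)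
  then obtain d where "d > 0" "\<And>r. r > 0 \<Longrightarrow> r < d \<Longrightarrow> norm (S r x - x) < e"
    unfolding eventually_at_right_field dist_norm by auto
  then show ?thesis using assms that[of d] by (metis S_0 diff_self norm_zero order_le_less)
qed

lemma S_continuous: "continuous_on {0..b} (\<lambda>t. S t x)"
proof -
  obtain K where K: "\<And>r. r \<in> {0..b} \<Longrightarrow> norm (S r) \<le> K" using S_bounded by blast
  show ?thesis unfolding continuous_on_iff
  proof (intro ballI allI impI)
    fix t e :: real assume t: "t \<in> {0..b}" and e: "e > 0"
    have K0: "K \<ge> 0" using K[OF t] norm_ge_zero order_trans by blast
    obtain d where d: "d > 0" "\<And>r. 0 \<le> r \<Longrightarrow> r < d \<Longrightarrow> norm (S r x - x) < e / (K + 1)"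
      using S_near_0[of "e / (K + 1)" x] e K0 by auto
    have *: "norm (S t x - S s x) < e" if "0 \<le> s" "s \<le> t" "s \<le> b" "t - s < d" for s t
    proof -
      have "norm (S t x - S s x) \<le> K * norm (S (t - s) x - x)" by (rule S_norm_diff_le[of b]) (use that K in auto)
      also have "\<dots> \<le> K * (e / (K + 1))" using d(2)[of "t - s"] that K0 by (intro mult_left_mono) auto
      also have "\<dots> < e" using K0 e by (simp add: field_simps)
      finally show ?thesis .
    qed
    have "dist (S s x) (S t x) < e" if "s \<in> {0..b}" "dist s t < d" for s
      using *[of s t] *[of t s] that t by (cases "s \<le> t") (auto simp: dist_norm norm_minus_commute)
    then show "\<exists>d>0. \<forall>s\<in>{0..b}. dist s t < d \<longrightarrow> dist (S s x) (S t x) < e" using d(1) by blast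
  qed
qed

end

text \<open>\<open>w\<close> is the integral of \<open>f\<close> in the weak sense only; the usual
  norm estimate survives because every test vector produces a scalar integral.\<close>

lemma weak_integral_norm_le:
  fixes f :: "real \<Rightarrow> 'v::real_inner"
  assumes f: "\<And>v. (\<lambda>r. f r \<bullet> v) integrable_on {a..b}" and "a \<le> b"
    and w: "\<And>v. w \<bullet> v = integral {a..b} (\<lambda>r. f r \<bullet> v)"
    and K: "\<And>r. r \<in> {a..b} \<Longrightarrow> norm (f r) \<le> K"
  shows "norm w \<le> K * (b - a)"
proof (rule inner_le_imp_norm_le)
  have "0 \<le> K" using K[of a] \<open>a \<le> b\<close> norm_ge_zero order_trans by (metis atLeastAtMost_iff order_refl)
  then show "0 \<le> K * (b - a)" using \<open>a \<le> b\<close> by simp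
  fix v
  have "integral {a..b} (\<lambda>r. f r \<bullet> v) \<le> integral {a..b} (\<lambda>r. K * norm v)"
  proof (rule integral_le)
    show "(\<lambda>r. f r \<bullet> v) integrable_on {a..b}" by (rule f)
    fix r assume "r \<in> {a..b}"
    then have "norm (f r) * norm v \<le> K * norm v" using K by (intro mult_right_mono) auto
    then show "f r \<bullet> v \<le> K * norm v" using norm_cauchy_schwarz[of "f r" v] by linarith
  qed (rule integrable_const_ivl)
  then show "w \<bullet> v \<le> K * (b - a) * norm v" unfolding w using \<open>a \<le> b\<close> by (simp add: algebra_simps)
qed

lemma integral_shift_interval:
  "integral {a..b::real} (\<lambda>x. f (x + c)) = integral {a + c..b + c} f"
  using integral_shift_Icc_real[of a b f c] by (simp add: o_def add.commute)

lemma integral_reflect_interval: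
  "integral {a..b::real} (\<lambda>x. f (c - x)) = integral {c - b..c - a} f"
  using Henstock_Kurzweil_Integration.integral_reflect_real[of "-a" "-b" "\<lambda>x. f (c + x)"]
    integral_shift_interval[of "-b" "-a" f c] by (simp add: add.commute)

section \<open>Orbit means and difference quotients of the semigroup\<close>

context semigroup
begin

text \<open>For \<open>e > 0\<close> this bounded operator is \<open>A\<close> after
  \<open>J e\<close> everywhere, and \<open>J e\<close> after \<open>A\<close> on \<open>DA\<close>.
  Below, \<open>Q e\<close> therefore stands for an application of the generator to a smoothed
  vector.\<close>

definition Q :: "real \<Rightarrow> 'v \<Rightarrow>\<^sub>L 'v" where
  "Q e = (1 / e) *\<^sub>R (S e - id_blinfun)"

text \<open>\<open>J e x\<close> is the mean of the orbit of \<open>x\<close> over \<open>{0..e}\<close>, defined weakly because the type of \<open>x\<close>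
  is not of class banach, which vector-valued integrals require.\<close>

definition J_fun :: "real \<Rightarrow> 'v \<Rightarrow> 'v" where
  "J_fun e x = (SOME w. \<forall>v. w \<bullet> v = integral {0..e} (\<lambda>r. S r x \<bullet> v) / e)"

definition J :: "real \<Rightarrow> 'v \<Rightarrow>\<^sub>L 'v" where
  "J e = Blinfun (J_fun e)"

lemma Q_apply: "Q e x = (1 / e) *\<^sub>R (S e x - x)"
  by (simp add: Q_def blinfun.scaleR_left blinfun.diff_left)

lemma S_inner_integrable: "0 \<le> a \<Longrightarrow> (\<lambda>r. S r x \<bullet> v) integrable_on {a..b}"
  by (intro integrable_continuous_real continuous_intros continuous_on_subset[OF S_continuous[of b]]) auto

lemma S_shift_continuous: "0 \<le> c \<Longrightarrow> continuous_on {0..b} (\<lambda>t. S (t + c) x)"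
  by (rule continuous_on_compose2[OF S_continuous[of "b + c" x]]) (auto intro!: continuous_intros)

lemma S_inner_integral_le:
  assumes "0 \<le> a" "a \<le> b" and K: "\<And>r. r \<in> {0..b} \<Longrightarrow> norm (S r) \<le> K"
  shows "\<bar>integral {a..b} (\<lambda>r. S r x \<bullet> v)\<bar> \<le> K * norm x * norm v * (b - a)"
proof -
  have "norm (integral {a..b} (\<lambda>r. S r x \<bullet> v)) \<le> K * norm x * norm v * (b - a)"
  proof (rule integral_bound)
    fix r assume r: "r \<in> {a..b}"
    have "\<bar>S r x \<bullet> v\<bar> \<le> norm (S r x) * norm v" by (rule Cauchy_Schwarz_ineq2)
    also have "\<dots> \<le> (K * norm x) * norm v"
      using r assms by (intro mult_right_mono order_trans[OF norm_blinfun] K) auto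
    finally show "norm (S r x \<bullet> v) \<le> K * norm x * norm v" by simp
  qed (use assms in \<open>auto intro!: continuous_intros continuous_on_subset[OF S_continuous[of b]]\<close>)
  then show ?thesis by simp
qed

text \<open>The local bound on \<open>S\<close> makes the right-hand side a bounded functional of
  \<open>v\<close>, so Riesz provides the witness for the choice in \<open>J_fun\<close>.\<close>

lemma inner_J_fun:
  assumes "e > 0"
  shows "J_fun e x \<bullet> v = integral {0..e} (\<lambda>r. S r x \<bullet> v) / e"
proof -
  obtain K where K: "\<And>r. r \<in> {0..e} \<Longrightarrow> norm (S r) \<le> K" using S_bounded by blast
  have "bounded_linear (\<lambda>v. integral {0..e} (\<lambda>r. S r x \<bullet> v) / e)"
  proof (rule bounded_linear_intro[where K = "K * norm x"])
    show "integral {0..e} (\<lambda>r. S r x \<bullet> (v + w)) / e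
        = integral {0..e} (\<lambda>r. S r x \<bullet> v) / e + integral {0..e} (\<lambda>r. S r x \<bullet> w) / e" for v w
      by (simp add: inner_add_right integral_add S_inner_integrable add_divide_distrib)
    show "norm (integral {0..e} (\<lambda>r. S r x \<bullet> v) / e) \<le> norm v * (K * norm x)" for v
      using S_inner_integral_le[of 0 e K x v] K assms by (simp add: field_simps)
  qed simp
  from riesz_representation[OF this]
  have "\<exists>w. \<forall>v. w \<bullet> v = integral {0..e} (\<lambda>r. S r x \<bullet> v) / e" by (metis inner_commute)
  then have "\<forall>v. J_fun e x \<bullet> v = integral {0..e} (\<lambda>r. S r x \<bullet> v) / e"
    unfolding J_fun_def by (rule someI_ex)
  then show ?thesis by simp
qed

lemma inner_J:
  assumes "e > 0"
  shows "J e x \<bullet> v = integral {0..e} (\<lambda>r. S r x \<bullet> v) / e"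
proof -
  obtain K where K: "\<And>r. r \<in> {0..e} \<Longrightarrow> norm (S r) \<le> K" using S_bounded by blast
  have "bounded_linear (J_fun e)"
  proof (rule bounded_linear_intro)
    show "J_fun e (x + y) = J_fun e x + J_fun e y" for x y
      by (rule eq_if_inner_eq)
        (simp add: inner_J_fun[OF assms] inner_add_left blinfun.add_right integral_add S_inner_integrable add_divide_distrib)
    show "J_fun e (c *\<^sub>R x) = c *\<^sub>R J_fun e x" for c x
      by (rule eq_if_inner_eq) (simp add: inner_J_fun[OF assms] blinfun.scaleR_right)
    show "norm (J_fun e x) \<le> norm x * K" for x
    proof (rule inner_le_imp_norm_le)
      show "J_fun e x \<bullet> v \<le> norm x * K * norm v" for v
        using S_inner_integral_le[of 0 e K x v] K assms by (simp add: inner_J_fun[OF assms] field_simps)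
      have "0 \<le> K" using order_trans[OF norm_ge_zero K[of 0]] assms by simp
      then show "0 \<le> norm x * K" by simp
    qed
  qed
  then show ?thesis by (simp add: J_def bounded_linear_Blinfun_apply inner_J_fun[OF assms])
qed

text \<open>\<open>J e\<close> is known only through scalar products: \<open>S t\<close> is moved to
  the test vector by its adjoint and comes back inside the scalar integral.\<close>

lemma J_commute_S: "e > 0 \<Longrightarrow> t \<ge> 0 \<Longrightarrow> J e (S t x) = S t (J e x)"
proof (rule eq_if_inner_eq)
  fix v assume e: "e > 0" and t: "t \<ge> 0"
  have "S t (J e x) \<bullet> v = J e x \<bullet> adjoint (S t) v" by (simp add: inner_adjoint blinfun.bounded_linear_right)
  also have "\<dots> = integral {0..e} (\<lambda>r. S r (S t x) \<bullet> v) / e"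
    unfolding inner_J[OF e] using t
    by (auto simp: inner_adjoint blinfun.bounded_linear_right add.commute simp flip: S_add intro!: integral_cong)
  finally show "J e (S t x) \<bullet> v = S t (J e x) \<bullet> v" by (simp add: inner_J[OF e])
qed

lemma J_commute_Q: "e > 0 \<Longrightarrow> J e (Q e x) = Q e (J e x)"
  by (simp add: Q_apply blinfun.scaleR_right blinfun.diff_right J_commute_S)

text \<open>The fundamental theorem of calculus for a smoothed orbit, with \<open>Q e x\<close> as
  its derivative at 0. Nothing is differentiated: if \<open>G\<close> is a primitive of the scalar
  orbit, both sides are the same combination of \<open>G\<close> at \<open>s\<close>,
  \<open>s + e\<close>, \<open>t\<close> and \<open>t + e\<close>, divided by
  \<open>e\<close>.\<close>

lemma S_J_diff:
  assumes e: "e > 0" and "0 \<le> s" "s \<le> t"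
  shows "(S t (J e x) - S s (J e x)) \<bullet> v = integral {s..t} (\<lambda>r. S r (Q e x) \<bullet> v)"
proof -
  define g where "g r = S r x \<bullet> v" for r
  define G where "G u = integral {0..u} g" for u
  have gi: "g integrable_on {a..b}" if "0 \<le> a" for a b unfolding g_def using that by (rule S_inner_integrable)
  have G: "integral {a..b} g = G b - G a" if "0 \<le> a" "a \<le> b" for a b
    unfolding G_def using Henstock_Kurzweil_Integration.integral_combine[of 0 a b g] gi[of 0 b] that by simp
  have L: "S r (J e x) \<bullet> v = (G (r + e) - G r) / e" if "r \<ge> 0" for r
  proof -
    have "S r (J e x) \<bullet> v = integral {0..e} (\<lambda>q. g (q + r)) / e"
      unfolding J_commute_S[OF e that, symmetric] inner_J[OF e] g_def using that
      by (auto simp flip: S_add intro!: integral_cong)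
    also have "\<dots> = (G (r + e) - G r) / e" unfolding integral_shift_interval using G[of r "r + e"] that e
      by (simp add: add.commute)
    finally show ?thesis .
  qed
  have "integral {s..t} (\<lambda>r. S r (Q e x) \<bullet> v) = integral {s..t} (\<lambda>r. (g (r + e) - g r) / e)"
    using assms by (intro integral_cong)
      (simp add: Q_apply g_def S_add blinfun.scaleR_right blinfun.diff_right inner_diff_left)
  also have "\<dots> = (integral {s..t} (\<lambda>r. g (r + e)) - integral {s..t} g) / e"
  proof -
    have "(\<lambda>r. g (r + e)) integrable_on {s..t}" unfolding g_def using assms
      by (intro integrable_continuous_real continuous_intros continuous_on_subset[OF S_shift_continuous[of e t]]) auto
    then show ?thesis using gi[of s t] assms by (simp add: Henstock_Kurzweil_Integration.integral_diff)
  qed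
  also have "\<dots> = ((G (t + e) - G (s + e)) - (G t - G s)) / e"
    unfolding integral_shift_interval using assms by (simp add: G)
  finally show ?thesis unfolding inner_diff_left using assms by (simp add: L diff_divide_distrib)
qed

lemma J_tendsto: "((\<lambda>e. J e x) \<longlongrightarrow> x) (at_right 0)"
proof (rule tendstoI)
  fix \<epsilon> :: real assume \<epsilon>: "\<epsilon> > 0"
  obtain d where d: "d > 0" "\<And>r. 0 \<le> r \<Longrightarrow> r < d \<Longrightarrow> norm (S r x - x) < \<epsilon> / 2"
    using S_near_0[of "\<epsilon> / 2" x] \<epsilon> by auto
  have "dist (J e x) x < \<epsilon>" if e: "0 < e" "e < d" for e
  proof -
    have "norm (e *\<^sub>R (J e x - x)) \<le> (\<epsilon> / 2) * (e - 0)"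
    proof (rule weak_integral_norm_le[where f = "\<lambda>r. S r x - x"])
      show "e *\<^sub>R (J e x - x) \<bullet> v = integral {0..e} (\<lambda>r. (S r x - x) \<bullet> v)" for v
        using e by (simp add: inner_diff_left inner_J Henstock_Kurzweil_Integration.integral_diff integrable_const_ivl S_inner_integrable algebra_simps)
    qed (use e less_imp_le[OF d(2)] in \<open>auto intro!: integrable_continuous_real continuous_intros S_continuous\<close>)
    then have "norm (J e x - x) \<le> \<epsilon> / 2" using e by simp
    then show ?thesis using \<epsilon> by (simp add: dist_norm)
  qed
  then show "\<forall>\<^sub>F e in at_right 0. dist (J e x) x < \<epsilon>"
    using d(1) unfolding eventually_at_right_field by blast
qed

end

section \<open>The generator and its adjoint\<close>

locale generator = semigroup S for S :: "real \<Rightarrow> ('v::{real_inner,complete_space}) \<Rightarrow>\<^sub>L 'v" +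
  fixes DA :: "'v set" and A :: "'v \<Rightarrow> 'v"
  assumes gen: "generates DA A S"
begin

lemma generator_tendsto: "x \<in> DA \<Longrightarrow> ((\<lambda>h. (1 / h) *\<^sub>R (S h x - x)) \<longlongrightarrow> A x) (at_right 0)"
  using gen by (simp add: generates_def)

text \<open>By \<open>S_J_diff\<close> the difference quotient at \<open>J e x\<close> is the mean
  of \<open>S r (Q e x)\<close> over \<open>{0..h}\<close>, which tends to \<open>Q e x\<close>;
  this limit is the value of the generator there.\<close>

lemma J_in_DA:
  assumes e: "e > 0"
  shows "J e x \<in> DA"
proof -
  have "((\<lambda>h. (1 / h) *\<^sub>R (S h (J e x) - J e x)) \<longlongrightarrow> Q e x) (at_right 0)"
  proof (rule tendstoI)
    fix \<epsilon> :: real assume \<epsilon>: "\<epsilon> > 0"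
    obtain d where d: "d > 0" "\<And>r. 0 \<le> r \<Longrightarrow> r < d \<Longrightarrow> norm (S r (Q e x) - Q e x) < \<epsilon> / 2"
      using S_near_0[of "\<epsilon> / 2" "Q e x"] \<epsilon> by auto
    have "dist ((1 / h) *\<^sub>R (S h (J e x) - J e x)) (Q e x) < \<epsilon>" if h: "0 < h" "h < d" for h
    proof -
      have "norm ((S h (J e x) - J e x) - h *\<^sub>R Q e x) \<le> (\<epsilon> / 2) * (h - 0)"
      proof (rule weak_integral_norm_le[where f = "\<lambda>r. S r (Q e x) - Q e x"])
        show "((S h (J e x) - J e x) - h *\<^sub>R Q e x) \<bullet> v = integral {0..h} (\<lambda>r. (S r (Q e x) - Q e x) \<bullet> v)" for v
          using h S_J_diff[OF e, of 0 h x v] by (simp add: inner_diff_left Henstock_Kurzweil_Integration.integral_diff integrable_const_ivl S_inner_integrable)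
      qed (use h less_imp_le[OF d(2)] in \<open>auto intro!: integrable_continuous_real continuous_intros S_continuous\<close>)
      then have "(1 / h) * norm ((S h (J e x) - J e x) - h *\<^sub>R Q e x) \<le> (1 / h) * ((\<epsilon> / 2) * (h - 0))"
        using h by (intro mult_left_mono) auto
      moreover have "(1 / h) *\<^sub>R (S h (J e x) - J e x) - Q e x = (1 / h) *\<^sub>R ((S h (J e x) - J e x) - h *\<^sub>R Q e x)"
        using h by (simp add: scaleR_diff_right)
      ultimately have "norm ((1 / h) *\<^sub>R (S h (J e x) - J e x) - Q e x) \<le> (1 / h) * ((\<epsilon> / 2) * (h - 0))" using h
        by (simp only: norm_scaleR abs_of_pos[of "1 / h"] zero_less_divide_1_iff)
      then show ?thesis using \<epsilon> h by (simp add: dist_norm)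
    qed
    then show "\<forall>\<^sub>F h in at_right 0. dist ((1 / h) *\<^sub>R (S h (J e x) - J e x)) (Q e x) < \<epsilon>"
      using d(1) unfolding eventually_at_right_field by blast
  qed
  then show ?thesis using gen unfolding generates_def by blast
qed

text \<open>\<open>J e\<close> is bounded and commutes with the semigroup, so it passes through the
  limit defining \<open>A x\<close> and turns the quotient into a mean of
  \<open>S r (Q e x)\<close>. Composition with \<open>J e\<close> thus replaces \<open>A\<close> by
  a bounded operator.\<close>

lemma J_A:
  assumes e: "e > 0" and x: "x \<in> DA"
  shows "J e (A x) = Q e x"
proof (rule eq_if_inner_eq)
  fix v
  have "((\<lambda>h. J e ((1 / h) *\<^sub>R (S h x - x)) \<bullet> v) \<longlongrightarrow> J e (A x) \<bullet> v) (at_right 0)"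
    by (intro tendsto_intros generator_tendsto x)
  moreover have "((\<lambda>h. J e ((1 / h) *\<^sub>R (S h x - x)) \<bullet> v) \<longlongrightarrow> Q e x \<bullet> v) (at_right 0)"
  proof -
    define H where "H t = integral {0..t} (\<lambda>r. S r (Q e x) \<bullet> v)" for t
    have "(H has_vector_derivative S 0 (Q e x) \<bullet> v) (at 0 within {0..1})" unfolding H_def
      by (rule integral_has_vector_derivative) (auto intro!: continuous_intros S_continuous)
    then have "(H has_real_derivative Q e x \<bullet> v) (at 0 within {0..1})"
      by (simp add: has_real_derivative_iff_has_vector_derivative)
    then have "((\<lambda>h. (H h - H 0) / (h - 0)) \<longlongrightarrow> Q e x \<bullet> v) (at 0 within {0..1})"
      by (simp add: has_field_derivative_iff)
    then have "((\<lambda>h. H h / h) \<longlongrightarrow> Q e x \<bullet> v) (at_right 0)"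
      by (simp add: at_within_Icc_at_right H_def)
    moreover have "\<forall>\<^sub>F h in at_right 0. H h / h = J e ((1 / h) *\<^sub>R (S h x - x)) \<bullet> v"
      unfolding eventually_at_right_field
    proof (intro exI[of _ 1] conjI allI impI)
      fix h :: real assume "0 < h"
      then show "H h / h = J e ((1 / h) *\<^sub>R (S h x - x)) \<bullet> v"
        using S_J_diff[OF e, of 0 h x v]
        by (simp add: H_def blinfun.scaleR_right blinfun.diff_right J_commute_S e)
    qed simp
    ultimately show ?thesis by (rule Lim_transform_eventually)
  qed
  ultimately show "J e (A x) \<bullet> v = Q e x \<bullet> v"
    by (rule tendsto_unique[OF trivial_limit_at_right_real])
qed

text \<open>\<open>adj_op\<close> is a definite description, so its value rests on uniqueness, that
  is, on the density of \<open>DA\<close>: the vectors \<open>J e x\<close> lie in \<open>DA\<close>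
  and tend to \<open>x\<close>.\<close>

lemma adj_op_eqI:
  assumes "\<And>x. x \<in> DA \<Longrightarrow> A x \<bullet> v = x \<bullet> w"
  shows "v \<in> adj_dom DA A" "adj_op DA A v = w"
proof -
  show "v \<in> adj_dom DA A" using assms unfolding adj_dom_def by blast
  show "adj_op DA A v = w" unfolding adj_op_def
  proof (rule the_equality)
    show "\<forall>x\<in>DA. A x \<bullet> v = x \<bullet> w" using assms by blast
    fix u assume u: "\<forall>x\<in>DA. A x \<bullet> v = x \<bullet> u"
    have "((\<lambda>e. J e (u - w) \<bullet> (u - w)) \<longlongrightarrow> (u - w) \<bullet> (u - w)) (at_right 0)"
      by (intro tendsto_intros J_tendsto)
    moreover have "\<forall>\<^sub>F e in at_right 0. J e (u - w) \<bullet> (u - w) = 0"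
      using assms u J_in_DA unfolding eventually_at_right_field
      by (intro exI[of _ 1]) (auto simp: inner_diff_right)
    ultimately have "((\<lambda>e::real. 0::real) \<longlongrightarrow> (u - w) \<bullet> (u - w)) (at_right 0)"
      by (rule Lim_transform_eventually)
    then have "(u - w) \<bullet> (u - w) = 0"
      by (simp add: tendsto_const_iff trivial_limit_at_right_real)
    then show "u = w" by simp
  qed
qed

end

subsection \<open>Approximation of adjoint orbits by finite-dimensional test functions\<close>

text \<open>For \<open>k\<close> binomial with parameters \<open>n\<close> and \<open>x\<close> this
  is the variance of \<open>k / n\<close>; it follows from the moments of order zero, one and
  two.\<close>

lemma Bernstein_variance:
  assumes "n > 0"
  shows "(\<Sum>k\<le>n. (x - k / n)\<^sup>2 * Bernstein n k x) = x * (1 - x) / n"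
proof -
  have *: "(x - k / n)\<^sup>2 * Bernstein n k x = (1 / (real n)\<^sup>2) * (real k * (real k - 1) * Bernstein n k x)
      + ((1 - 2 * (real n * x)) / (real n)\<^sup>2) * (real k * Bernstein n k x) + x\<^sup>2 * Bernstein n k x" for k
    using assms by (simp add: power2_eq_square field_simps)
  have "(\<Sum>k\<le>n. (x - k / n)\<^sup>2 * Bernstein n k x) = (1 / (real n)\<^sup>2) * (real n * (real n - 1) * x\<^sup>2)
      + ((1 - 2 * (real n * x)) / (real n)\<^sup>2) * (real n * x) + x\<^sup>2 * 1"
    unfolding * sum.distrib sum_distrib_left[symmetric] by simp
  also have "\<dots> = x * (1 - x) / n" using assms by (simp add: power2_eq_square field_simps)
  finally show ?thesis .
qed

text \<open>A quantitative Bernstein theorem for values in a normed space. The bound of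
  \<open>\<bar>t\<bar>\<close> by \<open>\<epsilon>\<close> plus \<open>1 / \<epsilon>\<close> times
  the square of \<open>t\<close> takes the part of Chebyshev's inequality: averaged with the
  Bernstein weights, its square term is the variance, at most \<open>1 / n\<close>.\<close>

lemma Bernstein_approx_Lipschitz:
  fixes f :: "real \<Rightarrow> 'a::real_normed_vector"
  assumes n: "n > 0" and x: "x \<in> {0..1}" and \<epsilon>: "\<epsilon> > 0" and K: "K \<ge> 0"
    and lip: "\<And>x y. x \<in> {0..1} \<Longrightarrow> y \<in> {0..1} \<Longrightarrow> norm (f x - f y) \<le> K * \<bar>x - y\<bar>"
  shows "norm (f x - (\<Sum>k\<le>n. Bernstein n k x *\<^sub>R f (k / n))) \<le> K * (\<epsilon> + 1 / (\<epsilon> * n))"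
proof -
  have B: "Bernstein n k x \<ge> 0" for k using x by (intro Bernstein_nonneg) auto
  have "f x = (\<Sum>k\<le>n. Bernstein n k x) *\<^sub>R f x" by simp
  then have "f x - (\<Sum>k\<le>n. Bernstein n k x *\<^sub>R f (k / n)) = (\<Sum>k\<le>n. Bernstein n k x *\<^sub>R (f x - f (k / n)))"
    unfolding scaleR_diff_right sum_subtractf scaleR_left.sum by metis
  also have "norm \<dots> \<le> (\<Sum>k\<le>n. K * (\<epsilon> * Bernstein n k x + (1 / \<epsilon>) * ((x - k / n)\<^sup>2 * Bernstein n k x)))"
  proof (rule sum_norm_le)
    fix k assume k: "k \<in> {..n}"
    have a: "\<bar>t\<bar> \<le> \<epsilon> + (1 / \<epsilon>) * t\<^sup>2" for t
    proof (cases "\<bar>t\<bar> \<le> \<epsilon>")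
      case False
      then have "\<epsilon> * \<bar>t\<bar> \<le> \<bar>t\<bar> * \<bar>t\<bar>" by (intro mult_right_mono) auto
      then have "\<bar>t\<bar> \<le> (1 / \<epsilon>) * t\<^sup>2" using \<epsilon> by (simp add: field_simps power2_eq_square)
      then show ?thesis using \<epsilon> by linarith
    qed (use \<epsilon> in \<open>simp add: add_increasing2\<close>)
    have "norm (f x - f (k / n)) \<le> K * \<bar>x - k / n\<bar>" using lip[of x "k / n"] x k n by auto
    also have "\<dots> \<le> K * (\<epsilon> + (1 / \<epsilon>) * (x - k / n)\<^sup>2)" using K a by (intro mult_left_mono) auto
    finally have "Bernstein n k x * norm (f x - f (k / n)) \<le> Bernstein n k x * (K * (\<epsilon> + (1 / \<epsilon>) * (x - k / n)\<^sup>2))"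
      using B by (intro mult_left_mono) auto
    then show "norm (Bernstein n k x *\<^sub>R (f x - f (k / n))) \<le> K * (\<epsilon> * Bernstein n k x + (1 / \<epsilon>) * ((x - k / n)\<^sup>2 * Bernstein n k x))"
      unfolding norm_scaleR abs_of_nonneg[OF B] by (simp add: algebra_simps)
  qed
  also have "\<dots> = K * (\<epsilon> + (1 / \<epsilon>) * (x * (1 - x) / n))"
    unfolding sum_distrib_left[symmetric] sum.distrib Bernstein_variance[OF n] by simp
  also have "\<dots> \<le> K * (\<epsilon> + (1 / \<epsilon>) * (1 / n))"
    using K x \<epsilon> by (intro mult_left_mono add_left_mono divide_right_mono mult_le_one) auto
  finally show ?thesis by simp
qed

section \<open>Backward orbits of the adjoint semigroup\<close>

context generator
begin

text \<open>Three factors \<open>J e\<close> let the adjoint of the generator be applied three times: once for the equation,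
  once for the derivative of the orbit, and once for the Lipschitz bound used in the approximation.\<close>

definition P :: "real \<Rightarrow> nat \<Rightarrow> 'v \<Rightarrow>\<^sub>L 'v" where
  "P e j = (if j = 0 then J e o\<^sub>L J e o\<^sub>L J e else if j = 1 then J e o\<^sub>L J e o\<^sub>L Q e
    else if j = 2 then J e o\<^sub>L Q e o\<^sub>L Q e else Q e o\<^sub>L Q e o\<^sub>L Q e)"

lemma P_A:
  assumes "e > 0" "x \<in> DA" "j < 3"
  shows "P e j (A x) = P e (Suc j) x"
proof -
  consider "j = 0" | "j = 1" | "j = 2" using assms(3) by linarith
  then show ?thesis using assms(1,2) by cases (simp_all add: P_def J_A J_commute_Q flip: J_commute_Q[of e "A x"] J_commute_Q[of e "Q e (A x)"])
qed

lemma P_J: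
  assumes "e > 0" "j < 3"
  shows "\<exists>z. P e j x = J e z \<and> P e (Suc j) x = Q e z"
proof -
  consider "j = 0" | "j = 1" | "j = 2" using assms(2) by linarith
  then show ?thesis
  proof cases
    case 1 then show ?thesis using assms(1) by (intro exI[of _ "J e (J e x)"]) (simp add: P_def J_commute_Q)
  next
    case 2 then show ?thesis using assms(1) by (intro exI[of _ "J e (Q e x)"]) (simp add: P_def J_commute_Q)
  next
    case 3 then show ?thesis by (intro exI[of _ "Q e (Q e x)"]) (simp add: P_def)
  qed
qed

text \<open>Raising \<open>j\<close> applies the adjoint generator once more. Time runs backwards,
  so the derivative in \<open>q\<close> is minus the orbit of index \<open>Suc j\<close>; this
  cancels the drift when the scalar product with \<open>Y (s + q)\<close> is followed in
  \<open>q\<close>.\<close>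

definition adj_orbit :: "real \<Rightarrow> real \<Rightarrow> 'v \<Rightarrow> nat \<Rightarrow> real \<Rightarrow> 'v" where
  "adj_orbit e h v j q = adjoint (S (h - q) o\<^sub>L P e j) v"

lemma inner_adj_orbit: "x \<bullet> adj_orbit e h v j q = S (h - q) (P e j x) \<bullet> v"
  by (simp add: adj_orbit_def inner_adjoint blinfun.bounded_linear_right)

lemma adj_orbit_adj:
  assumes "e > 0" "j < 3"
  shows "adj_orbit e h v j q \<in> adj_dom DA A" "adj_op DA A (adj_orbit e h v j q) = adj_orbit e h v (Suc j) q"
  by (rule adj_op_eqI[of _ "adj_orbit e h v (Suc j) q"], simp add: inner_adj_orbit P_A assms)+

lemma adj_orbit_inner_integrable:
  assumes "0 \<le> p" "q \<le> h"
  shows "(\<lambda>r. adj_orbit e h v j r \<bullet> x) integrable_on {p..q}"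
  unfolding inner_commute[of _ x] inner_adj_orbit
  by (intro integrable_continuous_real continuous_intros continuous_on_compose2[OF S_continuous[of h]])
    (use assms in \<open>auto intro!: continuous_intros\<close>)

text \<open>\<open>S_J_diff\<close> carried to the adjoint and reflected by \<open>h - r\<close>: in
  integrated form, index \<open>j\<close> has minus index \<open>Suc j\<close> as its time
  derivative.\<close>

lemma adj_orbit_diff:
  assumes e: "e > 0" and j: "j < 3" and "0 \<le> p" "p \<le> q" "q \<le> h"
  shows "(adj_orbit e h v j p - adj_orbit e h v j q) \<bullet> x = integral {p..q} (\<lambda>r. adj_orbit e h v (Suc j) r \<bullet> x)"
proof -
  obtain z where z: "P e j x = J e z" "P e (Suc j) x = Q e z" using P_J[OF e j] by blast
  have "(adj_orbit e h v j p - adj_orbit e h v j q) \<bullet> x = (S (h - p) (J e z) - S (h - q) (J e z)) \<bullet> v"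
    by (simp add: inner_commute[of _ x] inner_diff_right inner_adj_orbit z) (simp add: inner_diff_left)
  also have "\<dots> = integral {h - q..h - p} (\<lambda>r. S r (Q e z) \<bullet> v)"
    using assms by (intro S_J_diff) auto
  also have "\<dots> = integral {p..q} (\<lambda>r. adj_orbit e h v (Suc j) r \<bullet> x)"
    unfolding inner_commute[of _ x] inner_adj_orbit z by (rule integral_reflect_interval[symmetric])
  finally show ?thesis .
qed

lemma adj_orbit_bounded: "\<exists>K\<ge>0. \<forall>j\<le>3. \<forall>q\<in>{0..h}. norm (adj_orbit e h v j q) \<le> K"
proof -
  obtain K where K: "\<And>r. r \<in> {0..h} \<Longrightarrow> norm (S r) \<le> K" using S_bounded by blast
  define C where "C = Max ((\<lambda>j. norm (P e j)) ` {..3})"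
  have C: "norm (P e j) \<le> C" if "j \<le> 3" for j unfolding C_def using that by (intro Max_ge) auto
  have C0: "C \<ge> 0" using C[of 0] norm_ge_zero[of "P e 0"] by linarith
  have "norm (adj_orbit e h v j q) \<le> \<bar>K\<bar> * C * norm v" if "j \<le> 3" "q \<in> {0..h}" for j q
  proof (rule inner_le_imp_norm_le)
    fix x
    have "S (h - q) (P e j x) \<bullet> v \<le> norm (S (h - q) (P e j x)) * norm v" by (rule norm_cauchy_schwarz)
    also have "norm (S (h - q) (P e j x)) \<le> norm (S (h - q)) * norm (P e j x)" by (rule norm_blinfun)
    also have "\<dots> \<le> \<bar>K\<bar> * (C * norm x)"
    proof (rule mult_mono)
      show "norm (S (h - q)) \<le> \<bar>K\<bar>" using K[of "h - q"] that by auto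
      show "norm (P e j x) \<le> C * norm x"
        using norm_blinfun[of "P e j" x] mult_right_mono[OF C[OF that(1)], of "norm x"] by simp
    qed auto
    finally have "S (h - q) (P e j x) \<bullet> v \<le> \<bar>K\<bar> * (C * norm x) * norm v" by (simp add: mult_right_mono)
    then show "adj_orbit e h v j q \<bullet> x \<le> \<bar>K\<bar> * C * norm v * norm x"
      unfolding inner_commute[of _ x] inner_adj_orbit by (simp add: mult_ac)
  qed (use C0 in simp)
  moreover have "\<bar>K\<bar> * C * norm v \<ge> 0" using C0 by simp
  ultimately show ?thesis by blast
qed

lemma adj_orbit_Lipschitz:
  assumes e: "e > 0"
  shows "\<exists>K\<ge>0. \<forall>j<3. \<forall>p\<in>{0..h}. \<forall>q\<in>{0..h}. norm (adj_orbit e h v j p - adj_orbit e h v j q) \<le> K * \<bar>p - q\<bar>"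
proof -
  obtain K where K: "K \<ge> 0" "\<And>j q. j \<le> 3 \<Longrightarrow> q \<in> {0..h} \<Longrightarrow> norm (adj_orbit e h v j q) \<le> K"
    using adj_orbit_bounded by blast
  have *: "norm (adj_orbit e h v j p - adj_orbit e h v j q) \<le> K * (q - p)" if "j < 3" "0 \<le> p" "p \<le> q" "q \<le> h" for j p q
    by (rule weak_integral_norm_le[where f = "adj_orbit e h v (Suc j)"])
      (use that K in \<open>auto intro!: adj_orbit_inner_integrable adj_orbit_diff[OF e]\<close>)
  have "norm (adj_orbit e h v j p - adj_orbit e h v j q) \<le> K * \<bar>p - q\<bar>" if "j < 3" "p \<in> {0..h}" "q \<in> {0..h}" for j p q
    using *[of j p q] *[of j q p] that by (cases "p \<le> q") (auto simp: norm_minus_commute)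
  then show ?thesis using K(1) by blast
qed

text \<open>One degree \<open>n\<close> serves the three indices together, because they share a
  Lipschitz constant.\<close>

lemma adj_orbit_Bernstein:
  assumes e: "e > 0" and h: "h > 0" and \<delta>: "\<delta> > 0"
  shows "\<exists>n. \<forall>j<3. \<forall>q\<in>{0..h}.
    norm (adj_orbit e h v j q - (\<Sum>k\<le>n. Bernstein n k (q / h) *\<^sub>R adj_orbit e h v j (h * (k / n)))) \<le> \<delta>"
proof -
  obtain K where K: "K \<ge> 0" "\<And>j p q. j < 3 \<Longrightarrow> p \<in> {0..h} \<Longrightarrow> q \<in> {0..h} \<Longrightarrow>
      norm (adj_orbit e h v j p - adj_orbit e h v j q) \<le> K * \<bar>p - q\<bar>"
    using adj_orbit_Lipschitz[OF e] by blast
  \<comment> \<open>Half of \<open>\<delta>\<close> is reserved for each of the terms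
    \<open>\<epsilon>\<close> and \<open>1 / (\<epsilon> * n)\<close>; the added 1 keeps the
    denominator positive when \<open>K = 0\<close>.\<close>
  define \<epsilon> where "\<epsilon> = \<delta> / (2 * (K * h + 1))"
  have K1: "K * h + 1 > 0" using K(1) h by (simp add: add_nonneg_pos)
  have \<epsilon>: "\<epsilon> > 0" unfolding \<epsilon>_def using K1 \<delta> by simp
  obtain n :: nat where n: "n > 1 / \<epsilon>\<^sup>2" using reals_Archimedean2 by blast
  have n0: "n > 0" using n \<epsilon> by (metis of_nat_0_less_iff order_less_trans zero_less_divide_1_iff zero_less_power)
  have "1 / (\<epsilon> * n) \<le> \<epsilon>" using n n0 \<epsilon> by (simp add: field_simps power2_eq_square)
  then have "(K * h) * (\<epsilon> + 1 / (\<epsilon> * n)) \<le> (K * h) * (2 * \<epsilon>)" using K(1) h by (intro mult_left_mono) auto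
  also have "\<dots> \<le> (K * h + 1) * (2 * \<epsilon>)" using \<epsilon> by (intro mult_right_mono) auto
  also have "\<dots> = \<delta>" unfolding \<epsilon>_def using K1 by (simp add: field_simps)
  finally have small: "(K * h) * (\<epsilon> + 1 / (\<epsilon> * n)) \<le> \<delta>" .
  have "norm (adj_orbit e h v j q - (\<Sum>k\<le>n. Bernstein n k (q / h) *\<^sub>R adj_orbit e h v j (h * (k / n)))) \<le> \<delta>"
    if j: "j < 3" and q: "q \<in> {0..h}" for j q
  proof -
    have "norm (adj_orbit e h v j (h * (q / h)) - (\<Sum>k\<le>n. Bernstein n k (q / h) *\<^sub>R adj_orbit e h v j (h * (k / n)))) \<le> (K * h) * (\<epsilon> + 1 / (\<epsilon> * n))"
    proof (rule Bernstein_approx_Lipschitz[OF n0 _ \<epsilon>, where f = "\<lambda>x. adj_orbit e h v j (h * x)"])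
      fix x y :: real assume xy: "x \<in> {0..1}" "y \<in> {0..1}"
      have "norm (adj_orbit e h v j (h * x) - adj_orbit e h v j (h * y)) \<le> K * \<bar>h * x - h * y\<bar>"
        using xy h by (intro K(2)[OF j]) (auto simp: mult_left_le)
      also have "\<dots> = K * h * \<bar>x - y\<bar>" using h by (simp add: abs_mult flip: right_diff_distrib)
      finally show "norm (adj_orbit e h v j (h * x) - adj_orbit e h v j (h * y)) \<le> K * h * \<bar>x - y\<bar>" .
    qed (use q h K(1) in auto)
    then show ?thesis using small h by simp
  qed
  then show ?thesis by blast
qed

text \<open>The functions \<open>\<psi> k\<close> are Bernstein polynomials: the derivative of the adjoint orbit, rather than the
  orbit, is replaced by its Bernstein approximation, so that both the time derivative and the adjoint
  generator applied to the approximation converge uniformly.\<close>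

lemma test_functions:
  assumes e: "e > 0" and h: "h > 0" and \<delta>: "\<delta> > 0"
  obtains n :: nat and g :: "nat \<Rightarrow> 'v" and \<phi> \<psi> :: "nat \<Rightarrow> real \<Rightarrow> real" where
    "\<And>k. g k \<in> adj_dom DA A"
    "\<And>k. continuous_on UNIV (\<psi> k)"
    "\<And>k q. q \<in> {0..h} \<Longrightarrow> (\<phi> k has_real_derivative \<psi> k q) (at q within {0..h})"
    "\<And>x. x \<bullet> (\<Sum>k<n. \<phi> k h *\<^sub>R g k) = P e 0 x \<bullet> v"
    "\<And>x. \<bar>x \<bullet> (\<Sum>k<n. \<phi> k 0 *\<^sub>R g k) - S h (P e 0 x) \<bullet> v\<bar> \<le> \<delta> * norm x"
    "\<And>q. q \<in> {0..h} \<Longrightarrow> norm (\<Sum>k<n. \<psi> k q *\<^sub>R g k + \<phi> k q *\<^sub>R adj_op DA A (g k)) \<le> \<delta>"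
proof -
  \<comment> \<open>\<open>\<delta>\<close> is to cover a pointwise error integrated over a length
    of at most \<open>h\<close>, plus one pointwise error.\<close>
  define \<eta> where "\<eta> = \<delta> / (1 + h)"
  have "\<eta> * (1 + h) = \<delta>" using h by (simp add: \<eta>_def)
  then have \<eta>: "\<eta> > 0" "\<eta> * h + \<eta> = \<delta>" using \<delta> h by (simp add: \<eta>_def, simp add: algebra_simps)
  obtain n where n: "\<And>j q. j < 3 \<Longrightarrow> q \<in> {0..h} \<Longrightarrow>
      norm (adj_orbit e h v j q - (\<Sum>k\<le>n. Bernstein n k (q / h) *\<^sub>R adj_orbit e h v j (h * (k / n)))) \<le> \<eta>"
    using adj_orbit_Bernstein[OF e h \<eta>(1)] by blast
  define b where "b k q = Bernstein n k (q / h)" for k q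
  define c where "c k = h * (real k / real n)" for k
  have bc: "continuous_on X (b k)" for X k unfolding b_def Bernstein_def by (intro continuous_intros) (use h in auto)
  have bi: "b k integrable_on {p..q}" for k p q by (intro integrable_continuous_real bc)
  define \<beta> where "\<beta> k q = integral {q..h} (b k)" for k q
  \<comment> \<open>The terminal value plus the integral from \<open>q\<close> to \<open>h\<close>
    of the approximated next orbit: minus its derivative is the Bernstein approximation of index
    \<open>Suc j\<close>. At \<open>q = h\<close> the value is exact.\<close>
  define E where "E j q = adj_orbit e h v j h + (\<Sum>k\<le>n. \<beta> k q *\<^sub>R adj_orbit e h v (Suc j) (c k))" for j q
  have E: "norm (E j q - adj_orbit e h v j q) \<le> \<eta> * h" if j: "Suc j < 3" and q: "q \<in> {0..h}" for j q
  proof -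
    have int: "(\<lambda>r. (\<Sum>k\<le>n. b k r *\<^sub>R adj_orbit e h v (Suc j) (c k)) \<bullet> x) integrable_on {q..h}" for x
      unfolding inner_sum_left inner_scaleR_left
      by (intro integrable_continuous_real continuous_intros bc)
    have "norm (E j q - adj_orbit e h v j q) \<le> \<eta> * (h - q)"
    proof (rule weak_integral_norm_le)
      show "(\<lambda>r. ((\<Sum>k\<le>n. b k r *\<^sub>R adj_orbit e h v (Suc j) (c k)) - adj_orbit e h v (Suc j) r) \<bullet> x) integrable_on {q..h}" for x
        unfolding inner_diff_left using q by (intro integrable_diff int adj_orbit_inner_integrable) auto
      show "norm ((\<Sum>k\<le>n. b k r *\<^sub>R adj_orbit e h v (Suc j) (c k)) - adj_orbit e h v (Suc j) r) \<le> \<eta>" if "r \<in> {q..h}" for r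
        unfolding b_def c_def using n[of "Suc j" r] j q that by (auto simp: norm_minus_commute)
      fix x
      have "(adj_orbit e h v j q - adj_orbit e h v j h) \<bullet> x = integral {q..h} (\<lambda>r. adj_orbit e h v (Suc j) r \<bullet> x)"
        using j q by (intro adj_orbit_diff e) auto
      moreover have "(\<Sum>k\<le>n. \<beta> k q *\<^sub>R adj_orbit e h v (Suc j) (c k)) \<bullet> x
          = integral {q..h} (\<lambda>r. (\<Sum>k\<le>n. b k r *\<^sub>R adj_orbit e h v (Suc j) (c k)) \<bullet> x)"
        unfolding inner_sum_left inner_scaleR_left \<beta>_def
        by (subst integral_sum) (auto intro!: integrable_continuous_real continuous_intros bc)
      ultimately show "(E j q - adj_orbit e h v j q) \<bullet> x
          = integral {q..h} (\<lambda>r. ((\<Sum>k\<le>n. b k r *\<^sub>R adj_orbit e h v (Suc j) (c k)) - adj_orbit e h v (Suc j) r) \<bullet> x)"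
        unfolding inner_diff_left[of _ _ x] E_def inner_add_left using q
        by (subst Henstock_Kurzweil_Integration.integral_diff[OF int adj_orbit_inner_integrable]) (auto simp: inner_diff_left)
    qed (use q in auto)
    also have "\<dots> \<le> \<eta> * h" using \<eta>(1) q by (intro mult_left_mono) auto
    finally show ?thesis .
  qed
  \<comment> \<open>The additional index \<open>n + 1\<close> carries the constant terminal value.
    With the minus signs in \<open>g\<close> and \<open>\<phi>\<close>, the derivative of
    \<open>\<phi> k\<close> is the Bernstein polynomial itself.\<close>
  define g where "g k = (if k \<le> n then - adj_orbit e h v 1 (c k) else adj_orbit e h v 0 h)" for k
  define \<phi> where "\<phi> k q = (if k \<le> n then - \<beta> k q else 1)" for k q
  define \<psi> where "\<psi> k q = (if k \<le> n then b k q else 0)" for k q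
  have sum: "(\<Sum>k<n + 2. f k) = (\<Sum>k\<le>n. f k) + f (Suc n)" for f :: "nat \<Rightarrow> 'v"
    by (simp flip: lessThan_Suc_atMost)
  have \<phi>g: "(\<Sum>k<n + 2. \<phi> k q *\<^sub>R g k) = E 0 q" for q
    unfolding sum by (simp add: \<phi>_def g_def E_def add.commute)
  have g_adj: "adj_op DA A (g k) = (if k \<le> n then - adj_orbit e h v 2 (c k) else adj_orbit e h v 1 h)" "g k \<in> adj_dom DA A" for k
  proof -
    have "adj_op DA A (- adj_orbit e h v 1 (c k)) = - adj_orbit e h v 2 (c k)" "- adj_orbit e h v 1 (c k) \<in> adj_dom DA A"
      by (rule adj_op_eqI[of _ "- adj_orbit e h v 2 (c k)"], simp add: inner_adj_orbit P_A e numeral_2_eq_2)+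
    then show "adj_op DA A (g k) = (if k \<le> n then - adj_orbit e h v 2 (c k) else adj_orbit e h v 1 h)" "g k \<in> adj_dom DA A"
      unfolding g_def using adj_orbit_adj[OF e, of 0] by auto
  qed
  \<comment> \<open>Both terms on the right approximate \<open>adj_orbit e h v 1 q\<close>, the
    first up to \<open>\<eta> * h\<close> and the second up to \<open>\<eta>\<close>; their
    difference is small although neither term need be.\<close>
  have \<psi>g: "(\<Sum>k<n + 2. \<psi> k q *\<^sub>R g k + \<phi> k q *\<^sub>R adj_op DA A (g k)) = E 1 q - (\<Sum>k\<le>n. b k q *\<^sub>R adj_orbit e h v 1 (c k))" for q
    unfolding sum g_adj by (simp add: \<phi>_def \<psi>_def g_def E_def sum_subtractf numeral_2_eq_2)
  show ?thesis
  proof (rule that[of g \<psi> \<phi> "n + 2"])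
    show "continuous_on UNIV (\<psi> k)" for k unfolding \<psi>_def using bc by (cases "k \<le> n") auto
    show "(\<phi> k has_real_derivative \<psi> k q) (at q within {0..h})" if q: "q \<in> {0..h}" for k q
    proof (cases "k \<le> n")
      case True
      have D: "((\<lambda>q. integral {0..q} (b k) - integral {0..h} (b k)) has_real_derivative b k q - 0) (at q within {0..h})"
        by (intro DERIV_diff DERIV_const integral_has_real_derivative bc q)
      have eq: "integral {0..r} (b k) - integral {0..h} (b k) = \<phi> k r" if "r \<in> {0..h}" for r
        using Henstock_Kurzweil_Integration.integral_combine[of 0 r h "b k"] that True bi by (simp add: \<phi>_def \<beta>_def)
      have "(\<phi> k has_real_derivative b k q - 0) (at q within {0..h})"
        by (rule has_field_derivative_transform_within[OF D, where d = 1]) (use q eq in auto)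
      then show ?thesis using True by (simp add: \<psi>_def)
    qed (simp add: \<phi>_def[abs_def] \<psi>_def)
    show "x \<bullet> (\<Sum>k<n + 2. \<phi> k h *\<^sub>R g k) = P e 0 x \<bullet> v" for x
      unfolding \<phi>g by (simp add: E_def \<beta>_def inner_adj_orbit)
    show "\<bar>x \<bullet> (\<Sum>k<n + 2. \<phi> k 0 *\<^sub>R g k) - S h (P e 0 x) \<bullet> v\<bar> \<le> \<delta> * norm x" for x
    proof -
      have "norm (E 0 0 - adj_orbit e h v 0 0) \<le> \<delta>" using E[of 0 0] h \<eta> by auto
      then have "norm x * norm (E 0 0 - adj_orbit e h v 0 0) \<le> norm x * \<delta>" by (intro mult_left_mono) auto
      moreover have "\<bar>x \<bullet> (E 0 0 - adj_orbit e h v 0 0)\<bar> \<le> norm x * norm (E 0 0 - adj_orbit e h v 0 0)" by (rule Cauchy_Schwarz_ineq2)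
      ultimately show ?thesis unfolding \<phi>g by (simp add: inner_diff_right inner_adj_orbit mult.commute)
    qed
    show "norm (\<Sum>k<n + 2. \<psi> k q *\<^sub>R g k + \<phi> k q *\<^sub>R adj_op DA A (g k)) \<le> \<delta>" if q: "q \<in> {0..h}" for q
    proof -
      have "norm (E 1 q - (\<Sum>k\<le>n. b k q *\<^sub>R adj_orbit e h v 1 (c k)))
          \<le> norm (E 1 q - adj_orbit e h v 1 q) + norm (adj_orbit e h v 1 q - (\<Sum>k\<le>n. b k q *\<^sub>R adj_orbit e h v 1 (c k)))" by norm
      also have "\<dots> \<le> \<eta> * h + \<eta>" using E[of 1 q] n[of 1 q] q by (intro add_mono) (auto simp: b_def c_def)
      finally show ?thesis unfolding \<psi>g using \<eta>(2) by simp
    qed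
  qed (rule g_adj)
qed

end

subsection \<open>Convergence in probability\<close>

context prob_space
begin

text \<open>A subadditive gauge of convergence in probability: errors can be added without splitting
  events.\<close>

definition L0norm :: "('a \<Rightarrow> real) \<Rightarrow> real" where
  "L0norm Z = expectation (\<lambda>\<omega>. min 1 \<bar>Z \<omega>\<bar>)"

lemma integrable_min1 [simp, intro]:
  fixes Z :: "'a \<Rightarrow> real"
  assumes "Z \<in> borel_measurable M"
  shows "integrable M (\<lambda>\<omega>. min 1 \<bar>Z \<omega>\<bar>)"
  by (rule integrable_const_bound[where B = 1]) (use assms in \<open>auto intro!: AE_I2\<close>)

lemma L0norm_nonneg: "L0norm Z \<ge> 0"
  unfolding L0norm_def by (rule integral_nonneg_AE) auto

lemma L0norm_cong_AE:
  assumes "Z \<in> borel_measurable M" "W \<in> borel_measurable M" "AE \<omega> in M. Z \<omega> = W \<omega>"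
  shows "L0norm Z = L0norm W"
  unfolding L0norm_def using assms by (intro integral_cong_AE) auto

lemma L0norm_triangle:
  assumes [measurable]: "Z \<in> borel_measurable M" "W \<in> borel_measurable M"
  shows "L0norm (\<lambda>\<omega>. Z \<omega> + W \<omega>) \<le> L0norm Z + L0norm W"
proof -
  have "L0norm (\<lambda>\<omega>. Z \<omega> + W \<omega>) \<le> expectation (\<lambda>\<omega>. min 1 \<bar>Z \<omega>\<bar> + min 1 \<bar>W \<omega>\<bar>)"
    unfolding L0norm_def by (rule integral_mono) auto
  then show ?thesis unfolding L0norm_def by simp
qed

lemma L0norm_le_expectation:
  assumes "integrable M Z"
  shows "L0norm Z \<le> expectation (\<lambda>\<omega>. \<bar>Z \<omega>\<bar>)"
  unfolding L0norm_def using assms by (intro integral_mono) auto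

lemma L0norm_tendsto_AE:
  assumes [measurable]: "\<And>n. Z n \<in> borel_measurable M" and "AE \<omega> in M. (\<lambda>n. Z n \<omega>) \<longlonglongrightarrow> 0"
  shows "(\<lambda>n. L0norm (Z n)) \<longlonglongrightarrow> 0"
proof -
  have "(\<lambda>n. expectation (\<lambda>\<omega>. min 1 \<bar>Z n \<omega>\<bar>)) \<longlonglongrightarrow> expectation (\<lambda>\<omega>. 0)"
  proof (rule integral_dominated_convergence[where w = "\<lambda>_. 1"])
    show "AE \<omega> in M. (\<lambda>n. min 1 \<bar>Z n \<omega>\<bar>) \<longlonglongrightarrow> 0" using assms(2)
    proof eventually_elim
      case (elim \<omega>)
      have "(\<lambda>n. min 1 \<bar>Z n \<omega>\<bar>) \<longlonglongrightarrow> min 1 \<bar>0\<bar>" by (intro tendsto_intros elim)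
      then show ?case by simp
    qed
  qed auto
  then show ?thesis by (simp add: L0norm_def)
qed

lemma L0norm_le_prob:
  assumes [measurable]: "Z \<in> borel_measurable M" and "\<epsilon> \<ge> 0"
  shows "L0norm Z \<le> \<epsilon> + prob {\<omega> \<in> space M. \<bar>Z \<omega>\<bar> > \<epsilon>}"
proof -
  have "L0norm Z \<le> expectation (\<lambda>\<omega>. \<epsilon> + indicator {\<omega> \<in> space M. \<bar>Z \<omega>\<bar> > \<epsilon>} \<omega>)"
    unfolding L0norm_def
    by (rule integral_mono)
      (use assms(2) in \<open>auto simp: indicator_def emeasure_eq_measure intro!: integrable_const_bound[where B = "\<epsilon> + 1"] AE_I2\<close>)
  then show ?thesis by (simp add: prob_space emeasure_eq_measure)
qed

lemma L0norm_tendsto_prob: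
  assumes [measurable]: "\<And>n. Z n \<in> borel_measurable M"
    and lim: "\<And>\<epsilon>. \<epsilon> > 0 \<Longrightarrow> ((\<lambda>n. prob {\<omega> \<in> space M. \<bar>Z n \<omega>\<bar> > \<epsilon>}) \<longlongrightarrow> 0) F"
  shows "((\<lambda>n. L0norm (Z n)) \<longlongrightarrow> 0) F"
proof (rule tendstoI)
  fix \<epsilon> :: real assume \<epsilon>: "\<epsilon> > 0"
  have "\<forall>\<^sub>F n in F. dist (prob {\<omega> \<in> space M. \<bar>Z n \<omega>\<bar> > \<epsilon> / 2}) 0 < \<epsilon> / 2"
    using lim[of "\<epsilon> / 2"] \<epsilon> by (intro tendstoD) auto
  then show "\<forall>\<^sub>F n in F. dist (L0norm (Z n)) 0 < \<epsilon>"
  proof eventually_elim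
    case (elim n)
    then show ?case using L0norm_le_prob[of "Z n" "\<epsilon> / 2"] L0norm_nonneg[of "Z n"] \<epsilon> by simp
  qed
qed

text \<open>Laws are compared only through expectations of cosines, the real parts of characteristic
  functions. This is enough because \<open>psi\<close>, the function averaged in the end, is
  even.\<close>

lemma expectation_cos_diff_le:
  assumes [measurable]: "X \<in> borel_measurable M" "Y \<in> borel_measurable M"
  shows "\<bar>expectation (\<lambda>\<omega>. cos (X \<omega>)) - expectation (\<lambda>\<omega>. cos (Y \<omega>))\<bar> \<le> 2 * L0norm (\<lambda>\<omega>. X \<omega> - Y \<omega>)"
proof -
  have int: "integrable M (\<lambda>\<omega>. cos (Z \<omega>))" if [measurable]: "Z \<in> borel_measurable M" for Z :: "'a \<Rightarrow> real"
    by (rule integrable_const_bound[where B = 1]) auto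
  have cos_le: "\<bar>cos x - cos y\<bar> \<le> 2 * min 1 \<bar>x - y\<bar>" for x y :: real
  proof -
    have "\<bar>cos x - cos y\<bar> \<le> \<bar>x - y\<bar>"
    proof -
      have "\<bar>cos x - cos y\<bar> = 2 * (\<bar>sin ((x + y) / 2)\<bar> * \<bar>sin ((y - x) / 2)\<bar>)"
        by (simp add: cos_diff_cos abs_mult)
      also have "\<dots> \<le> 2 * (1 * \<bar>(y - x) / 2\<bar>)"
        by (intro mult_left_mono mult_mono abs_sin_x_le_abs_x) auto
      finally show ?thesis by simp
    qed
    moreover have "\<bar>cos x - cos y\<bar> \<le> 2" using abs_cos_le_one[of x] abs_cos_le_one[of y] by linarith
    ultimately show ?thesis unfolding min_def by (smt (verit) abs_ge_zero)
  qed
  have "\<bar>expectation (\<lambda>\<omega>. cos (X \<omega>)) - expectation (\<lambda>\<omega>. cos (Y \<omega>))\<bar> = \<bar>expectation (\<lambda>\<omega>. cos (X \<omega>) - cos (Y \<omega>))\<bar>"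
    by (simp add: int)
  also have "\<dots> \<le> expectation (\<lambda>\<omega>. \<bar>cos (X \<omega>) - cos (Y \<omega>)\<bar>)" by (rule integral_abs_bound)
  also have "\<dots> \<le> expectation (\<lambda>\<omega>. 2 * min 1 \<bar>X \<omega> - Y \<omega>\<bar>)"
    by (rule integral_mono) (auto simp: int cos_le)
  finally show ?thesis by (simp add: L0norm_def)
qed

lemma expectation_cos_tendsto:
  assumes [measurable]: "\<And>n. X n \<in> borel_measurable M" "Y \<in> borel_measurable M"
    and "(\<lambda>n. L0norm (\<lambda>\<omega>. X n \<omega> - Y \<omega>)) \<longlonglongrightarrow> 0"
  shows "(\<lambda>n. expectation (\<lambda>\<omega>. cos (X n \<omega>))) \<longlonglongrightarrow> expectation (\<lambda>\<omega>. cos (Y \<omega>))"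
proof -
  have "(\<lambda>n. 2 * L0norm (\<lambda>\<omega>. X n \<omega> - Y \<omega>)) \<longlonglongrightarrow> 2 * 0" by (intro tendsto_intros assms)
  then have lim: "(\<lambda>n. 2 * L0norm (\<lambda>\<omega>. X n \<omega> - Y \<omega>)) \<longlonglongrightarrow> 0" by simp
  have "(\<lambda>n. expectation (\<lambda>\<omega>. cos (X n \<omega>)) - expectation (\<lambda>\<omega>. cos (Y \<omega>))) \<longlonglongrightarrow> 0"
  proof (rule Lim_null_comparison[rotated])
    show "\<forall>\<^sub>F n in sequentially. norm (expectation (\<lambda>\<omega>. cos (X n \<omega>)) - expectation (\<lambda>\<omega>. cos (Y \<omega>)))
        \<le> 2 * L0norm (\<lambda>\<omega>. X n \<omega> - Y \<omega>)"
      unfolding real_norm_def by (intro always_eventually allI expectation_cos_diff_le) measurable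
  qed (rule lim)
  then show ?thesis by (rule LIM_zero_cancel)
qed

subsection \<open>Functionals of Levy processes\<close>

text \<open>Independence and stationarity make the joint law of \<open>m\<close> consecutive
  increments over steps of length \<open>d\<close> a product of \<open>m\<close> copies of the law
  at time \<open>d\<close>, in which the starting time \<open>s\<close> no longer occurs.\<close>

lemma levy_increments_law:
  assumes levy: "levy_process_Rn M {..<n} X" and s: "s \<ge> 0" and d: "d \<ge> 0"
    and F [measurable]: "F \<in> borel_measurable (PiM {..<m} (\<lambda>_. PiM {..<n} (\<lambda>_. borel :: real measure)))"
  shows "expectation (\<lambda>\<omega>. F (\<lambda>i\<in>{..<m}. \<lambda>k\<in>{..<n}. X (s + real (Suc i) * d) \<omega> k - X (s + real i * d) \<omega> k) :: real)
       = expectation (\<lambda>\<omega>. F (\<lambda>i\<in>{..<m}. \<lambda>k\<in>{..<n}. X (real (Suc i) * d) \<omega> k - X (real i * d) \<omega> k))"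
\<comment> \<open>The characterisation of independence by a product measure asks for a nonempty
  index set.\<close>
proof (cases "m = 0")
  case False
  define V where "V = PiM {..<n} (\<lambda>_. borel :: real measure)"
  define D where "D s i \<omega> = (\<lambda>k\<in>{..<n}. X (s + real (Suc i) * d) \<omega> k - X (s + real i * d) \<omega> k)" for s i \<omega>
  have L: "\<forall>(ts :: nat \<Rightarrow> real) (m::nat). 0 \<le> ts 0 \<and> (\<forall>k<m. ts k \<le> ts (Suc k)) \<longrightarrow>
      indep_vars (\<lambda>_. V) (\<lambda>k \<omega>. \<lambda>i\<in>{..<n}. X (ts (Suc k)) \<omega> i - X (ts k) \<omega> i) {..<m}"
    using levy unfolding levy_process_Rn_def V_def by (elim conjE) assumption
  have Xm: "(\<lambda>\<omega>. X t \<omega> k) \<in> borel_measurable M" if "t \<ge> 0" "k < n" for t k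
  proof -
    have "(\<lambda>\<omega>. restrict (X t \<omega>) {..<n}) \<in> M \<rightarrow>\<^sub>M PiM {..<n} (\<lambda>_. borel)"
      using levy that unfolding levy_process_Rn_def by blast
    from measurable_compose[OF this measurable_component_singleton[of k "{..<n}" "\<lambda>_. borel"]] that
    show ?thesis by simp
  qed
  have Dm [measurable]: "D s i \<in> measurable M V" if "s \<ge> 0" for s i
    unfolding D_def V_def using that d by (intro measurable_restrict borel_measurable_diff Xm) auto
  have law1: "distr M V (D s i) = distr M V (\<lambda>\<omega>. \<lambda>k\<in>{..<n}. X d \<omega> k)" if "s \<ge> 0" for s i
  proof -
    have "0 \<le> s + real i * d \<and> s + real i * d \<le> s + real (Suc i) * d" using that d by (simp add: mult_right_mono)
    then have "distr M V (D s i) = distr M V (\<lambda>\<omega>. \<lambda>k\<in>{..<n}. X (s + real (Suc i) * d - (s + real i * d)) \<omega> k)"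
      using levy unfolding levy_process_Rn_def V_def D_def by blast
    then show ?thesis by (simp add: algebra_simps)
  qed
  have law: "distr M (PiM {..<m} (\<lambda>_. V)) (\<lambda>\<omega>. \<lambda>i\<in>{..<m}. D s i \<omega>)
      = PiM {..<m} (\<lambda>_. distr M V (\<lambda>\<omega>. \<lambda>k\<in>{..<n}. X d \<omega> k))" if s: "s \<ge> 0" for s
  proof -
    have "0 \<le> s + real 0 * d \<and> (\<forall>k<m. s + real k * d \<le> s + real (Suc k) * d)"
      using s d by (simp add: mult_right_mono)
    then have "indep_vars (\<lambda>_. V) (D s) {..<m}"
      using L[rule_format, of "\<lambda>k. s + real k * d" m] unfolding D_def[abs_def] by blast
    then have "distr M (PiM {..<m} (\<lambda>_. V)) (\<lambda>\<omega>. \<lambda>i\<in>{..<m}. D s i \<omega>) = PiM {..<m} (\<lambda>i. distr M V (D s i))"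
      using False s by (subst (asm) indep_vars_iff_distr_eq_PiM) auto
    then show ?thesis using s by (simp add: law1)
  qed
  have Dm' [measurable]: "(\<lambda>\<omega>. \<lambda>i\<in>{..<m}. D s i \<omega>) \<in> measurable M (PiM {..<m} (\<lambda>_. V))" if "s \<ge> 0" for s
    using that by measurable
  have F' [measurable]: "F \<in> borel_measurable (PiM {..<m} (\<lambda>_. V))" unfolding V_def by (rule F)
  have "expectation (\<lambda>\<omega>. F (\<lambda>i\<in>{..<m}. D s i \<omega>)) = expectation (\<lambda>\<omega>. F (\<lambda>i\<in>{..<m}. D 0 i \<omega>))"
    using law[OF s] law[of 0] by (simp add: Dm' s flip: integral_distr[OF Dm' F'])
  then show ?thesis by (simp add: D_def)
qed (simp add: restrict_def)

end

section \<open>Truncation and Riemann sums for measurable processes\<close>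

definition clip :: "real \<Rightarrow> real \<Rightarrow> real" where
  "clip c x = max (- c) (min c x)"

lemma clip_measurable [measurable]: "clip c \<in> borel_measurable borel"
  unfolding clip_def[abs_def] by measurable

lemma abs_clip_le: "c \<ge> 0 \<Longrightarrow> \<bar>clip c x\<bar> \<le> c"
  by (auto simp: clip_def)

lemma abs_clip_le_abs: "c \<ge> 0 \<Longrightarrow> \<bar>clip c x\<bar> \<le> \<bar>x\<bar>"
  by (auto simp: clip_def)

lemma clip_tendsto: "(\<lambda>i. clip (real i) x) \<longlonglongrightarrow> x"
proof (rule tendsto_eventually)
  obtain N :: nat where "\<bar>x\<bar> \<le> N" using real_arch_simple by blast
  then have "clip (real i) x = x" if "i \<ge> N" for i using that by (auto simp: clip_def)
  then show "\<forall>\<^sub>F i in sequentially. clip (real i) x = x" unfolding eventually_sequentially by blast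
qed

lemma clip_diff_le: "c \<ge> 0 \<Longrightarrow> \<bar>clip c x - clip c y\<bar> \<le> (2 * c + 1) * min 1 \<bar>x - y\<bar>"
proof -
  assume c: "c \<ge> 0"
  have "\<bar>clip c x - clip c y\<bar> \<le> \<bar>x - y\<bar>" "\<bar>clip c x - clip c y\<bar> \<le> 2 * c" using c by (auto simp: clip_def)
  moreover have "1 * \<bar>x - y\<bar> \<le> (2 * c + 1) * \<bar>x - y\<bar>" using c by (intro mult_right_mono) auto
  ultimately show ?thesis by (auto simp: min_def)
qed

text \<open>Half-open, so that every point of \<open>{0..<h}\<close> lies in exactly one of the
  \<open>m\<close> cells.\<close>

definition cell :: "real \<Rightarrow> nat \<Rightarrow> nat \<Rightarrow> real set" where
  "cell h m j = {real j * (h / real m)..<real (Suc j) * (h / real m)}"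

lemma sum_indicator_cell:
  assumes h: "h > 0" and m: "m > 0" and q: "0 \<le> q" "q < h"
  obtains j where "j < m" "\<bar>q - real j * (h / real m)\<bar> \<le> h / real m"
    "\<And>f :: nat \<Rightarrow> real. (\<Sum>i<m. indicator (cell h m i) q * f i) = f j"
proof -
  define d where "d = h / real m"
  have d: "d > 0" using h m by (simp add: d_def)
  define j where "j = nat \<lfloor>q / d\<rfloor>"
  have fl: "0 \<le> \<lfloor>q / d\<rfloor>" using q d by simp
  have j: "real j \<le> q / d" "q / d < real j + 1" using fl by (simp_all add: j_def)
  have jd: "real j * d \<le> q" "q < real (Suc j) * d" using j d by (simp_all add: field_simps)
  have in_cell: "q \<in> cell h m i \<longleftrightarrow> i = j" for i
  proof
    assume "q \<in> cell h m i"
    then have "real i * d \<le> q" "q < real (Suc i) * d" by (auto simp: cell_def d_def)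
    then have "real i * d < real (Suc j) * d" "real j * d < real (Suc i) * d" using jd by linarith+
    then have "i < Suc j" "j < Suc i" using d by (metis mult_less_cancel_right_pos of_nat_less_iff)+
    then show "i = j" by simp
  qed (use jd in \<open>auto simp: cell_def d_def\<close>)
  have "real j * d < real m * d" using jd(1) q h m by (simp add: d_def)
  then have jm: "j < m" using d by simp
  show ?thesis
  proof (rule that[OF jm])
    show "\<bar>q - real j * (h / real m)\<bar> \<le> h / real m" using jd unfolding d_def[symmetric] by (simp add: algebra_simps)
    show "(\<Sum>i<m. indicator (cell h m i) q * f i) = f j" for f :: "nat \<Rightarrow> real"
      using jm by (simp add: indicator_def in_cell if_distrib[of "\<lambda>x. x * _"] cong: if_cong)
  qed
qed


context prob_space
begin

lemma
  fixes f :: "real \<Rightarrow> 'a \<Rightarrow> real"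
  assumes f [measurable]: "(\<lambda>(q, \<omega>). f q \<omega>) \<in> borel_measurable (borel \<Otimes>\<^sub>M M)"
    and B: "\<And>q \<omega>. \<bar>f q \<omega>\<bar> \<le> B" and A [measurable]: "A \<in> sets borel" and fin: "emeasure lborel A < \<infinity>"
  shows integrable_set_integral: "integrable M (\<lambda>\<omega>. LINT q:A|lborel. f q \<omega>)"
    and expectation_set_integral:
      "expectation (\<lambda>\<omega>. LINT q:A|lborel. f q \<omega>) = (LINT q:A|lborel. expectation (f q))"
proof -
  interpret P: pair_sigma_finite lborel M ..
  have [measurable]: "(\<lambda>(q, \<omega>). f q \<omega>) \<in> borel_measurable (lborel \<Otimes>\<^sub>M M)"
    using f by (simp cong: measurable_cong_sets)
  have int: "integrable (lborel \<Otimes>\<^sub>M M) (\<lambda>(q, \<omega>). indicator A q *\<^sub>R f q \<omega>)"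
  proof (rule integrableI_bounded_set[where A = "A \<times> space M" and B = B])
    show "emeasure (lborel \<Otimes>\<^sub>M M) (A \<times> space M) < \<infinity>"
      using fin by (simp add: emeasure_pair_measure_Times emeasure_space_1)
  qed (use B in \<open>auto simp: space_pair_measure indicator_def intro!: AE_I2\<close>)
  have "integrable M (\<lambda>\<omega>. \<integral>q. indicator A q *\<^sub>R f q \<omega> \<partial>lborel)" using P.integrable_snd[OF int] .
  then show "integrable M (\<lambda>\<omega>. LINT q:A|lborel. f q \<omega>)" by (simp add: set_lebesgue_integral_def)
  show "expectation (\<lambda>\<omega>. LINT q:A|lborel. f q \<omega>) = (LINT q:A|lborel. expectation (f q))"
    using P.Fubini_integral[OF int] by (simp add: set_lebesgue_integral_def)
qed

lemma stochastic_Riemann_sums: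
  fixes x :: "real \<Rightarrow> 'a \<Rightarrow> real"
  assumes h: "h > 0" and x [measurable]: "(\<lambda>(q, \<omega>). x q \<omega>) \<in> borel_measurable (borel \<Otimes>\<^sub>M M)"
    and c: "\<And>q \<omega>. \<bar>x q \<omega>\<bar> \<le> c" and \<psi>: "continuous_on UNIV \<psi>"
    and cont: "\<And>q u. q \<in> {0..h} \<Longrightarrow> (\<And>i. u i \<in> {0..h}) \<Longrightarrow> u \<longlonglongrightarrow> q \<Longrightarrow>
      (\<lambda>i. expectation (\<lambda>\<omega>. \<bar>x (u i) \<omega> - x q \<omega>\<bar>)) \<longlonglongrightarrow> 0"
  shows "(\<lambda>m. expectation (\<lambda>\<omega>. \<bar>(LINT q:{0..<h}|lborel. \<psi> q * x q \<omega>)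
      - (\<Sum>j<Suc m. (LINT q:cell h (Suc m) j|lborel. \<psi> q) * x (real j * (h / real (Suc m))) \<omega>)\<bar>)) \<longlonglongrightarrow> 0"
proof -
  have [measurable]: "\<psi> \<in> borel_measurable borel" using \<psi> by (rule borel_measurable_continuous_onI)
  have xs [measurable]: "x q \<in> borel_measurable M" for q using measurable_Pair2[OF x, of q] by simp
  have xq [measurable]: "(\<lambda>q. x q \<omega>) \<in> borel_measurable borel" if "\<omega> \<in> space M" for \<omega>
    using measurable_Pair1[OF x that] by simp
  obtain K where K: "\<And>q. q \<in> {0..h} \<Longrightarrow> \<bar>\<psi> q\<bar> \<le> K"
    using compact_imp_bounded[OF compact_continuous_image[OF continuous_on_subset[OF \<psi>] compact_Icc[of 0 h]]]
    unfolding bounded_iff by (metis imageI real_norm_def subset_UNIV)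
  have K0: "K \<ge> 0" using K[of 0] h by auto
  have c0: "c \<ge> 0" using c[of 0 undefined] by linarith
  define w where "w m q \<omega> = (\<Sum>i<Suc m. indicator (cell h (Suc m) i) q * x (real i * (h / real (Suc m))) \<omega>)" for m q \<omega>
  have cm [measurable]: "cell h m i \<in> sets borel" for m i by (simp add: cell_def)
  have w [measurable]: "(\<lambda>(q, \<omega>). w m q \<omega>) \<in> borel_measurable (borel \<Otimes>\<^sub>M M)" for m unfolding w_def by measurable
  have wb: "\<exists>j. q < h \<longrightarrow> 0 \<le> q \<longrightarrow> w m q = x (real j * (h / real (Suc m))) \<and> j < Suc m \<and> \<bar>q - real j * (h / real (Suc m))\<bar> \<le> h / real (Suc m)" for m q
  proof (cases "0 \<le> q \<and> q < h")
    case True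
    obtain j where "j < Suc m" "\<bar>q - real j * (h / real (Suc m))\<bar> \<le> h / real (Suc m)"
      "\<And>f :: nat \<Rightarrow> real. (\<Sum>i<Suc m. indicator (cell h (Suc m) i) q * f i) = f j"
      using sum_indicator_cell[of h "Suc m" q] h True by auto
    then show ?thesis by (intro exI[of _ j]) (auto simp: w_def fun_eq_iff simp del: sum.lessThan_Suc)
  qed auto
  define D where "D m q \<omega> = indicator {0..<h} q * \<bar>x q \<omega> - w m q \<omega>\<bar>" for m q \<omega>
  have D [measurable]: "(\<lambda>(q, \<omega>). D m q \<omega>) \<in> borel_measurable (borel \<Otimes>\<^sub>M M)" for m unfolding D_def by measurable
  have Db: "\<bar>D m q \<omega>\<bar> \<le> 2 * c" for m q \<omega>
  proof (cases "0 \<le> q \<and> q < h")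
    case True
    then obtain j where "w m q = x (real j * (h / real (Suc m)))" using wb[of q m] by blast
    then show ?thesis using c[of q \<omega>] c[of "real j * (h / real (Suc m))" \<omega>] True by (simp add: D_def)
  qed (use c0 in \<open>auto simp: D_def\<close>)
  have "(\<lambda>m. LINT q:{0..<h}|lborel. expectation (D m q)) \<longlonglongrightarrow> (LINT q:{0..<h}|lborel. 0)"
    unfolding set_lebesgue_integral_def
  proof (rule integral_dominated_convergence[where w = "\<lambda>q. indicator {0..<h} q * (2 * c)"])
    show "integrable lborel (\<lambda>q. indicator {0..<h} q * (2 * c))"
      using h by (intro integrable_mult_left) (simp add: integrable_indicator_iff)
    show "AE q in lborel. norm (indicator {0..<h} q *\<^sub>R expectation (D m q)) \<le> indicator {0..<h} q * (2 * c)" for m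
    proof (rule AE_I2)
      fix q
      have "\<bar>expectation (D m q)\<bar> \<le> expectation (\<lambda>\<omega>. \<bar>D m q \<omega>\<bar>)" by (rule integral_abs_bound)
      also have "\<dots> \<le> 2 * c" using Db c0 by (intro integral_le_const) (auto intro!: integrable_const_bound[where B = "2 * c"])
      finally show "norm (indicator {0..<h} q *\<^sub>R expectation (D m q)) \<le> indicator {0..<h} q * (2 * c)"
        by (simp add: indicator_def)
    qed
    show "AE q in lborel. (\<lambda>m. indicator {0..<h} q *\<^sub>R expectation (D m q)) \<longlonglongrightarrow> indicator {0..<h} q *\<^sub>R 0"
    proof (rule AE_I2, cases)
      fix q :: real assume q: "0 \<le> q \<and> q < h"
      then obtain j where j: "\<And>m. w m q = x (real (j m) * (h / real (Suc m)))" "\<And>m. j m < Suc m"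
        "\<And>m. \<bar>q - real (j m) * (h / real (Suc m))\<bar> \<le> h / real (Suc m)" using wb[of q] by metis
      have "(\<lambda>m. q - real (j m) * (h / real (Suc m))) \<longlonglongrightarrow> 0"
      proof (rule Lim_null_comparison)
        show "\<forall>\<^sub>F m in sequentially. norm (q - real (j m) * (h / real (Suc m))) \<le> h / real (Suc m)" using j(3) by simp
        show "(\<lambda>m. h / real (Suc m)) \<longlonglongrightarrow> 0" by (rule LIMSEQ_Suc[OF lim_const_over_n])
      qed
      from tendsto_diff[OF tendsto_const[of q] this] have "(\<lambda>m. real (j m) * (h / real (Suc m))) \<longlonglongrightarrow> q" by simp
      moreover have "real (j m) * (h / real (Suc m)) \<in> {0..h}" for m
      proof -
        have "real (j m) * (h / real (Suc m)) \<le> real (Suc m) * (h / real (Suc m))"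
          using j(2)[of m] h by (intro mult_right_mono) auto
        then show ?thesis using h by simp
      qed
      ultimately have "(\<lambda>m. expectation (\<lambda>\<omega>. \<bar>x (real (j m) * (h / real (Suc m))) \<omega> - x q \<omega>\<bar>)) \<longlonglongrightarrow> 0"
        using q by (intro cont) auto
      then show "(\<lambda>m. indicator {0..<h} q *\<^sub>R expectation (D m q)) \<longlonglongrightarrow> indicator {0..<h} q *\<^sub>R 0"
        using q by (simp add: D_def[abs_def] j(1) abs_minus_commute)
    qed auto
  qed measurable
  then have "(\<lambda>m. K * (LINT q:{0..<h}|lborel. expectation (D m q))) \<longlonglongrightarrow> K * 0" by (intro tendsto_intros) simp
  then have lim: "(\<lambda>m. K * (LINT q:{0..<h}|lborel. expectation (D m q))) \<longlonglongrightarrow> 0" by simp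
  show ?thesis
  proof (rule Lim_null_comparison[OF _ lim], intro always_eventually allI)
    fix m
    have si: "set_integrable lborel X (\<lambda>q. \<psi> q * f q)" if [measurable]: "f \<in> borel_measurable borel" "X \<in> sets borel"
      and "\<And>q. \<bar>f q\<bar> \<le> C" "X \<subseteq> {0..h}" for f X and C :: real
      unfolding set_integrable_def
    proof (rule integrableI_bounded_set[where A = X and B = "K * C"])
      have "emeasure lborel X \<le> emeasure lborel {0..h}" using that by (intro emeasure_mono) auto
      then show "emeasure lborel X < \<infinity>" using h by (simp add: order.strict_trans1)
      have "\<bar>\<psi> q\<bar> * \<bar>f q\<bar> \<le> K * C" if "q \<in> X" for q
        using that \<open>\<And>q. \<bar>f q\<bar> \<le> C\<close> \<open>X \<subseteq> {0..h}\<close> K K0 by (intro mult_mono) auto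
      then show "AE q in lborel. q \<in> X \<longrightarrow> norm (indicator X q *\<^sub>R (\<psi> q * f q)) \<le> K * C" by (auto simp: abs_mult)
    qed auto
    have cs: "cell h (Suc m) j \<subseteq> {0..<h}" if "j < Suc m" for j
    proof -
      have "real (Suc j) * (h / real (Suc m)) \<le> real (Suc m) * (h / real (Suc m))"
        using that h by (intro mult_right_mono) auto
      moreover have "real (Suc m) * (h / real (Suc m)) = h" by simp
      moreover have "0 \<le> real j * (h / real (Suc m))" using h by simp
      ultimately show ?thesis unfolding cell_def by (auto simp del: of_nat_Suc)
    qed
    let ?x = "\<lambda>j \<omega>. x (real j * (h / real (Suc m))) \<omega>"
    let ?diff = "\<lambda>\<omega>. (LINT q:{0..<h}|lborel. \<psi> q * x q \<omega>) - (\<Sum>j<Suc m. (LINT q:cell h (Suc m) j|lborel. \<psi> q) * ?x j \<omega>)"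
    have le: "\<bar>?diff \<omega>\<bar> \<le> K * (LINT q:{0..<h}|lborel. D m q \<omega>)" if [simp]: "\<omega> \<in> space M" for \<omega>
    proof -
      have [measurable]: "(\<lambda>q. x q \<omega>) \<in> borel_measurable borel" by (rule xq) simp
      have [measurable]: "(\<lambda>q. w m q \<omega>) \<in> borel_measurable borel" unfolding w_def by measurable
      have [measurable]: "(\<lambda>q. D m q \<omega>) \<in> borel_measurable borel" unfolding D_def by measurable
      have Dsi: "set_integrable lborel {0..<h} (\<lambda>q. D m q \<omega>)" unfolding set_integrable_def
        by (rule integrableI_bounded_set[where A = "{0..<h}" and B = "2 * c"])
          (use h Db in \<open>auto intro!: AE_I2\<close>)
      have "(LINT q:{0..<h}|lborel. \<psi> q * w m q \<omega>) = (\<integral>q. (\<Sum>j<Suc m. (indicator (cell h (Suc m) j) q *\<^sub>R \<psi> q) * ?x j \<omega>) \<partial>lborel)"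
        unfolding set_lebesgue_integral_def
      proof (rule Bochner_Integration.integral_cong[OF refl])
        fix q
        have "indicator {0..<h} q * (\<psi> q * (indicator (cell h (Suc m) j) q * y)) = indicator (cell h (Suc m) j) q * \<psi> q * y"
          if "j < Suc m" for j and y :: real
          using cs[OF that] by (auto simp: indicator_def)
        then show "indicator {0..<h} q *\<^sub>R (\<psi> q * w m q \<omega>) = (\<Sum>j<Suc m. (indicator (cell h (Suc m) j) q *\<^sub>R \<psi> q) * ?x j \<omega>)"
          unfolding w_def sum_distrib_left real_scaleR_def by (intro sum.cong refl) simp
      qed
      also have "\<dots> = (\<Sum>j<Suc m. (LINT q:cell h (Suc m) j|lborel. \<psi> q) * ?x j \<omega>)"
      proof -
        have "set_integrable lborel (cell h (Suc m) j) (\<lambda>q. \<psi> q * 1)" if "j < Suc m" for j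
          using cs[OF that] by (intro si[of "\<lambda>_. 1" _ 1]) auto
        then show ?thesis unfolding set_lebesgue_integral_def set_integrable_def
          by (subst Bochner_Integration.integral_sum) (auto simp del: sum.lessThan_Suc)
      qed
      finally have "?diff \<omega> = (LINT q:{0..<h}|lborel. \<psi> q * x q \<omega>) - (LINT q:{0..<h}|lborel. \<psi> q * w m q \<omega>)" by simp
      also have "\<dots> = (LINT q:{0..<h}|lborel. \<psi> q * (x q \<omega> - w m q \<omega>))"
      proof -
        \<comment> \<open>\<open>si\<close> asks for a bound on the whole line, while
          \<open>wb\<close> describes \<open>w\<close> only on \<open>{0..<h}\<close>; the
          additional indicator leaves the integral unchanged.\<close>
        have "set_integrable lborel {0..<h} (\<lambda>q. \<psi> q * (w m q \<omega> * indicator {0..<h} q))"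
        proof (rule si[of _ _ c])
          fix q show "\<bar>w m q \<omega> * indicator {0..<h} q\<bar> \<le> c" using wb[of q m] c c0 by (auto simp: indicator_def)
        qed auto
        then have "set_integrable lborel {0..<h} (\<lambda>q. \<psi> q * w m q \<omega>)"
          by (rule set_integrable_cong[THEN iffD1, rotated -1]) auto
        moreover have "set_integrable lborel {0..<h} (\<lambda>q. \<psi> q * x q \<omega>)" using c by (intro si[of _ _ c]) auto
        ultimately show ?thesis by (simp add: right_diff_distrib set_integral_diff)
      qed
      also have "\<bar>\<dots>\<bar> \<le> (LINT q:{0..<h}|lborel. K * D m q \<omega>)"
        unfolding set_lebesgue_integral_def
      proof (rule order_trans[OF integral_abs_bound], rule integral_mono')
        show "integrable lborel (\<lambda>q. indicator {0..<h} q *\<^sub>R (K * D m q \<omega>))"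
          using set_integrable_mult_right[OF Dsi, of K] by (simp add: set_integrable_def)
        show "\<bar>indicator {0..<h} q *\<^sub>R (\<psi> q * (x q \<omega> - w m q \<omega>))\<bar> \<le> indicator {0..<h} q *\<^sub>R (K * D m q \<omega>)" for q
          using K[of q] by (auto simp: indicator_def D_def abs_mult intro!: mult_right_mono)
      qed (use K0 in \<open>auto simp: D_def\<close>)
      finally show ?thesis by simp
    qed
    have Di: "integrable M (\<lambda>\<omega>. LINT q:{0..<h}|lborel. D m q \<omega>)"
      by (rule integrable_set_integral[OF D]) (use Db h in auto)
    have "expectation (\<lambda>\<omega>. \<bar>?diff \<omega>\<bar>) \<le> expectation (\<lambda>\<omega>. K * (LINT q:{0..<h}|lborel. D m q \<omega>))"
    proof (rule integral_mono')
      show "integrable M (\<lambda>\<omega>. K * (LINT q:{0..<h}|lborel. D m q \<omega>))" using Di by simp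
      show "0 \<le> K * (LINT q:{0..<h}|lborel. D m q \<omega>)" if "\<omega> \<in> space M" for \<omega> using le[OF that] by linarith
    qed (rule le)
    also have "\<dots> = K * (LINT q:{0..<h}|lborel. expectation (D m q))"
      using expectation_set_integral[OF D[of m], of "2 * c" "{0..<h}"] Db h by simp
    finally show "norm (expectation (\<lambda>\<omega>. \<bar>?diff \<omega>\<bar>)) \<le> K * (LINT q:{0..<h}|lborel. expectation (D m q))"
      by (simp add: integral_nonneg_AE)
  qed
qed

end

subsection \<open>Integration by parts along a path\<close>

lemma set_integrable_lborel_shift:
  fixes f :: "real \<Rightarrow> real"
  assumes "set_integrable lborel {c + a..c + b} f"
  shows "set_integrable lborel {a..b} (\<lambda>r. f (c + r))"
  using lborel_integrable_real_affine[OF assms[unfolded set_integrable_def], of 1 c]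
  by (simp add: set_integrable_def indicator_def)

lemma set_integral_lborel_shift:
  fixes f :: "real \<Rightarrow> real"
  shows "(LINT r:{a..b}|lborel. f (c + r)) = (LINT r:{c + a..c + b}|lborel. f r)"
  using lborel_integral_real_affine[of 1 "\<lambda>r. indicator {c + a..c + b} r *\<^sub>R f r" c]
  by (simp add: set_lebesgue_integral_def indicator_def)

lemma set_integral_lborel_combine:
  fixes f :: "real \<Rightarrow> real"
  assumes "set_integrable lborel {a..c} f" "a \<le> b" "b \<le> c"
  shows "(LINT r:{a..c}|lborel. f r) = (LINT r:{a..b}|lborel. f r) + (LINT r:{b..c}|lborel. f r)"
proof -
  have "set_integrable lborel {a..b} f" "set_integrable lborel {b..c} f"
    using assms by (auto intro: set_integrable_subset)
  then show ?thesis using assms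
    by (simp add: set_borel_integral_eq_integral Henstock_Kurzweil_Integration.integral_combine)
qed

lemma set_integral_lborel_Ico:
  fixes f :: "real \<Rightarrow> real"
  assumes [measurable]: "f \<in> borel_measurable borel"
  shows "(LINT r:{a..<b}|lborel. f r) = (LINT r:{a..b}|lborel. f r)"
  unfolding set_lebesgue_integral_def
  by (rule integral_cong_AE) (use AE_lborel_singleton[of b] in \<open>auto simp: indicator_def elim!: eventually_mono\<close>)

lemma set_integrable_mult_continuous:
  fixes f \<psi> :: "real \<Rightarrow> real"
  assumes f: "set_integrable lborel {a..b} f" and \<psi>: "continuous_on {a..b} \<psi>"
  shows "set_integrable lborel {a..b} (\<lambda>q. \<psi> q * f q)"
proof -
  obtain K where K: "\<And>q. q \<in> {a..b} \<Longrightarrow> \<bar>\<psi> q\<bar> \<le> K"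
    using compact_imp_bounded[OF compact_continuous_image[OF \<psi> compact_Icc]]
    unfolding bounded_iff by (metis imageI real_norm_def)
  have m: "(\<lambda>q. indicator {a..b} q *\<^sub>R \<psi> q) \<in> borel_measurable borel"
    by (rule borel_measurable_continuous_on_indicator) (use \<psi> in auto)
  have [measurable]: "(\<lambda>q. indicator {a..b} q *\<^sub>R f q) \<in> borel_measurable borel"
    using borel_measurable_integrable[OF f[unfolded set_integrable_def]] by simp
  have eq: "indicator {a..b} q *\<^sub>R (\<psi> q * f q) = (indicator {a..b} q *\<^sub>R \<psi> q) * (indicator {a..b} q *\<^sub>R f q)" for q
    by (simp add: indicator_def)
  show ?thesis unfolding set_integrable_def
  proof (rule Bochner_Integration.integrable_bound)
    show "integrable lborel (\<lambda>q. K * (indicator {a..b} q *\<^sub>R f q))"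
      using f by (simp add: set_integrable_def)
    show "(\<lambda>q. indicator {a..b} q *\<^sub>R (\<psi> q * f q)) \<in> borel_measurable lborel"
      unfolding eq using m by measurable
    show "AE q in lborel. norm (indicator {a..b} q *\<^sub>R (\<psi> q * f q)) \<le> norm (K * (indicator {a..b} q *\<^sub>R f q))"
      using K by (auto simp: indicator_def abs_mult intro!: AE_I2 mult_right_mono intro: order_trans[OF _ abs_ge_self])
  qed
qed

text \<open>Fubini over the triangle \<open>0 \<le> r \<le> q \<le> h\<close>: for fixed
  \<open>r\<close>, the integral of \<open>\<psi>\<close> over \<open>{r..h}\<close> is
  \<open>\<phi> h - \<phi> r\<close>.\<close>

lemma integral_primitive_by_parts:
  fixes z \<phi> \<psi> :: "real \<Rightarrow> real"
  assumes h: "h > 0" and z: "set_integrable lborel {0..h} z" and \<psi>: "continuous_on UNIV \<psi>"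
    and \<phi>: "\<And>q. q \<in> {0..h} \<Longrightarrow> (\<phi> has_real_derivative \<psi> q) (at q within {0..h})"
  shows "(LINT q:{0..h}|lborel. \<psi> q * (LINT r:{0..q}|lborel. z r)) = (LINT r:{0..h}|lborel. (\<phi> h - \<phi> r) * z r)"
    and "set_integrable lborel {0..h} (\<lambda>q. \<psi> q * (LINT r:{0..q}|lborel. z r))"
proof -
  define \<zeta> where "\<zeta> r = indicator {0..h} r *\<^sub>R z r" for r
  have \<zeta>: "integrable lborel \<zeta>" using z unfolding \<zeta>_def set_integrable_def .
  have [measurable]: "\<zeta> \<in> borel_measurable borel" using borel_measurable_integrable[OF \<zeta>] by simp
  have [measurable]: "\<psi> \<in> borel_measurable borel" using \<psi> by (rule borel_measurable_continuous_onI)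
  define f where "f q r = (if 0 \<le> r \<and> r \<le> q \<and> q \<le> h then \<psi> q * \<zeta> r else 0)" for q r
  obtain K where K: "\<And>q. q \<in> {0..h} \<Longrightarrow> \<bar>\<psi> q\<bar> \<le> K"
    using compact_imp_bounded[OF compact_continuous_image[OF continuous_on_subset[OF \<psi>] compact_Icc[of 0 h]]]
    unfolding bounded_iff by (metis imageI real_norm_def subset_UNIV)
  have K0: "K \<ge> 0" using K[of 0] h by auto
  have fm [measurable]: "(\<lambda>(q, r). f q r) \<in> borel_measurable (lborel \<Otimes>\<^sub>M lborel)"
  proof -
    have "(\<lambda>(q, r). f q r) \<in> borel_measurable (borel \<Otimes>\<^sub>M borel)" unfolding f_def by measurable
    then show ?thesis by (simp cong: measurable_cong_sets)
  qed
  have int: "integrable (lborel \<Otimes>\<^sub>M lborel) (\<lambda>(q, r). f q r)"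
  proof (rule Bochner_Integration.integrable_bound)
    show "integrable (lborel \<Otimes>\<^sub>M lborel) (\<lambda>(q, r). (indicator {0..h} q * K) * \<zeta> r)"
    proof (rule lborel_pair.Fubini_integrable)
      have "(\<lambda>(q, r). (indicator {0..h} q * K) * \<zeta> r) \<in> borel_measurable (borel \<Otimes>\<^sub>M borel)" by measurable
      then show "(\<lambda>(q, r). (indicator {0..h} q * K) * \<zeta> r) \<in> borel_measurable (lborel \<Otimes>\<^sub>M lborel)"
        by (simp cong: measurable_cong_sets)
      show "integrable lborel (\<lambda>q. \<integral>r. norm (case (q, r) of (q, r) \<Rightarrow> (indicator {0..h} q * K) * \<zeta> r) \<partial>lborel)"
        using h by (simp add: abs_mult integrable_indicator_iff)
    qed (use \<zeta> in \<open>auto intro!: AE_I2\<close>)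
    show "AE x in lborel \<Otimes>\<^sub>M lborel. norm (case x of (q, r) \<Rightarrow> f q r) \<le> norm (case x of (q, r) \<Rightarrow> (indicator {0..h} q * K) * \<zeta> r)"
      using K K0 by (auto simp: f_def abs_mult intro!: AE_I2 mult_right_mono)
  qed simp
  have fq: "(\<integral>r. f q r \<partial>lborel) = indicator {0..h} q *\<^sub>R (\<psi> q * (LINT r:{0..q}|lborel. z r))" for q
  proof -
    have "(\<integral>r. f q r \<partial>lborel) = (\<integral>r. (indicator {0..h} q * \<psi> q) * (indicator {0..q} r *\<^sub>R z r) \<partial>lborel)"
      by (rule Bochner_Integration.integral_cong) (auto simp: f_def \<zeta>_def indicator_def)
    then show ?thesis by (simp add: set_lebesgue_integral_def)
  qed
  have fr: "(\<integral>q. f q r \<partial>lborel) = indicator {0..h} r *\<^sub>R ((\<phi> h - \<phi> r) * z r)" for r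
  proof (cases "r \<in> {0..h}")
    case True
    have "(\<integral>q. f q r \<partial>lborel) = (\<integral>q. (indicator {r..h} q *\<^sub>R \<psi> q) * z r \<partial>lborel)"
      by (rule Bochner_Integration.integral_cong) (use True in \<open>auto simp: f_def \<zeta>_def indicator_def\<close>)
    also have "\<dots> = (\<integral>q. indicator {r..h} q *\<^sub>R \<psi> q \<partial>lborel) * z r" by simp
    also have "(\<integral>q. indicator {r..h} q *\<^sub>R \<psi> q \<partial>lborel) = \<phi> h - \<phi> r"
    proof (rule integral_FTC_Icc)
      show "(\<phi> has_vector_derivative \<psi> q) (at q within {r..h})" if "r \<le> q" "q \<le> h" for q
        using \<phi>[of q] that True
        by (auto simp: has_real_derivative_iff_has_vector_derivative intro: has_vector_derivative_within_subset)
    qed (use True \<psi> in \<open>auto intro: continuous_on_subset\<close>)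
    finally show ?thesis using True by simp
  next
    case False
    then have "f q r = 0" for q by (auto simp: f_def \<zeta>_def indicator_def)
    then show ?thesis using False by simp
  qed
  show "(LINT q:{0..h}|lborel. \<psi> q * (LINT r:{0..q}|lborel. z r)) = (LINT r:{0..h}|lborel. (\<phi> h - \<phi> r) * z r)"
    using lborel_pair.Fubini_integral[OF int] unfolding fq fr by (simp add: set_lebesgue_integral_def)
  show "set_integrable lborel {0..h} (\<lambda>q. \<psi> q * (LINT r:{0..q}|lborel. z r))"
    using lborel_pair.integrable_fst[OF int] unfolding fq by (simp add: set_integrable_def)
qed

text \<open>With \<open>N\<close> read as noise, the left-hand side is the integral of
  \<open>\<phi>\<close> against it, written by parts. The right-hand side involves only the end
  values of \<open>y\<close> and the drift defect \<open>\<psi> q * y q + \<phi> q * z q\<close>,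
  which becomes small when summed over a good test family.\<close>

lemma path_by_parts:
  fixes y z \<phi> \<psi> :: "real \<Rightarrow> real"
  assumes h: "h > 0" and y: "set_integrable lborel {0..h} y" and z: "set_integrable lborel {0..h} z"
    and \<psi>: "continuous_on UNIV \<psi>"
    and \<phi>: "\<And>q. q \<in> {0..h} \<Longrightarrow> (\<phi> has_real_derivative \<psi> q) (at q within {0..h})"
    and N: "\<And>q. N q = y q - y 0 - (LINT r:{0..q}|lborel. z r)"
  shows "\<phi> h * N h - (LINT q:{0..h}|lborel. \<psi> q * N q)
    = \<phi> h * y h - \<phi> 0 * y 0 - (LINT q:{0..h}|lborel. \<psi> q * y q + \<phi> q * z q)"
    and "set_integrable lborel {0..h} (\<lambda>q. \<psi> q * N q)"
proof -
  note parts = integral_primitive_by_parts[OF h z \<psi> \<phi>]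
  have \<psi>': "continuous_on {0..h} \<psi>" using \<psi> by (rule continuous_on_subset) simp
  have \<phi>': "continuous_on {0..h} \<phi>" using \<phi> by (rule DERIV_continuous_on)
  have \<psi>i: "set_integrable lborel {0..h} \<psi>" using \<psi>' by (rule borel_integrable_atLeastAtMost')
  have \<psi>y: "set_integrable lborel {0..h} (\<lambda>q. \<psi> q * y q)" using y \<psi>' by (rule set_integrable_mult_continuous)
  have \<phi>z: "set_integrable lborel {0..h} (\<lambda>q. \<phi> q * z q)" using z \<phi>' by (rule set_integrable_mult_continuous)
  have FTC: "(LINT q:{0..h}|lborel. \<psi> q) = \<phi> h - \<phi> 0" unfolding set_lebesgue_integral_def
    by (rule integral_FTC_Icc) (use h \<phi> \<psi>' in \<open>auto simp: has_real_derivative_iff_has_vector_derivative\<close>)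
  have eq: "\<psi> q * N q = \<psi> q * y q - \<psi> q * y 0 - \<psi> q * (LINT r:{0..q}|lborel. z r)" for q
    by (simp add: N algebra_simps)
  show "set_integrable lborel {0..h} (\<lambda>q. \<psi> q * N q)"
    unfolding eq using \<psi>y \<psi>i parts(2) by (intro set_integral_diff) auto
  have "(LINT q:{0..h}|lborel. \<psi> q * N q) = (LINT q:{0..h}|lborel. \<psi> q * y q) - (\<phi> h - \<phi> 0) * y 0
      - (LINT r:{0..h}|lborel. (\<phi> h - \<phi> r) * z r)"
    unfolding eq using \<psi>y \<psi>i parts FTC by (simp add: set_integral_diff)
  also have "(LINT r:{0..h}|lborel. (\<phi> h - \<phi> r) * z r) = \<phi> h * (LINT r:{0..h}|lborel. z r) - (LINT r:{0..h}|lborel. \<phi> r * z r)"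
    unfolding left_diff_distrib using z \<phi>z by (simp add: set_integral_diff)
  finally show "\<phi> h * N h - (LINT q:{0..h}|lborel. \<psi> q * N q)
      = \<phi> h * y h - \<phi> 0 * y 0 - (LINT q:{0..h}|lborel. \<psi> q * y q + \<phi> q * z q)"
    using \<psi>y \<phi>z by (simp add: N set_integral_add algebra_simps)
qed

subsection \<open>The noise seen along the solution\<close>

text \<open>Here \<open>l t v\<close> stands for \<open>L t (adjoint B v)\<close>.\<close>

locale weak_cauchy = prob_space M + generator S DA A
  for M :: "'w measure" and S :: "real \<Rightarrow> ('v::{real_inner,complete_space,second_countable_topology}) \<Rightarrow>\<^sub>L 'v"
    and DA A +
  fixes T :: real and Y :: "real \<Rightarrow> 'w \<Rightarrow> 'v" and y0 :: 'v and l :: "real \<Rightarrow> 'v \<Rightarrow> 'w \<Rightarrow> real"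
  assumes T: "T > 0"
    and Y_measurable: "(\<lambda>(s, \<omega>). Y s \<omega>) \<in> borel_measurable (borel \<Otimes>\<^sub>M M)"
    and bochner: "weakly_bochner_regular M T Y"
    and weak: "\<And>v t. v \<in> adj_dom DA A \<Longrightarrow> t \<in> {0..T} \<Longrightarrow> AE \<omega> in M. Y t \<omega> \<bullet> v =
          y0 \<bullet> v + (LINT s:{0..t}|lborel. Y s \<omega> \<bullet> adj_op DA A v) + l t v \<omega>"
    and levy: "\<And>n (vs :: nat \<Rightarrow> 'v). levy_process_Rn M {..<n} (\<lambda>t \<omega> i. l t (vs i) \<omega>)"
begin

lemma Y_shift_measurable [measurable]: "(\<lambda>(q, \<omega>). Y (s + q) \<omega>) \<in> borel_measurable (borel \<Otimes>\<^sub>M M)"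
  using measurable_compose[of "\<lambda>(q, \<omega>). (s + q, \<omega>)" "borel \<Otimes>\<^sub>M M", OF _ Y_measurable]
  by (simp add: split_beta')

lemma Y_measurable_fixed [measurable]: "Y t \<in> borel_measurable M"
  using measurable_Pair2[OF Y_measurable, of t] by simp

lemma Y_measurable_path: "\<omega> \<in> space M \<Longrightarrow> (\<lambda>t. Y t \<omega>) \<in> borel_measurable borel"
  using measurable_Pair1[OF Y_measurable] by simp

lemma bochner_integrable:
  assumes "continuous_on {0..h} g" "0 \<le> s" "0 \<le> h" "s + h \<le> T"
  shows "AE \<omega> in M. set_integrable lborel {0..h} (\<lambda>q. Y (s + q) \<omega> \<bullet> g q)"
proof -
  \<comment> \<open>\<open>g\<close> is continued by its end values outside the window
    \<open>{s..s + h}\<close>, because regularity speaks of continuous functions on all of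
    \<open>{0..T}\<close>.\<close>
  have "continuous_on {0..T} (\<lambda>r. g (max 0 (min h (r - s))))"
    by (rule continuous_on_compose2[OF assms(1)]) (use assms in \<open>auto intro!: continuous_intros\<close>)
  then have "AE \<omega> in M. set_integrable lborel {0..T} (\<lambda>r. Y r \<omega> \<bullet> g (max 0 (min h (r - s))))"
    using bochner unfolding weakly_bochner_regular_def by blast
  then show ?thesis
  proof eventually_elim
    case (elim \<omega>)
    have "set_integrable lborel {s + 0..s + h} (\<lambda>r. Y r \<omega> \<bullet> g (max 0 (min h (r - s))))"
      by (rule set_integrable_subset[OF elim]) (use assms in auto)
    then have "set_integrable lborel {0..h} (\<lambda>q. Y (s + q) \<omega> \<bullet> g (max 0 (min h (s + q - s))))"
      by (rule set_integrable_lborel_shift)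
    then show ?case by (rule set_integrable_cong[THEN iffD1, rotated -1]) auto
  qed
qed

text \<open>A version of the increment \<open>l (s + q) g - l s g\<close> which, unlike the noise itself, is jointly measurable
  in \<open>q\<close> and the sample point.\<close>

definition N :: "real \<Rightarrow> 'v \<Rightarrow> real \<Rightarrow> 'w \<Rightarrow> real" where
  "N s g q \<omega> = Y (s + q) \<omega> \<bullet> g - Y s \<omega> \<bullet> g - (LINT r:{0..q}|lborel. Y (s + r) \<omega> \<bullet> adj_op DA A g)"

lemma N_joint_measurable [measurable]: "(\<lambda>(q, \<omega>). N s g q \<omega>) \<in> borel_measurable (borel \<Otimes>\<^sub>M M)"
proof -
  have "(\<lambda>((q, \<omega>), r). if 0 \<le> r \<and> r \<le> q then Y (s + r) \<omega> \<bullet> adj_op DA A g else 0) \<in> borel_measurable ((borel \<Otimes>\<^sub>M M) \<Otimes>\<^sub>M borel)"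
  proof -
    have [measurable]: "(\<lambda>x. Y (s + snd x) (snd (fst x))) \<in> borel_measurable ((borel \<Otimes>\<^sub>M M) \<Otimes>\<^sub>M borel)"
      using measurable_compose[of "\<lambda>x. (snd x, snd (fst x))" "(borel \<Otimes>\<^sub>M M) \<Otimes>\<^sub>M borel" "borel \<Otimes>\<^sub>M M", OF _ Y_shift_measurable[of s]]
      by simp
    show ?thesis unfolding split_beta' by measurable
  qed
  then have "(\<lambda>((q, \<omega>), r). indicator {0..q} r *\<^sub>R (Y (s + r) \<omega> \<bullet> adj_op DA A g)) \<in> borel_measurable ((borel \<Otimes>\<^sub>M M) \<Otimes>\<^sub>M lborel)"
    by (simp add: indicator_def split_beta' if_distrib[of "\<lambda>x. x * _"] cong: if_cong measurable_cong_sets)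
  then have [measurable]: "(\<lambda>x. \<integral>r. indicator {0..fst x} r *\<^sub>R (Y (s + r) (snd x) \<bullet> adj_op DA A g) \<partial>lborel) \<in> borel_measurable (borel \<Otimes>\<^sub>M M)"
    by (intro lborel.borel_measurable_lebesgue_integral) (simp add: split_beta')
  show ?thesis unfolding N_def set_lebesgue_integral_def split_beta' by measurable
qed

lemma N_measurable [measurable]: "N s g q \<in> borel_measurable M"
  using measurable_Pair2[OF N_joint_measurable, of q] by simp

lemma N_path_measurable: "\<omega> \<in> space M \<Longrightarrow> (\<lambda>q. N s g q \<omega>) \<in> borel_measurable borel"
  using measurable_Pair1[OF N_joint_measurable] by simp

text \<open>The weak equation at \<open>s + q\<close> minus the one at \<open>s\<close>. The
  exceptional null set depends on \<open>q\<close>, so the identity is used for finitely many times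
  at once only.\<close>

lemma N_eq_increment:
  assumes g: "g \<in> adj_dom DA A" and "0 \<le> s" "0 \<le> q" "s + q \<le> T"
  shows "AE \<omega> in M. N s g q \<omega> = l (s + q) g \<omega> - l s g \<omega>"
proof -
  have "AE \<omega> in M. set_integrable lborel {0..T} (\<lambda>r. Y (0 + r) \<omega> \<bullet> adj_op DA A g)"
    using T by (intro bochner_integrable) auto
  moreover have "AE \<omega> in M. Y (s + q) \<omega> \<bullet> g =
      y0 \<bullet> g + (LINT r:{0..s + q}|lborel. Y r \<omega> \<bullet> adj_op DA A g) + l (s + q) g \<omega>"
    "AE \<omega> in M. Y s \<omega> \<bullet> g = y0 \<bullet> g + (LINT r:{0..s}|lborel. Y r \<omega> \<bullet> adj_op DA A g) + l s g \<omega>"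
    using assms by (auto intro!: weak)
  ultimately show ?thesis
  proof eventually_elim
    case (elim \<omega>)
    have i: "set_integrable lborel {0..s + q} (\<lambda>r. Y r \<omega> \<bullet> adj_op DA A g)"
      by (rule set_integrable_subset[OF elim(1)[unfolded add_0_left]]) (use assms in auto)
    show ?case using elim(2,3) set_integral_lborel_combine[OF i, of s] assms
      set_integral_lborel_shift[of 0 q "\<lambda>r. Y r \<omega> \<bullet> adj_op DA A g" s]
      by (simp add: N_def)
  qed
qed

lemma l_measurable [measurable]: "t \<ge> 0 \<Longrightarrow> l t g \<in> borel_measurable M"
proof -
  assume "t \<ge> 0"
  then have "(\<lambda>\<omega>. restrict (\<lambda>i. l t g \<omega>) {..<1::nat}) \<in> M \<rightarrow>\<^sub>M PiM {..<1} (\<lambda>_. borel)"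
    using levy[of 1 "\<lambda>_. g"] unfolding levy_process_Rn_def by blast
  from measurable_compose[OF this measurable_component_singleton[of 0 "{..<1}" "\<lambda>_. borel"]]
  show ?thesis by simp
qed

lemma N_stochastically_continuous:
  assumes g: "g \<in> adj_dom DA A" and s: "0 \<le> s" "s + h \<le> T" and q: "q \<in> {0..h}"
    and u: "\<And>i. u i \<in> {0..h}" "u \<longlonglongrightarrow> q"
  shows "(\<lambda>i. L0norm (\<lambda>\<omega>. N s g (u i) \<omega> - N s g q \<omega>)) \<longlonglongrightarrow> 0"
proof -
  have "(\<lambda>i. L0norm (\<lambda>\<omega>. l (s + u i) g \<omega> - l (s + q) g \<omega>)) \<longlonglongrightarrow> 0"
  proof (rule L0norm_tendsto_prob)
    show "(\<lambda>\<omega>. l (s + u i) g \<omega> - l (s + q) g \<omega>) \<in> borel_measurable M" for i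
      using s q u(1)[of i] by (intro borel_measurable_diff l_measurable) auto
    fix \<epsilon> :: real assume \<epsilon>: "\<epsilon> > 0"
    define p where "p r = prob {\<omega> \<in> space M. \<bar>l r g \<omega> - l (s + q) g \<omega>\<bar> > \<epsilon>}" for r
    have "\<forall>t\<ge>0. \<forall>e>0. ((\<lambda>s. prob {\<omega> \<in> space M. sqrt (\<Sum>i<1::nat. (l s g \<omega> - l t g \<omega>)\<^sup>2) > e}) \<longlongrightarrow> 0) (at t within {0..})"
      using levy[of 1 "\<lambda>_. g"] unfolding levy_process_Rn_def by (elim conjE) assumption
    then have "(p \<longlongrightarrow> 0) (at (s + q) within {0..})"
      using s q \<epsilon> by (simp add: p_def[abs_def])
    \<comment> \<open>The limit is over a punctured neighbourhood, whereas \<open>u i\<close> may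
      equal \<open>q\<close>; the value 0 turns it into continuity.\<close>
    moreover have "p (s + q) = 0" using \<epsilon> by (simp add: p_def)
    ultimately have "continuous (at (s + q) within {0..}) p" by (simp add: continuous_within)
    moreover have "(\<lambda>i. s + u i) \<longlonglongrightarrow> s + q" by (intro tendsto_intros u)
    moreover have "\<forall>i. s + u i \<in> {0..}" using s u(1) by auto
    ultimately have "(\<lambda>i. p (s + u i)) \<longlonglongrightarrow> p (s + q)"
      by (intro continuous_within_tendsto_compose'[of "s + q" "{0..}" p]) auto
    then show "(\<lambda>i. prob {\<omega> \<in> space M. \<bar>l (s + u i) g \<omega> - l (s + q) g \<omega>\<bar> > \<epsilon>}) \<longlonglongrightarrow> 0"
      using \<open>p (s + q) = 0\<close> by (simp add: p_def)
  qed
  moreover have "L0norm (\<lambda>\<omega>. N s g (u i) \<omega> - N s g q \<omega>) = L0norm (\<lambda>\<omega>. l (s + u i) g \<omega> - l (s + q) g \<omega>)" for i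
  proof (rule L0norm_cong_AE)
    have "AE \<omega> in M. N s g (u i) \<omega> = l (s + u i) g \<omega> - l s g \<omega>" "AE \<omega> in M. N s g q \<omega> = l (s + q) g \<omega> - l s g \<omega>"
      using s q u(1)[of i] by (auto intro!: N_eq_increment g)
    then show "AE \<omega> in M. N s g (u i) \<omega> - N s g q \<omega> = l (s + u i) g \<omega> - l (s + q) g \<omega>"
      by eventually_elim simp
    show "(\<lambda>\<omega>. l (s + u i) g \<omega> - l (s + q) g \<omega>) \<in> borel_measurable M"
      using s q u(1)[of i] by (intro borel_measurable_diff l_measurable) auto
  qed measurable
  ultimately show ?thesis by simp
qed

end

lemma (in sigma_finite_measure) set_integral_lborel_measurable:
  fixes f :: "real \<Rightarrow> 'a \<Rightarrow> real"
  assumes f: "(\<lambda>(q, \<omega>). f q \<omega>) \<in> borel_measurable (borel \<Otimes>\<^sub>M M)" and [measurable]: "A \<in> sets borel"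
  shows "(\<lambda>\<omega>. LINT q:A|lborel. f q \<omega>) \<in> borel_measurable M"
proof -
  have [measurable]: "(\<lambda>x. f (snd x) (fst x)) \<in> borel_measurable (M \<Otimes>\<^sub>M borel)"
    using measurable_compose[OF measurable_pair_swap' f] by (simp add: split_beta')
  have "(\<lambda>(\<omega>, q). indicator A q *\<^sub>R f q \<omega>) \<in> borel_measurable (M \<Otimes>\<^sub>M borel)"
    unfolding split_beta' by measurable
  then have "(\<lambda>(\<omega>, q). indicator A q *\<^sub>R f q \<omega>) \<in> borel_measurable (M \<Otimes>\<^sub>M lborel)"
    by (simp cong: measurable_cong_sets)
  then show ?thesis unfolding set_lebesgue_integral_def
    by (intro lborel.borel_measurable_lebesgue_integral)
qed

section \<open>Laws of weighted integrals of the noise\<close>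

context weak_cauchy
begin

lemma N_path_integrable:
  assumes g: "g \<in> adj_dom DA A" and "h > 0" "0 \<le> s" "s + h \<le> T" and \<psi>: "continuous_on UNIV \<psi>"
  shows "AE \<omega> in M. set_integrable lborel {0..h} (\<lambda>q. \<psi> q * N s g q \<omega>)"
proof -
  have "AE \<omega> in M. set_integrable lborel {0..h} (\<lambda>q. Y (s + q) \<omega> \<bullet> g)"
    "AE \<omega> in M. set_integrable lborel {0..h} (\<lambda>q. Y (s + q) \<omega> \<bullet> adj_op DA A g)"
    using assms by (auto intro!: bochner_integrable)
  then show ?thesis
  proof eventually_elim
    case (elim \<omega>)
    \<comment> \<open>Any primitive of \<open>\<psi>\<close> can serve as \<open>\<phi>\<close> in
      \<open>path_by_parts\<close>, of which only the integrability is wanted here.\<close>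
    have "((\<lambda>q. integral {0..q} \<psi>) has_real_derivative \<psi> q) (at q within {0..h})" if "q \<in> {0..h}" for q
      using that by (intro integral_has_real_derivative continuous_on_subset[OF \<psi>]) auto
    from path_by_parts(2)[OF \<open>h > 0\<close> elim \<psi> this, of "\<lambda>q. N s g q \<omega>"] show ?case by (simp add: N_def)
  qed
qed

text \<open>If \<open>b k = \<phi> k h\<close> and \<open>\<psi> k\<close> is the derivative of
  \<open>\<phi> k\<close>, this is the integral of the test function against the noise over
  \<open>{s..s + h}\<close>, written by parts so that only ordinary integrals of \<open>N\<close>
  occur.\<close>

definition Theta :: "real \<Rightarrow> real \<Rightarrow> nat \<Rightarrow> (nat \<Rightarrow> real) \<Rightarrow> (nat \<Rightarrow> real \<Rightarrow> real) \<Rightarrow> (nat \<Rightarrow> 'v) \<Rightarrow> 'w \<Rightarrow> real" where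
  "Theta s h n b \<psi> g \<omega> = (\<Sum>k<n. b k * N s (g k) h \<omega> - (LINT q:{0..h}|lborel. \<psi> k q * N s (g k) q \<omega>))"

lemma Theta_measurable:
  assumes "\<And>k. continuous_on UNIV (\<psi> k)"
  shows "Theta s h n b \<psi> g \<in> borel_measurable M"
proof -
  have [measurable]: "\<psi> k \<in> borel_measurable borel" for k using assms by (rule borel_measurable_continuous_onI)
  have [measurable]: "(\<lambda>\<omega>. LINT q:{0..h}|lborel. \<psi> k q * N s (g k) q \<omega>) \<in> borel_measurable M" for k
    by (rule set_integral_lborel_measurable) measurable
  show ?thesis unfolding Theta_def[abs_def] by measurable
qed

text \<open>Truncated Riemann sums of the noise are functions of finitely many increments on a grid,
  whose joint law does not depend on \<open>s\<close>. The mesh tends to 0 while the truncation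
  level \<open>c\<close> is fixed, and \<open>c\<close> tends to infinity afterwards; expectations
  of cosines pass to both limits.\<close>

lemma Theta_law:
  assumes h: "h > 0" and s: "0 \<le> s" "s + h \<le> T" and g: "\<And>k. g k \<in> adj_dom DA A"
    and \<psi>: "\<And>k. continuous_on UNIV (\<psi> k)"
  shows "expectation (\<lambda>\<omega>. cos (Theta s h n b \<psi> g \<omega>)) = expectation (\<lambda>\<omega>. cos (Theta 0 h n b \<psi> g \<omega>))"
proof -
  have [measurable]: "\<psi> k \<in> borel_measurable borel" for k using \<psi> by (rule borel_measurable_continuous_onI)
  define I where "I c s k \<omega> = (LINT q:{0..h}|lborel. \<psi> k q * clip c (N s (g k) q \<omega>))" for c s k \<omega>
  define W where "W m k j = (LINT q:cell h (Suc m) j|lborel. \<psi> k q)" for m k j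
  define d where "d m = h / real (Suc m)" for m
  define R where "R c m s k \<omega> = (\<Sum>j<Suc m. W m k j * clip c (N s (g k) (real j * d m) \<omega>))" for c m s k \<omega>
  \<comment> \<open>Only the integrated noise is truncated; the end value is itself a sum of
    increments and is kept exactly.\<close>
  define Tc where "Tc c s \<omega> = (\<Sum>k<n. b k * N s (g k) h \<omega> - I c s k \<omega>)" for c s \<omega>
  define Tm where "Tm c m s \<omega> = (\<Sum>k<n. b k * N s (g k) h \<omega> - R c m s k \<omega>)" for c m s \<omega>
  have I_meas [measurable]: "I c s k \<in> borel_measurable M" for c s k
    unfolding I_def[abs_def] by (rule set_integral_lborel_measurable) measurable
  have [measurable]: "R c m s k \<in> borel_measurable M" for c m s k unfolding R_def[abs_def] by measurable
  have [measurable]: "Tc c s \<in> borel_measurable M" "Tm c m s \<in> borel_measurable M" for c m s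
    unfolding Tc_def[abs_def] Tm_def[abs_def] by measurable
  have Th [measurable]: "Theta s h n b \<psi> g \<in> borel_measurable M" for s using \<psi> by (rule Theta_measurable)

  have law: "expectation (\<lambda>\<omega>. cos (Tm c m s \<omega>)) = expectation (\<lambda>\<omega>. cos (Tm c m 0 \<omega>))" for c m
  proof -
    \<comment> \<open>Values of the noise at grid points are partial sums of its increments, so that
      one function \<open>F\<close> of the increments serves every starting time.\<close>
    define F where "F D = cos (\<Sum>k<n. b k * (\<Sum>i<Suc m. D i k) - (\<Sum>j<Suc m. W m k j * clip c (\<Sum>i<j. D i k)))"
      for D :: "nat \<Rightarrow> nat \<Rightarrow> real"
    have Dik [measurable]: "(\<lambda>D. D i k) \<in> borel_measurable (PiM {..<Suc m} (\<lambda>_. PiM {..<n} (\<lambda>_. borel :: real measure)))"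
      if "i < Suc m" "k < n" for i k
      using measurable_compose[OF measurable_component_singleton[of i "{..<Suc m}" "\<lambda>_. PiM {..<n} (\<lambda>_. borel)"]
          measurable_component_singleton[of k "{..<n}" "\<lambda>_. borel"]] that by simp
    have cosm: "(cos :: real \<Rightarrow> real) \<in> borel_measurable borel" by measurable
    have F [measurable]: "F \<in> borel_measurable (PiM {..<Suc m} (\<lambda>_. PiM {..<n} (\<lambda>_. borel)))"
      unfolding F_def[abs_def]
      by (intro measurable_compose[OF _ cosm] borel_measurable_sum borel_measurable_diff borel_measurable_times
          borel_measurable_const measurable_compose[OF _ clip_measurable] Dik) auto
    have "expectation (\<lambda>\<omega>. cos (Tm c m s \<omega>)) = expectation (\<lambda>\<omega>. F (\<lambda>i\<in>{..<Suc m}. \<lambda>k\<in>{..<n}.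
        l (s + real (Suc i) * d m) (g k) \<omega> - l (s + real i * d m) (g k) \<omega>))" if s: "0 \<le> s" "s + h \<le> T" for s
    proof (rule integral_cong_AE)
      have d0: "d m > 0" "real (Suc m) * d m = h" using h by (simp_all add: d_def del: of_nat_Suc)
      have jd: "0 \<le> real j * d m \<and> s + real j * d m \<le> T" if "j \<le> Suc m" for j
      proof -
        have "real j * d m \<le> real (Suc m) * d m" using that d0(1) by (intro mult_right_mono) auto
        then have "real j * d m \<le> h" unfolding d0(2) .
        moreover have "0 \<le> real j * d m" using d0(1) by simp
        ultimately show ?thesis using s(2) by linarith
      qed
      have "AE \<omega> in M. \<forall>k\<in>{..<n}. \<forall>j\<in>{..Suc m}. N s (g k) (real j * d m) \<omega> = l (s + real j * d m) (g k) \<omega> - l s (g k) \<omega>"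
        using jd s g by (intro AE_finite_allI N_eq_increment) auto
      then show "AE \<omega> in M. cos (Tm c m s \<omega>) = F (\<lambda>i\<in>{..<Suc m}. \<lambda>k\<in>{..<n}.
        l (s + real (Suc i) * d m) (g k) \<omega> - l (s + real i * d m) (g k) \<omega>)"
      proof eventually_elim
        case (elim \<omega>)
        let ?D = "\<lambda>i\<in>{..<Suc m}. \<lambda>k\<in>{..<n}. l (s + real (Suc i) * d m) (g k) \<omega> - l (s + real i * d m) (g k) \<omega>"
        have tel: "(\<Sum>i<j. ?D i k) = N s (g k) (real j * d m) \<omega>" if "j \<le> Suc m" "k < n" for j k
        proof -
          have "(\<Sum>i<j. ?D i k) = (\<Sum>i<j. l (s + real (Suc i) * d m) (g k) \<omega> - l (s + real i * d m) (g k) \<omega>)"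
            using that by (intro sum.cong) auto
          also have "\<dots> = l (s + real j * d m) (g k) \<omega> - l (s + real 0 * d m) (g k) \<omega>" by (rule sum_lessThan_telescope)
          finally show ?thesis using elim that by simp
        qed
        have "(\<Sum>i<Suc m. ?D i k) = N s (g k) h \<omega>" if "k < n" for k
          using tel[of "Suc m" k] that unfolding d0(2) by simp
        moreover have "(\<Sum>j<Suc m. W m k j * clip c (\<Sum>i<j. ?D i k)) = R c m s k \<omega>" if "k < n" for k
          unfolding R_def by (intro sum.cong refl) (use tel that in auto)
        ultimately show ?case unfolding F_def Tm_def by (intro arg_cong[of _ _ cos] sum.cong) auto
      qed
      show "(\<lambda>\<omega>. F (\<lambda>i\<in>{..<Suc m}. \<lambda>k\<in>{..<n}. l (s + real (Suc i) * d m) (g k) \<omega> - l (s + real i * d m) (g k) \<omega>)) \<in> borel_measurable M"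
        by (rule measurable_compose[OF _ F])
          (use s d0 in \<open>auto intro!: measurable_restrict borel_measurable_diff l_measurable\<close>)
    qed measurable
    from this[OF s] this[of 0] s h levy_increments_law[OF levy[of n g] s(1) _ F, of "d m"] show ?thesis
      by (simp add: d_def del: of_nat_Suc)
  qed

  have lim_m: "(\<lambda>m. expectation (\<lambda>\<omega>. cos (Tm c m s \<omega>))) \<longlonglongrightarrow> expectation (\<lambda>\<omega>. cos (Tc c s \<omega>))"
    if c: "c \<ge> 0" and s: "0 \<le> s" "s + h \<le> T" for c s
  proof (rule expectation_cos_tendsto)
    have D_int: "integrable M (\<lambda>\<omega>. I c s k \<omega> - R c m s k \<omega>)" for k m
    proof -
      obtain K where K: "\<And>q. q \<in> {0..h} \<Longrightarrow> \<bar>\<psi> k q\<bar> \<le> K"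
        using compact_imp_bounded[OF compact_continuous_image[OF continuous_on_subset[OF \<psi>[of k]] compact_Icc[of 0 h]]]
        unfolding bounded_iff by (metis imageI real_norm_def subset_UNIV)
      have K0: "K \<ge> 0" using K[of 0] h by auto
      \<comment> \<open>The indicator provides a bound for all \<open>q\<close>; \<open>K\<close>
        controls \<open>\<psi> k\<close> on \<open>{0..h}\<close> only.\<close>
      have "integrable M (\<lambda>\<omega>. LINT q:{0..h}|lborel. indicator {0..h} q * (\<psi> k q * clip c (N s (g k) q \<omega>)))"
      proof (rule integrable_set_integral[where B = "K * c"])
        show "\<bar>indicator {0..h} q * (\<psi> k q * clip c (N s (g k) q \<omega>))\<bar> \<le> K * c" for q \<omega>
          using K[of q] K0 abs_clip_le[OF c] c by (auto simp: indicator_def abs_mult intro!: mult_mono)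
      qed (use h in auto)
      moreover have "(LINT q:{0..h}|lborel. indicator {0..h} q * (\<psi> k q * clip c (N s (g k) q \<omega>))) = I c s k \<omega>" for \<omega>
        unfolding I_def by (rule set_lebesgue_integral_cong) auto
      moreover have "integrable M (R c m s k)"
        unfolding R_def[abs_def]
        by (intro Bochner_Integration.integrable_sum integrable_mult_right integrable_const_bound[where B = c])
          (auto intro!: AE_I2 abs_clip_le c)
      ultimately show ?thesis by simp
    qed
    have "(\<lambda>m. \<Sum>k<n. expectation (\<lambda>\<omega>. \<bar>I c s k \<omega> - R c m s k \<omega>\<bar>)) \<longlonglongrightarrow> (\<Sum>k<n. 0)"
    proof (intro tendsto_sum)
      fix k
      have "(\<lambda>m. expectation (\<lambda>\<omega>. \<bar>(LINT q:{0..<h}|lborel. \<psi> k q * clip c (N s (g k) q \<omega>))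
         - (\<Sum>j<Suc m. (LINT q:cell h (Suc m) j|lborel. \<psi> k q) * clip c (N s (g k) (real j * (h / real (Suc m))) \<omega>))\<bar>)) \<longlonglongrightarrow> 0"
      proof (rule stochastic_Riemann_sums[OF h _ _ \<psi>])
        show "\<bar>clip c (N s (g k) q \<omega>)\<bar> \<le> c" for q \<omega> by (rule abs_clip_le[OF c])
        fix q u assume q: "q \<in> {0..h}" and u: "\<And>i. u i \<in> {0..h}" "u \<longlonglongrightarrow> q"
        have "(\<lambda>i. (2 * c + 1) * L0norm (\<lambda>\<omega>. N s (g k) (u i) \<omega> - N s (g k) q \<omega>)) \<longlonglongrightarrow> (2 * c + 1) * 0"
          by (intro tendsto_intros N_stochastically_continuous[OF g s q u])
        then have lim: "(\<lambda>i. (2 * c + 1) * L0norm (\<lambda>\<omega>. N s (g k) (u i) \<omega> - N s (g k) q \<omega>)) \<longlonglongrightarrow> 0" by simp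
        show "(\<lambda>i. expectation (\<lambda>\<omega>. \<bar>clip c (N s (g k) (u i) \<omega>) - clip c (N s (g k) q \<omega>)\<bar>)) \<longlonglongrightarrow> 0"
        proof (rule Lim_null_comparison[OF always_eventually[OF allI] lim])
          fix i
          have "expectation (\<lambda>\<omega>. \<bar>clip c (N s (g k) (u i) \<omega>) - clip c (N s (g k) q \<omega>)\<bar>)
            \<le> expectation (\<lambda>\<omega>. (2 * c + 1) * min 1 \<bar>N s (g k) (u i) \<omega> - N s (g k) q \<omega>\<bar>)"
            by (rule integral_mono') (use c in \<open>auto intro!: clip_diff_le integrable_mult_right integrable_min1\<close>)
          then show "norm (expectation (\<lambda>\<omega>. \<bar>clip c (N s (g k) (u i) \<omega>) - clip c (N s (g k) q \<omega>)\<bar>))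
            \<le> (2 * c + 1) * L0norm (\<lambda>\<omega>. N s (g k) (u i) \<omega> - N s (g k) q \<omega>)"
            by (simp add: L0norm_def integral_nonneg_AE)
        qed
      qed measurable
      moreover have "expectation (\<lambda>\<omega>. \<bar>(LINT q:{0..<h}|lborel. \<psi> k q * clip c (N s (g k) q \<omega>))
         - (\<Sum>j<Suc m. (LINT q:cell h (Suc m) j|lborel. \<psi> k q) * clip c (N s (g k) (real j * (h / real (Suc m))) \<omega>))\<bar>)
         = expectation (\<lambda>\<omega>. \<bar>I c s k \<omega> - R c m s k \<omega>\<bar>)" for m
      proof (rule Bochner_Integration.integral_cong[OF refl])
        fix \<omega> assume "\<omega> \<in> space M"
        note [measurable] = N_path_measurable[OF this]
        have "(LINT q:{0..<h}|lborel. \<psi> k q * clip c (N s (g k) q \<omega>)) = I c s k \<omega>"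
          unfolding I_def by (rule set_integral_lborel_Ico) measurable
        then show "\<bar>(LINT q:{0..<h}|lborel. \<psi> k q * clip c (N s (g k) q \<omega>))
         - (\<Sum>j<Suc m. (LINT q:cell h (Suc m) j|lborel. \<psi> k q) * clip c (N s (g k) (real j * (h / real (Suc m))) \<omega>))\<bar>
         = \<bar>I c s k \<omega> - R c m s k \<omega>\<bar>" unfolding R_def W_def d_def by simp
      qed
      ultimately show "(\<lambda>m. expectation (\<lambda>\<omega>. \<bar>I c s k \<omega> - R c m s k \<omega>\<bar>)) \<longlonglongrightarrow> 0" by simp
    qed
    then have lim: "(\<lambda>m. \<Sum>k<n. expectation (\<lambda>\<omega>. \<bar>I c s k \<omega> - R c m s k \<omega>\<bar>)) \<longlonglongrightarrow> 0" by simp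
    show "(\<lambda>m. L0norm (\<lambda>\<omega>. Tm c m s \<omega> - Tc c s \<omega>)) \<longlonglongrightarrow> 0"
    proof (rule Lim_null_comparison[OF always_eventually[OF allI] lim])
      fix m
      have eq: "Tm c m s \<omega> - Tc c s \<omega> = (\<Sum>k<n. I c s k \<omega> - R c m s k \<omega>)" for \<omega>
        unfolding Tm_def Tc_def sum_subtractf[symmetric] by (intro sum.cong) auto
      have "L0norm (\<lambda>\<omega>. Tm c m s \<omega> - Tc c s \<omega>) \<le> expectation (\<lambda>\<omega>. \<bar>\<Sum>k<n. I c s k \<omega> - R c m s k \<omega>\<bar>)"
        unfolding eq by (intro L0norm_le_expectation Bochner_Integration.integrable_sum D_int)
      also have "\<dots> \<le> expectation (\<lambda>\<omega>. \<Sum>k<n. \<bar>I c s k \<omega> - R c m s k \<omega>\<bar>)"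
        by (intro integral_mono integrable_abs Bochner_Integration.integrable_sum D_int sum_abs)
      also have "\<dots> = (\<Sum>k<n. expectation (\<lambda>\<omega>. \<bar>I c s k \<omega> - R c m s k \<omega>\<bar>))"
        by (intro Bochner_Integration.integral_sum integrable_abs D_int)
      finally show "norm (L0norm (\<lambda>\<omega>. Tm c m s \<omega> - Tc c s \<omega>)) \<le> (\<Sum>k<n. expectation (\<lambda>\<omega>. \<bar>I c s k \<omega> - R c m s k \<omega>\<bar>))"
        by (simp add: L0norm_nonneg)
    qed
  qed measurable

  have lim_c: "(\<lambda>i. expectation (\<lambda>\<omega>. cos (Tc (real i) s \<omega>))) \<longlonglongrightarrow> expectation (\<lambda>\<omega>. cos (Theta s h n b \<psi> g \<omega>))"
    if s: "0 \<le> s" "s + h \<le> T" for s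
  proof (rule expectation_cos_tendsto)
    show "(\<lambda>i. L0norm (\<lambda>\<omega>. Tc (real i) s \<omega> - Theta s h n b \<psi> g \<omega>)) \<longlonglongrightarrow> 0"
    proof (rule L0norm_tendsto_AE)
      have "AE \<omega> in M. \<forall>k\<in>{..<n}. set_integrable lborel {0..h} (\<lambda>q. \<psi> k q * N s (g k) q \<omega>)"
        using h s g \<psi> by (intro AE_finite_allI N_path_integrable) auto
      then show "AE \<omega> in M. (\<lambda>i. Tc (real i) s \<omega> - Theta s h n b \<psi> g \<omega>) \<longlonglongrightarrow> 0" using AE_space
      proof eventually_elim
        case (elim \<omega>)
        note [measurable] = N_path_measurable[OF elim(2)]
        have "(\<lambda>i. I (real i) s k \<omega>) \<longlonglongrightarrow> (LINT q:{0..h}|lborel. \<psi> k q * N s (g k) q \<omega>)" if "k < n" for k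
          unfolding I_def set_lebesgue_integral_def
        proof (rule integral_dominated_convergence[where w = "\<lambda>q. \<bar>indicator {0..h} q *\<^sub>R (\<psi> k q * N s (g k) q \<omega>)\<bar>"])
          show "integrable lborel (\<lambda>q. \<bar>indicator {0..h} q *\<^sub>R (\<psi> k q * N s (g k) q \<omega>)\<bar>)"
            using elim(1) that by (auto simp: set_integrable_def intro!: integrable_abs)
          show "AE q in lborel. (\<lambda>i. indicator {0..h} q *\<^sub>R (\<psi> k q * clip (real i) (N s (g k) q \<omega>)))
              \<longlonglongrightarrow> indicator {0..h} q *\<^sub>R (\<psi> k q * N s (g k) q \<omega>)"
            by (intro AE_I2 tendsto_intros clip_tendsto)
          show "AE q in lborel. norm (indicator {0..h} q *\<^sub>R (\<psi> k q * clip (real i) (N s (g k) q \<omega>)))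
              \<le> \<bar>indicator {0..h} q *\<^sub>R (\<psi> k q * N s (g k) q \<omega>)\<bar>" for i
            by (auto simp: abs_mult intro!: AE_I2 mult_left_mono abs_clip_le_abs)
        qed measurable
        then have "(\<lambda>i. Tc (real i) s \<omega>) \<longlonglongrightarrow> Theta s h n b \<psi> g \<omega>"
          unfolding Tc_def Theta_def by (intro tendsto_sum tendsto_diff tendsto_const) auto
        then show ?case by (rule LIM_zero)
      qed
    qed measurable
  qed measurable

  have "expectation (\<lambda>\<omega>. cos (Tc (real i) s \<omega>)) = expectation (\<lambda>\<omega>. cos (Tc (real i) 0 \<omega>))" for i
    using lim_m[of "real i" s] lim_m[of "real i" 0] s h unfolding law by (auto intro: LIMSEQ_unique)
  then show ?thesis using lim_c[of s] lim_c[of 0] s h by (auto intro: LIMSEQ_unique)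
qed

end

section \<open>Regularity on subintervals and the law of the remainder\<close>

context weak_cauchy
begin

lemma bochner_integral_measurable:
  assumes G: "continuous_on {0..h} G"
  shows "(\<lambda>\<omega>. LINT q:{0..h}|lborel. Y (s + q) \<omega> \<bullet> G q) \<in> borel_measurable M"
proof -
  have m [measurable]: "(\<lambda>q. indicator {0..h} q *\<^sub>R G q) \<in> borel_measurable borel"
    by (rule borel_measurable_continuous_on_indicator) (use G in auto)
  have "(\<lambda>\<omega>. LINT q:{0..h}|lborel. Y (s + q) \<omega> \<bullet> (indicator {0..h} q *\<^sub>R G q)) \<in> borel_measurable M"
    by (rule set_integral_lborel_measurable) measurable
  also have "(\<lambda>\<omega>. LINT q:{0..h}|lborel. Y (s + q) \<omega> \<bullet> (indicator {0..h} q *\<^sub>R G q))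
      = (\<lambda>\<omega>. LINT q:{0..h}|lborel. Y (s + q) \<omega> \<bullet> G q)"
    by (intro ext set_lebesgue_integral_cong) auto
  finally show ?thesis .
qed

text \<open>Weak Bochner regularity concerns continuous functions on the whole of \<open>{0..T}\<close>; on a
  subinterval it is applied to a continuous extension multiplied by a steep cutoff.\<close>

lemma bochner_shift_tendsto:
  assumes s: "0 \<le> s" "s + h \<le> T" and h: "h > 0" and G: "\<And>i. continuous_on {0..h} (G i)"
    and \<delta>: "\<And>i q. q \<in> {0..h} \<Longrightarrow> norm (G i q) \<le> \<delta> i" "\<delta> \<longlonglongrightarrow> 0"
  shows "(\<lambda>i::nat. L0norm (\<lambda>\<omega>. LINT q:{0..h}|lborel. Y (s + q) \<omega> \<bullet> G i q)) \<longlonglongrightarrow> 0"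
proof -
  define E where "E i r = G i (max 0 (min h (r - s)))" for i r
  define \<rho> where "\<rho> m r = max 0 (1 - real m * (max 0 (s - r) + max 0 (r - s - h)))" for m r
  have \<rho>01: "0 \<le> \<rho> m r" "\<rho> m r \<le> 1" for m r by (auto simp: \<rho>_def)
  have \<rho>_lim: "(\<lambda>m. \<rho> m r) \<longlonglongrightarrow> indicator {s..s + h} r" for r
  proof (cases "r \<in> {s..s + h}")
    case True
    then have "max 0 (s - r) = 0" "max 0 (r - s - h) = 0" by auto
    then show ?thesis using True by (simp add: \<rho>_def)
  next
    case False
    define c where "c = max 0 (s - r) + max 0 (r - s - h)"
    have c: "c > 0" using False by (auto simp: c_def)
    obtain n :: nat where n: "1 / c < n" using reals_Archimedean2 by blast
    have "\<rho> m r = 0" if "m \<ge> n" for m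
    proof -
      have "1 / c \<le> m" using n that by simp
      then have "1 \<le> real m * c" using c by (simp add: field_simps)
      then show ?thesis unfolding \<rho>_def c_def[symmetric] by simp
    qed
    then have "\<forall>\<^sub>F m in sequentially. \<rho> m r = indicator {s..s + h} r"
      using False unfolding eventually_sequentially by auto
    then show ?thesis by (rule tendsto_eventually)
  qed
  have \<rho>c: "continuous_on A (\<rho> m)" for A m unfolding \<rho>_def by (intro continuous_intros)
  have Ec: "continuous_on {0..T} (E i)" for i unfolding E_def
    by (rule continuous_on_compose2[OF G]) (use h in \<open>auto intro!: continuous_intros\<close>)
  have Eb: "norm (E i r) \<le> \<delta> i" for i r unfolding E_def by (rule \<delta>) (use h in auto)
  have \<delta>0: "\<delta> i \<ge> 0" for i using order_trans[OF norm_ge_zero Eb[of i 0]] .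
  define Z where "Z i m \<omega> = (LINT r:{0..T}|lborel. Y (0 + r) \<omega> \<bullet> (\<rho> m r *\<^sub>R E i r))" for i m \<omega>
  define Z' where "Z' i \<omega> = (LINT q:{0..h}|lborel. Y (s + q) \<omega> \<bullet> G i q)" for i \<omega>
  have [measurable]: "Z i m \<in> borel_measurable M" for i m
    unfolding Z_def[abs_def] by (intro bochner_integral_measurable continuous_intros \<rho>c Ec)
  have [measurable]: "Z' i \<in> borel_measurable M" for i
    unfolding Z'_def[abs_def] by (intro bochner_integral_measurable G)
  have lim_m: "(\<lambda>m. L0norm (\<lambda>\<omega>. Z' i \<omega> - Z i m \<omega>)) \<longlonglongrightarrow> 0" for i
  proof (rule L0norm_tendsto_AE)
    have "AE \<omega> in M. set_integrable lborel {0..T} (\<lambda>r. Y (0 + r) \<omega> \<bullet> E i r)"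
      using T by (intro bochner_integrable Ec) auto
    then show "AE \<omega> in M. (\<lambda>m. Z' i \<omega> - Z i m \<omega>) \<longlonglongrightarrow> 0"
    proof eventually_elim
      case (elim \<omega>)
      then have int: "integrable lborel (\<lambda>r. indicator {0..T} r *\<^sub>R (Y r \<omega> \<bullet> E i r))" by (simp add: set_integrable_def)
      define w where "w r = indicator {0..T} r *\<^sub>R (Y r \<omega> \<bullet> E i r)" for r
      have int: "integrable lborel w" using int unfolding w_def .
      have [measurable]: "w \<in> borel_measurable borel" using borel_measurable_integrable[OF int] by simp
      have \<rho>m [measurable]: "\<rho> m \<in> borel_measurable borel" for m by (intro borel_measurable_continuous_onI \<rho>c)
      have "Z' i \<omega> = (LINT q:{0..h}|lborel. Y (s + q) \<omega> \<bullet> E i (s + q))"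
        unfolding Z'_def E_def by (rule set_lebesgue_integral_cong) auto
      also have "\<dots> = (LINT r:{s..s + h}|lborel. Y r \<omega> \<bullet> E i r)"
        using set_integral_lborel_shift[of 0 h "\<lambda>r. Y r \<omega> \<bullet> E i r" s] by simp
      also have "\<dots> = (\<integral>r. indicator {s..s + h} r * w r \<partial>lborel)"
        unfolding set_lebesgue_integral_def
        by (rule Bochner_Integration.integral_cong) (use s in \<open>auto simp: indicator_def w_def\<close>)
      finally have Z': "Z' i \<omega> = (\<integral>r. indicator {s..s + h} r * w r \<partial>lborel)" .
      have Z: "Z i m \<omega> = (\<integral>r. \<rho> m r * w r \<partial>lborel)" for m
        unfolding Z_def set_lebesgue_integral_def
        by (rule Bochner_Integration.integral_cong) (auto simp: indicator_def w_def)
      have "(\<lambda>m. Z i m \<omega>) \<longlonglongrightarrow> Z' i \<omega>" unfolding Z Z'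
      proof (rule integral_dominated_convergence[OF _ _ integrable_abs[OF int]])
        show "AE r in lborel. (\<lambda>m. \<rho> m r * w r)
            \<longlonglongrightarrow> indicator {s..s + h} r * w r"
          by (intro AE_I2 tendsto_intros \<rho>_lim)
        show "AE r in lborel. norm (\<rho> m r * w r) \<le> \<bar>w r\<bar>" for m
          using \<rho>01 by (auto intro!: AE_I2 simp: abs_mult mult_left_le_one_le)
      qed measurable
      from tendsto_diff[OF tendsto_const[of "Z' i \<omega>"] this] show ?case by simp
    qed
  qed measurable
  \<comment> \<open>For each \<open>i\<close> a cutoff is selected that is steep enough for an error
    below \<open>1 / real (Suc i)\<close>. It does not enlarge the norm bound
    \<open>\<delta> i\<close>, so regularity applies along this diagonal sequence.\<close>
  have "\<exists>m. L0norm (\<lambda>\<omega>. Z' i \<omega> - Z i m \<omega>) < 1 / real (Suc i)" for i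
    using order_tendstoD(2)[OF lim_m[of i], of "1 / real (Suc i)"] by (auto simp: eventually_sequentially)
  then obtain m where m: "\<And>i. L0norm (\<lambda>\<omega>. Z' i \<omega> - Z i (m i) \<omega>) < 1 / real (Suc i)" by metis
  have "conv_in_prob M (\<lambda>i \<omega>. LINT r:{0..T}|lborel. Y r \<omega> \<bullet> (\<rho> (m i) r *\<^sub>R E i r)) (\<lambda>_. 0) sequentially"
  proof -
    have gs: "continuous_on {0..T} (\<lambda>r. \<rho> (m i) r *\<^sub>R E i r)" for i by (intro continuous_intros \<rho>c Ec)
    have b: "norm (\<rho> (m i) r *\<^sub>R E i r) \<le> \<delta> i" for i r
      using mult_mono[OF \<rho>01(2)[of "m i" r] Eb[of i r]] \<rho>01[of "m i" r] by simp
    have "(\<lambda>i. Sup ((\<lambda>r. norm (\<rho> (m i) r *\<^sub>R E i r)) ` {0..T})) \<longlonglongrightarrow> 0"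
    proof (rule Lim_null_comparison[OF always_eventually[OF allI] \<delta>(2)])
      fix i
      have "Sup ((\<lambda>r. norm (\<rho> (m i) r *\<^sub>R E i r)) ` {0..T}) \<le> \<delta> i" using T b by (intro cSUP_least) auto
      moreover have "0 \<le> Sup ((\<lambda>r. norm (\<rho> (m i) r *\<^sub>R E i r)) ` {0..T})"
        by (rule cSUP_upper2[of _ _ 0]) (use T b in \<open>auto intro!: bdd_aboveI[of _ "\<delta> i"]\<close>)
      ultimately show "norm (Sup ((\<lambda>r. norm (\<rho> (m i) r *\<^sub>R E i r)) ` {0..T})) \<le> \<delta> i" by simp
    qed
    with gs show ?thesis
      using bochner[unfolded weakly_bochner_regular_def, THEN conjunct2, rule_format, of "\<lambda>i r. \<rho> (m i) r *\<^sub>R E i r"] by blast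
  qed
  then have "(\<lambda>i. L0norm (Z i (m i))) \<longlonglongrightarrow> 0"
    by (intro L0norm_tendsto_prob) (simp_all add: conv_in_prob_def Z_def)
  then have "(\<lambda>i. 1 / real (Suc i) + L0norm (Z i (m i))) \<longlonglongrightarrow> 0 + 0"
    by (intro tendsto_add LIMSEQ_Suc[OF lim_1_over_n])
  then have lim: "(\<lambda>i. 1 / real (Suc i) + L0norm (Z i (m i))) \<longlonglongrightarrow> 0" by simp
  have "(\<lambda>i. L0norm (Z' i)) \<longlonglongrightarrow> 0"
  proof (rule Lim_null_comparison[OF always_eventually[OF allI] lim])
    fix i
    have "L0norm (Z' i) \<le> L0norm (\<lambda>\<omega>. Z' i \<omega> - Z i (m i) \<omega>) + L0norm (Z i (m i))"
      using L0norm_triangle[of "\<lambda>\<omega>. Z' i \<omega> - Z i (m i) \<omega>" "Z i (m i)"] by simp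
    then show "norm (L0norm (Z' i)) \<le> 1 / real (Suc i) + L0norm (Z i (m i))"
      using m[of i] by (simp add: L0norm_nonneg)
  qed
  then show ?thesis by (simp add: Z'_def[abs_def])
qed

text \<open>Regularity is a statement about sequences. A counterexample bounded by
  \<open>1 / real (Suc i)\<close> for each \<open>i\<close> would contradict it; this yields a
  tolerance \<open>\<delta>\<close> that is fixed before the function \<open>G\<close>.\<close>

lemma bochner_shift_small:
  assumes s: "0 \<le> s" "s + h \<le> T" and h: "h > 0" and \<epsilon>: "\<epsilon> > 0"
  shows "\<exists>\<delta>>0. \<forall>G. continuous_on {0..h} G \<and> (\<forall>q\<in>{0..h}. norm (G q) \<le> \<delta>) \<longrightarrow>
    L0norm (\<lambda>\<omega>. LINT q:{0..h}|lborel. Y (s + q) \<omega> \<bullet> G q) < \<epsilon>"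
proof (rule ccontr)
  assume neg: "\<not> ?thesis"
  have "\<forall>i. \<exists>G. continuous_on {0..h} G \<and> (\<forall>q\<in>{0..h}. norm (G q) \<le> 1 / real (Suc i)) \<and>
      L0norm (\<lambda>\<omega>. LINT q:{0..h}|lborel. Y (s + q) \<omega> \<bullet> G q) \<ge> \<epsilon>"
  proof
    fix i
    have "1 / real (Suc i) > 0" by simp
    with neg show "\<exists>G. continuous_on {0..h} G \<and> (\<forall>q\<in>{0..h}. norm (G q) \<le> 1 / real (Suc i)) \<and>
      L0norm (\<lambda>\<omega>. LINT q:{0..h}|lborel. Y (s + q) \<omega> \<bullet> G q) \<ge> \<epsilon>" by (meson not_less)
  qed
  from choice[OF this] obtain G where "\<forall>i. continuous_on {0..h} (G i) \<and> (\<forall>q\<in>{0..h}. norm (G i q) \<le> 1 / real (Suc i)) \<and>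
      L0norm (\<lambda>\<omega>. LINT q:{0..h}|lborel. Y (s + q) \<omega> \<bullet> G i q) \<ge> \<epsilon>" ..
  then have G: "\<And>i. continuous_on {0..h} (G i)" "\<And>i q. q \<in> {0..h} \<Longrightarrow> norm (G i q) \<le> 1 / real (Suc i)"
    "\<And>i. L0norm (\<lambda>\<omega>. LINT q:{0..h}|lborel. Y (s + q) \<omega> \<bullet> G i q) \<ge> \<epsilon>" by blast+
  have "(\<lambda>i. L0norm (\<lambda>\<omega>. LINT q:{0..h}|lborel. Y (s + q) \<omega> \<bullet> G i q)) \<longlonglongrightarrow> 0"
    by (rule bochner_shift_tendsto[OF s h G(1,2) LIMSEQ_Suc[OF lim_1_over_n]])
  then have "\<epsilon> \<le> 0" using G(3) by (intro LIMSEQ_le_const) auto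
  then show False using \<epsilon> by simp
qed

text \<open>Formally the convolution of \<open>S\<close> with the noise over
  \<open>{s..s + h}\<close>; expressed through \<open>Y\<close> it is a genuine random
  vector.\<close>

definition R :: "real \<Rightarrow> real \<Rightarrow> 'w \<Rightarrow> 'v" where
  "R s h \<omega> = Y (s + h) \<omega> - S h (Y s \<omega>)"

lemma R_measurable [measurable]: "R s h \<in> borel_measurable M"
proof -
  have [measurable]: "(\<lambda>x. S h x) \<in> borel_measurable borel"
    by (intro borel_measurable_continuous_onI continuous_intros)
  show ?thesis unfolding R_def[abs_def] by measurable
qed

lemma blinfun_inner_measurable [measurable]:
  "(\<lambda>x. blinfun_apply C x \<bullet> v) \<in> borel_measurable borel" for C :: "'v \<Rightarrow>\<^sub>L 'v"
  by (intro borel_measurable_continuous_onI continuous_intros)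

lemma P0_commute_S: "e > 0 \<Longrightarrow> h \<ge> 0 \<Longrightarrow> P e 0 (S h x) = S h (P e 0 x)"
  by (simp add: P_def J_commute_S)

text \<open>The conclusions of \<open>test_functions\<close> as a predicate, so that
  \<open>\<delta>\<close> can be quantified before the family and one family can serve two starting
  times.\<close>

definition test_family :: "real \<Rightarrow> real \<Rightarrow> 'v \<Rightarrow> real \<Rightarrow> nat \<Rightarrow> (nat \<Rightarrow> 'v) \<Rightarrow> (nat \<Rightarrow> real \<Rightarrow> real) \<Rightarrow>
    (nat \<Rightarrow> real \<Rightarrow> real) \<Rightarrow> bool" where
  "test_family e h v \<delta> n g \<phi> \<psi> \<longleftrightarrow> (\<forall>k. g k \<in> adj_dom DA A) \<and> (\<forall>k. continuous_on UNIV (\<psi> k)) \<and>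
    (\<forall>k. \<forall>q\<in>{0..h}. (\<phi> k has_real_derivative \<psi> k q) (at q within {0..h})) \<and>
    (\<forall>x. x \<bullet> (\<Sum>k<n. \<phi> k h *\<^sub>R g k) = P e 0 x \<bullet> v) \<and>
    (\<forall>x. \<bar>x \<bullet> (\<Sum>k<n. \<phi> k 0 *\<^sub>R g k) - S h (P e 0 x) \<bullet> v\<bar> \<le> \<delta> * norm x) \<and>
    (\<forall>q\<in>{0..h}. norm (\<Sum>k<n. \<psi> k q *\<^sub>R g k + \<phi> k q *\<^sub>R adj_op DA A (g k)) \<le> \<delta>)"

lemma test_family_mono:
  assumes "test_family e h v \<delta> n g \<phi> \<psi>" "\<delta> \<le> \<delta>'"
  shows "test_family e h v \<delta>' n g \<phi> \<psi>"
proof -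
  have "\<delta> * norm x \<le> \<delta>' * norm x" for x :: 'v using assms(2) by (rule mult_right_mono) simp
  then have "a \<le> \<delta>' * norm x" if "a \<le> \<delta> * norm x" for a and x :: 'v using that order_trans by blast
  moreover have "a \<le> \<delta>'" if "a \<le> \<delta>" for a using that assms(2) by simp
  ultimately show ?thesis using assms(1) unfolding test_family_def by simp
qed

text \<open>Integration by parts leaves two errors between the smoothed remainder and
  \<open>Theta\<close>: \<open>D\<close>, from the initial time, where the test function is not
  exact, and \<open>IG\<close>, the drift defect integrated against \<open>Y\<close>. The first is
  at most \<open>\<delta> * norm (Y s \<omega>)\<close>, the second is small by weak Bochner
  regularity.\<close>

lemma Theta_approx:
  assumes e: "e > 0" and h: "h > 0" and s: "0 \<le> s" "s + h \<le> T" and \<epsilon>: "\<epsilon> > 0"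
  shows "\<exists>\<delta>>0. \<forall>n g \<phi> \<psi>. test_family e h v \<delta> n g \<phi> \<psi> \<longrightarrow>
    \<bar>expectation (\<lambda>\<omega>. cos (P e 0 (R s h \<omega>) \<bullet> v)) - expectation (\<lambda>\<omega>. cos (Theta s h n (\<lambda>k. \<phi> k h) \<psi> g \<omega>))\<bar> < \<epsilon>"
proof -
  \<comment> \<open>A quarter of \<open>\<epsilon>\<close> for each of \<open>D\<close> and
    \<open>IG\<close>, since \<open>expectation_cos_diff_le\<close> doubles their sum.\<close>
  obtain \<delta>1 where \<delta>1: "\<delta>1 > 0" "\<And>G. continuous_on {0..h} G \<Longrightarrow> (\<And>q. q \<in> {0..h} \<Longrightarrow> norm (G q) \<le> \<delta>1) \<Longrightarrow>
      L0norm (\<lambda>\<omega>. LINT q:{0..h}|lborel. Y (s + q) \<omega> \<bullet> G q) < \<epsilon> / 4"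
    using bochner_shift_small[OF s h, of "\<epsilon> / 4"] \<epsilon> by auto
  have "(\<lambda>i. L0norm (\<lambda>\<omega>. 1 / real (Suc i) * norm (Y s \<omega>))) \<longlonglongrightarrow> 0"
  proof (rule L0norm_tendsto_AE)
    have "(\<lambda>i. 1 / real (Suc i) * norm (Y s \<omega>)) \<longlonglongrightarrow> 0 * norm (Y s \<omega>)" for \<omega>
      by (intro tendsto_mult_right LIMSEQ_Suc[OF lim_1_over_n])
    then show "AE \<omega> in M. (\<lambda>i. 1 / real (Suc i) * norm (Y s \<omega>)) \<longlonglongrightarrow> 0" by simp
  qed measurable
  then obtain i where i: "L0norm (\<lambda>\<omega>. 1 / real (Suc i) * norm (Y s \<omega>)) < \<epsilon> / 4"
    using order_tendstoD(2)[of _ 0 sequentially "\<epsilon> / 4"] \<epsilon> by (force simp: eventually_sequentially)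
  define \<delta> where "\<delta> = min \<delta>1 (1 / real (Suc i))"
  have \<delta>: "\<delta> > 0" "\<delta> \<le> \<delta>1" "\<delta> \<le> 1 / real (Suc i)" using \<delta>1 by (auto simp: \<delta>_def)
  show ?thesis
  proof (intro exI[of _ \<delta>] conjI allI impI \<delta>(1))
    fix n g \<phi> \<psi> assume "test_family e h v \<delta> n g \<phi> \<psi>"
    then have g: "\<forall>k. g k \<in> adj_dom DA A" and \<psi>: "\<forall>k. continuous_on UNIV (\<psi> k)"
      and \<phi>: "\<forall>k. \<forall>q\<in>{0..h}. (\<phi> k has_real_derivative \<psi> k q) (at q within {0..h})"
      and a1: "\<forall>x. x \<bullet> (\<Sum>k<n. \<phi> k h *\<^sub>R g k) = P e 0 x \<bullet> v"
      and a2: "\<forall>x. \<bar>x \<bullet> (\<Sum>k<n. \<phi> k 0 *\<^sub>R g k) - S h (P e 0 x) \<bullet> v\<bar> \<le> \<delta> * norm x"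
      and a3: "\<forall>q\<in>{0..h}. norm (\<Sum>k<n. \<psi> k q *\<^sub>R g k + \<phi> k q *\<^sub>R adj_op DA A (g k)) \<le> \<delta>"
      unfolding test_family_def by - (elim conjE, assumption)+
    define G where "G q = (\<Sum>k<n. \<psi> k q *\<^sub>R g k + \<phi> k q *\<^sub>R adj_op DA A (g k))" for q
    have \<phi>c: "continuous_on {0..h} (\<phi> k)" for k using \<phi> by (intro DERIV_continuous_on[where D = "\<psi> k"]) auto
    have \<psi>c: "continuous_on {0..h} (\<psi> k)" for k using \<psi> by (auto intro: continuous_on_subset)
    have Gc: "continuous_on {0..h} G" unfolding G_def by (intro continuous_intros \<phi>c \<psi>c)
    define \<Theta> where "\<Theta> = Theta s h n (\<lambda>k. \<phi> k h) \<psi> g"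
    have [measurable]: "\<Theta> \<in> borel_measurable M" unfolding \<Theta>_def using \<psi> by (intro Theta_measurable) auto
    define IG where "IG \<omega> = (LINT q:{0..h}|lborel. Y (s + q) \<omega> \<bullet> G q)" for \<omega>
    have [measurable]: "IG \<in> borel_measurable M" unfolding IG_def[abs_def] by (rule bochner_integral_measurable[OF Gc])
    define D where "D \<omega> = Y s \<omega> \<bullet> (\<Sum>k<n. \<phi> k 0 *\<^sub>R g k) - S h (P e 0 (Y s \<omega>)) \<bullet> v" for \<omega>
    have [measurable]: "D \<in> borel_measurable M"
    proof -
      have "(\<lambda>x. x \<bullet> (\<Sum>k<n. \<phi> k 0 *\<^sub>R g k) - S h (P e 0 x) \<bullet> v) \<in> borel_measurable borel"
        by (intro borel_measurable_continuous_onI continuous_intros)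
      from measurable_compose[OF Y_measurable_fixed this] show ?thesis unfolding D_def[abs_def] by simp
    qed
    have [measurable]: "(\<lambda>\<omega>. P e 0 (R s h \<omega>) \<bullet> v) \<in> borel_measurable M" by measurable
    have "AE \<omega> in M. \<forall>k\<in>{..<n}. set_integrable lborel {0..h} (\<lambda>q. Y (s + q) \<omega> \<bullet> g k) \<and>
        set_integrable lborel {0..h} (\<lambda>q. Y (s + q) \<omega> \<bullet> adj_op DA A (g k))"
      using s h by (intro AE_finite_allI AE_conjI bochner_integrable) auto
    then have eq: "AE \<omega> in M. P e 0 (R s h \<omega>) \<bullet> v - \<Theta> \<omega> = D \<omega> + IG \<omega>"
    proof eventually_elim
      case (elim \<omega>)
      have int: "set_integrable lborel {0..h} (\<lambda>q. \<psi> k q * (Y (s + q) \<omega> \<bullet> g k) + \<phi> k q * (Y (s + q) \<omega> \<bullet> adj_op DA A (g k)))"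
        if "k < n" for k
        using elim that by (intro set_integral_add set_integrable_mult_continuous \<phi>c \<psi>c) auto
      have parts: "\<phi> k h * N s (g k) h \<omega> - (LINT q:{0..h}|lborel. \<psi> k q * N s (g k) q \<omega>)
          = \<phi> k h * (Y (s + h) \<omega> \<bullet> g k) - \<phi> k 0 * (Y s \<omega> \<bullet> g k)
          - (LINT q:{0..h}|lborel. \<psi> k q * (Y (s + q) \<omega> \<bullet> g k) + \<phi> k q * (Y (s + q) \<omega> \<bullet> adj_op DA A (g k)))" if "k < n" for k
        using path_by_parts(1)[of h "\<lambda>q. Y (s + q) \<omega> \<bullet> g k" "\<lambda>q. Y (s + q) \<omega> \<bullet> adj_op DA A (g k)" "\<psi> k" "\<phi> k" "\<lambda>q. N s (g k) q \<omega>"]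
          elim that h \<phi> \<psi> by (simp add: N_def)
      have IG: "IG \<omega> = (\<Sum>k<n. LINT q:{0..h}|lborel. \<psi> k q * (Y (s + q) \<omega> \<bullet> g k) + \<phi> k q * (Y (s + q) \<omega> \<bullet> adj_op DA A (g k)))"
      proof -
        have "IG \<omega> = (\<integral>q. (\<Sum>k<n. indicator {0..h} q *\<^sub>R (\<psi> k q * (Y (s + q) \<omega> \<bullet> g k) + \<phi> k q * (Y (s + q) \<omega> \<bullet> adj_op DA A (g k)))) \<partial>lborel)"
          unfolding IG_def G_def set_lebesgue_integral_def
          by (rule Bochner_Integration.integral_cong) (simp_all add: inner_sum_right inner_add_right sum_distrib_left)
        also have "\<dots> = (\<Sum>k<n. \<integral>q. indicator {0..h} q *\<^sub>R (\<psi> k q * (Y (s + q) \<omega> \<bullet> g k) + \<phi> k q * (Y (s + q) \<omega> \<bullet> adj_op DA A (g k))) \<partial>lborel)"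
          using int by (intro Bochner_Integration.integral_sum) (auto simp: set_integrable_def)
        finally show ?thesis by (simp add: set_lebesgue_integral_def)
      qed
      have "\<Theta> \<omega> = (\<Sum>k<n. \<phi> k h * (Y (s + h) \<omega> \<bullet> g k)) - (\<Sum>k<n. \<phi> k 0 * (Y s \<omega> \<bullet> g k)) - IG \<omega>"
        unfolding \<Theta>_def Theta_def IG sum_subtractf[symmetric] by (intro sum.cong) (auto simp: parts)
      moreover have "(\<Sum>k<n. \<phi> k h * (Y (s + h) \<omega> \<bullet> g k)) = P e 0 (Y (s + h) \<omega>) \<bullet> v"
        using a1[rule_format, of "Y (s + h) \<omega>"] by (simp add: inner_sum_right)
      moreover have "(\<Sum>k<n. \<phi> k 0 * (Y s \<omega> \<bullet> g k)) = D \<omega> + S h (P e 0 (Y s \<omega>)) \<bullet> v"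
        by (simp add: D_def inner_sum_right)
      ultimately show ?case
        using h e by (simp add: R_def blinfun.diff_right inner_diff_left P0_commute_S)
    qed
    have "L0norm (\<lambda>\<omega>. P e 0 (R s h \<omega>) \<bullet> v - \<Theta> \<omega>) = L0norm (\<lambda>\<omega>. D \<omega> + IG \<omega>)"
      using eq by (intro L0norm_cong_AE) measurable
    also have "\<dots> \<le> L0norm D + L0norm IG" by (rule L0norm_triangle) measurable
    also have "L0norm D \<le> L0norm (\<lambda>\<omega>. 1 / real (Suc i) * norm (Y s \<omega>))"
      unfolding L0norm_def
    proof (rule integral_mono)
      fix \<omega>
      have "\<bar>D \<omega>\<bar> \<le> \<delta> * norm (Y s \<omega>)" unfolding D_def using a2 by blast
      also have "\<dots> \<le> 1 / real (Suc i) * norm (Y s \<omega>)" using \<delta>(3) by (intro mult_right_mono) auto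
      finally show "min 1 \<bar>D \<omega>\<bar> \<le> min 1 \<bar>1 / real (Suc i) * norm (Y s \<omega>)\<bar>"
        by (intro min.mono order_refl order_trans[OF _ abs_ge_self])
    qed (rule integrable_min1, measurable)+
    also have "\<dots> < \<epsilon> / 4" by (rule i)
    also have "L0norm IG < \<epsilon> / 4"
      unfolding IG_def[abs_def] using a3 \<delta>(2) by (intro \<delta>1(2)[OF Gc]) (auto simp: G_def intro: order_trans)
    finally have "L0norm (\<lambda>\<omega>. P e 0 (R s h \<omega>) \<bullet> v - \<Theta> \<omega>) < \<epsilon> / 2" by simp
    moreover have "\<bar>expectation (\<lambda>\<omega>. cos (P e 0 (R s h \<omega>) \<bullet> v)) - expectation (\<lambda>\<omega>. cos (\<Theta> \<omega>))\<bar>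
        \<le> 2 * L0norm (\<lambda>\<omega>. P e 0 (R s h \<omega>) \<bullet> v - \<Theta> \<omega>)" by (rule expectation_cos_diff_le) measurable
    ultimately show "\<bar>expectation (\<lambda>\<omega>. cos (P e 0 (R s h \<omega>) \<bullet> v)) - expectation (\<lambda>\<omega>. cos (Theta s h n (\<lambda>k. \<phi> k h) \<psi> g \<omega>))\<bar> < \<epsilon>"
      unfolding \<Theta>_def by simp
  qed
qed

text \<open>The tolerance given by \<open>Theta_approx\<close> depends on the starting time. With
  the smaller of the two, one test family approximates both remainders, and \<open>Theta_law\<close>
  identifies the approximations.\<close>

lemma cos_P_R:
  assumes e: "e > 0" and h: "h > 0" and s: "0 \<le> s" "s + h \<le> T"
  shows "expectation (\<lambda>\<omega>. cos (P e 0 (R s h \<omega>) \<bullet> v)) = expectation (\<lambda>\<omega>. cos (P e 0 (R 0 h \<omega>) \<bullet> v))"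
proof -
  have "\<bar>expectation (\<lambda>\<omega>. cos (P e 0 (R s h \<omega>) \<bullet> v)) - expectation (\<lambda>\<omega>. cos (P e 0 (R 0 h \<omega>) \<bullet> v))\<bar> \<le> \<epsilon>"
    if \<epsilon>: "\<epsilon> > 0" for \<epsilon>
  proof -
    have \<epsilon>2: "\<epsilon> / 2 > 0" and s0: "0 \<le> (0::real)" "0 + h \<le> T" using \<epsilon> s by auto
    obtain \<delta>1 where \<delta>1: "\<delta>1 > 0" and A1: "\<And>n g \<phi> \<psi>. test_family e h v \<delta>1 n g \<phi> \<psi> \<Longrightarrow>
      \<bar>expectation (\<lambda>\<omega>. cos (P e 0 (R s h \<omega>) \<bullet> v)) - expectation (\<lambda>\<omega>. cos (Theta s h n (\<lambda>k. \<phi> k h) \<psi> g \<omega>))\<bar> < \<epsilon> / 2"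
      using Theta_approx[OF e h s \<epsilon>2, of v] by blast
    obtain \<delta>2 where \<delta>2: "\<delta>2 > 0" and A2: "\<And>n g \<phi> \<psi>. test_family e h v \<delta>2 n g \<phi> \<psi> \<Longrightarrow>
      \<bar>expectation (\<lambda>\<omega>. cos (P e 0 (R 0 h \<omega>) \<bullet> v)) - expectation (\<lambda>\<omega>. cos (Theta 0 h n (\<lambda>k. \<phi> k h) \<psi> g \<omega>))\<bar> < \<epsilon> / 2"
      using Theta_approx[OF e h s0 \<epsilon>2, of v] by blast
    have \<delta>: "min \<delta>1 \<delta>2 > 0" using \<delta>1 \<delta>2 by simp
    obtain g :: "nat \<Rightarrow> 'v" and \<psi> \<phi> :: "nat \<Rightarrow> real \<Rightarrow> real" and n :: nat where fam: "\<And>k. g k \<in> adj_dom DA A" "\<And>k. continuous_on UNIV (\<psi> k)"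
      "\<And>k q. q \<in> {0..h} \<Longrightarrow> (\<phi> k has_real_derivative \<psi> k q) (at q within {0..h})"
      "\<And>x. x \<bullet> (\<Sum>k<n. \<phi> k h *\<^sub>R g k) = P e 0 x \<bullet> v"
      "\<And>x. \<bar>x \<bullet> (\<Sum>k<n. \<phi> k 0 *\<^sub>R g k) - S h (P e 0 x) \<bullet> v\<bar> \<le> min \<delta>1 \<delta>2 * norm x"
      "\<And>q. q \<in> {0..h} \<Longrightarrow> norm (\<Sum>k<n. \<psi> k q *\<^sub>R g k + \<phi> k q *\<^sub>R adj_op DA A (g k)) \<le> min \<delta>1 \<delta>2"
    proof (rule test_functions[OF e h \<delta>, of v], goal_cases)
      case (1 n g \<phi> \<psi>)
      show ?case by (rule 1(1)[of g \<psi> \<phi> n]) (fact 1)+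
    qed
    have t: "test_family e h v (min \<delta>1 \<delta>2) n g \<phi> \<psi>" unfolding test_family_def by (intro conjI allI ballI fam)
    have "\<bar>expectation (\<lambda>\<omega>. cos (P e 0 (R s h \<omega>) \<bullet> v)) - expectation (\<lambda>\<omega>. cos (Theta s h n (\<lambda>k. \<phi> k h) \<psi> g \<omega>))\<bar> < \<epsilon> / 2"
      by (rule A1, rule test_family_mono[OF t]) simp
    moreover have "\<bar>expectation (\<lambda>\<omega>. cos (P e 0 (R 0 h \<omega>) \<bullet> v)) - expectation (\<lambda>\<omega>. cos (Theta 0 h n (\<lambda>k. \<phi> k h) \<psi> g \<omega>))\<bar> < \<epsilon> / 2"
      by (rule A2, rule test_family_mono[OF t]) simp
    moreover have "expectation (\<lambda>\<omega>. cos (Theta s h n (\<lambda>k. \<phi> k h) \<psi> g \<omega>)) = expectation (\<lambda>\<omega>. cos (Theta 0 h n (\<lambda>k. \<phi> k h) \<psi> g \<omega>))"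
      by (rule Theta_law[OF h s fam(1,2)])
    ultimately show ?thesis by linarith
  qed
  then have "\<bar>expectation (\<lambda>\<omega>. cos (P e 0 (R s h \<omega>) \<bullet> v)) - expectation (\<lambda>\<omega>. cos (P e 0 (R 0 h \<omega>) \<bullet> v))\<bar> \<le> 0"
    by (rule field_le_epsilon[of _ 0, simplified])
  then show ?thesis by simp
qed

lemma J_bounded: "\<exists>K\<ge>0. \<forall>e\<in>{0<..1}. \<forall>x. norm (J e x) \<le> K * norm x"
proof -
  obtain K where K: "\<And>r. r \<in> {0..1} \<Longrightarrow> norm (S r) \<le> K" using S_bounded by blast
  have K0: "K \<ge> 0" using order_trans[OF norm_ge_zero K[of 0]] by simp
  have "norm (J e x) \<le> K * norm x" if e: "e \<in> {0<..1}" for e x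
  proof (rule inner_le_imp_norm_le)
    show "J e x \<bullet> v \<le> K * norm x * norm v" for v
      using S_inner_integral_le[of 0 e K x v] K e by (simp add: inner_J field_simps)
  qed (use K0 in simp)
  then show ?thesis using K0 by blast
qed

lemma P0_tendsto: "(\<lambda>i. P (1 / real (Suc i)) 0 x) \<longlonglongrightarrow> x"
proof -
  obtain K where K: "K \<ge> 0" "\<And>e x. e \<in> {0<..1} \<Longrightarrow> norm (J e x) \<le> K * norm x" using J_bounded by blast
  have "filterlim (\<lambda>i. 1 / real (Suc i)) (at_right 0) sequentially"
    unfolding filterlim_at using LIMSEQ_Suc[OF lim_1_over_n] by (auto intro!: always_eventually)
  then have J: "(\<lambda>i. J (1 / real (Suc i)) x) \<longlonglongrightarrow> x" using J_tendsto filterlim_compose by blast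
  have "(\<lambda>i. (K * K + K + 1) * norm (J (1 / real (Suc i)) x - x)) \<longlonglongrightarrow> (K * K + K + 1) * norm (x - x)"
    by (intro tendsto_intros J)
  then have lim: "(\<lambda>i. (K * K + K + 1) * norm (J (1 / real (Suc i)) x - x)) \<longlonglongrightarrow> 0" by simp
  have "(\<lambda>i. P (1 / real (Suc i)) 0 x - x) \<longlonglongrightarrow> 0"
  proof (rule Lim_null_comparison[OF always_eventually[OF allI] lim])
    fix i
    define e where "e = 1 / real (Suc i)"
    have e: "e \<in> {0<..1}" by (simp add: e_def)
    define y where "y = J e x - x"
    \<comment> \<open>The factorisation of the cube of \<open>J e\<close> minus 1 by
      \<open>J e\<close> minus 1: the uniform bound on \<open>J e\<close> reduces the claim to the
      convergence of \<open>J e x\<close>.\<close>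
    have "P e 0 x - x = J e (J e y) + J e y + y" by (simp add: P_def y_def blinfun.diff_right)
    also have "norm \<dots> \<le> norm (J e (J e y)) + norm (J e y) + norm y" by norm
    also have "\<dots> \<le> K * (K * norm y) + K * norm y + norm y"
      using K(2)[OF e, of y] K(2)[OF e, of "J e y"] mult_left_mono[OF K(2)[OF e, of y] K(1)] by simp
    finally show "norm (P (1 / real (Suc i)) 0 x - x) \<le> (K * K + K + 1) * norm (J (1 / real (Suc i)) x - x)"
      by (simp add: e_def y_def algebra_simps)
  qed
  then show ?thesis by (rule LIM_zero_cancel)
qed

lemma cos_R:
  assumes h: "h > 0" and s: "0 \<le> s" "s + h \<le> T"
  shows "expectation (\<lambda>\<omega>. cos (R s h \<omega> \<bullet> v)) = expectation (\<lambda>\<omega>. cos (R 0 h \<omega> \<bullet> v))"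
proof -
  have lim: "(\<lambda>i. expectation (\<lambda>\<omega>. cos (P (1 / real (Suc i)) 0 (R s h \<omega>) \<bullet> v))) \<longlonglongrightarrow> expectation (\<lambda>\<omega>. cos (R s h \<omega> \<bullet> v))" for s
  proof (rule expectation_cos_tendsto)
    show "(\<lambda>i. L0norm (\<lambda>\<omega>. P (1 / real (Suc i)) 0 (R s h \<omega>) \<bullet> v - R s h \<omega> \<bullet> v)) \<longlonglongrightarrow> 0"
    proof (rule L0norm_tendsto_AE, measurable, rule AE_I2)
      fix \<omega>
      show "(\<lambda>i. P (1 / real (Suc i)) 0 (R s h \<omega>) \<bullet> v - R s h \<omega> \<bullet> v) \<longlonglongrightarrow> 0"
        by (intro LIM_zero tendsto_intros P0_tendsto)
    qed
  qed measurable
  have "expectation (\<lambda>\<omega>. cos (P (1 / real (Suc i)) 0 (R s h \<omega>) \<bullet> v)) = expectation (\<lambda>\<omega>. cos (P (1 / real (Suc i)) 0 (R 0 h \<omega>) \<bullet> v))" for i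
    by (rule cos_P_R[OF _ h s]) simp
  then show ?thesis using lim[of s] lim[of 0] by (auto intro: LIMSEQ_unique)
qed

end

subsection \<open>Recovering the law of the norm from the characteristic function\<close>

lemma integral_cos_std_normal:
  "(\<integral>\<xi>. cos (a + \<xi> * b) \<partial>std_normal_distribution) = cos a * exp (- (b\<^sup>2 / 2))"
proof -
  interpret N: prob_space std_normal_distribution by (rule prob_space_normal_density) simp
  have int: "integrable std_normal_distribution (\<lambda>\<xi>. iexp (b * \<xi>))"
    by (rule N.integrable_const_bound[where B = 1]) auto
  have ch: "(CLINT \<xi>|std_normal_distribution. iexp (b * \<xi>)) = complex_of_real (exp (- (b\<^sup>2) / 2))"
    using fun_cong[OF char_std_normal_distribution, of b] by (simp add: char_def)
  have "Re (CLINT \<xi>|std_normal_distribution. iexp (b * \<xi>)) = (\<integral>\<xi>. cos (b * \<xi>) \<partial>std_normal_distribution)"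
    by (subst integral_Re[OF int, symmetric]) (simp add: Re_exp)
  then have c: "(\<integral>\<xi>. cos (b * \<xi>) \<partial>std_normal_distribution) = exp (- (b\<^sup>2 / 2))" unfolding ch by simp
  have "Im (CLINT \<xi>|std_normal_distribution. iexp (b * \<xi>)) = (\<integral>\<xi>. sin (b * \<xi>) \<partial>std_normal_distribution)"
    by (subst integral_Im[OF int, symmetric]) (simp add: Im_exp)
  then have s: "(\<integral>\<xi>. sin (b * \<xi>) \<partial>std_normal_distribution) = 0" unfolding ch by simp
  have "integrable std_normal_distribution (\<lambda>\<xi>. cos (b * \<xi>))" "integrable std_normal_distribution (\<lambda>\<xi>. sin (b * \<xi>))"
    by (rule N.integrable_const_bound[where B = 1]; simp)+
  then have "(\<integral>\<xi>. cos a * cos (b * \<xi>) - sin a * sin (b * \<xi>) \<partial>std_normal_distribution) = cos a * exp (- (b\<^sup>2 / 2))"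
    by (simp add: c s)
  then show ?thesis by (simp add: cos_add mult.commute)
qed

text \<open>By \<open>integral_cos_std_normal\<close>, a factor
  \<open>exp (- ((Z \<omega> \<bullet> f)\<^sup>2 / 2))\<close> next to the cosine is a mean of
  \<open>cos (Z \<omega> \<bullet> (v + \<xi> *\<^sub>R f))\<close> over a standard normal
  \<open>\<xi>\<close>. Each factor is thus traded for a shift of \<open>v\<close>, which is why
  \<open>v\<close> stays arbitrary in the induction.\<close>

lemma (in prob_space) gaussian_weights_eq:
  fixes Z W :: "'a \<Rightarrow> 'v::{real_inner,second_countable_topology}"
  assumes [measurable]: "Z \<in> borel_measurable M" "W \<in> borel_measurable M"
    and eq: "\<And>v. expectation (\<lambda>\<omega>. cos (Z \<omega> \<bullet> v)) = expectation (\<lambda>\<omega>. cos (W \<omega> \<bullet> v))"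
  shows "expectation (\<lambda>\<omega>. cos (Z \<omega> \<bullet> v) * exp (- (\<Sum>f\<leftarrow>fs. (Z \<omega> \<bullet> f)\<^sup>2 / 2)))
    = expectation (\<lambda>\<omega>. cos (W \<omega> \<bullet> v) * exp (- (\<Sum>f\<leftarrow>fs. (W \<omega> \<bullet> f)\<^sup>2 / 2)))"
proof (induction fs arbitrary: v)
  case Nil
  then show ?case using eq by simp
next
  case (Cons f fs)
  interpret N: prob_space std_normal_distribution by (rule prob_space_normal_density) simp
  interpret P: pair_sigma_finite M std_normal_distribution ..
  interpret PP: pair_prob_space M std_normal_distribution ..
  have step: "expectation (\<lambda>\<omega>. cos (X \<omega> \<bullet> v) * exp (- (\<Sum>f\<leftarrow>f # fs. (X \<omega> \<bullet> f)\<^sup>2 / 2)))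
      = (\<integral>\<xi>. expectation (\<lambda>\<omega>. cos (X \<omega> \<bullet> (v + \<xi> *\<^sub>R f)) * exp (- (\<Sum>f\<leftarrow>fs. (X \<omega> \<bullet> f)\<^sup>2 / 2))) \<partial>std_normal_distribution)"
    if [measurable]: "X \<in> borel_measurable M" for X :: "'a \<Rightarrow> 'v"
  proof -
    have sm [measurable]: "(\<lambda>\<omega>. \<Sum>f\<leftarrow>fs. (X \<omega> \<bullet> f)\<^sup>2 / 2) \<in> borel_measurable M" by (induction fs) auto
    have pos: "0 \<le> (\<Sum>f\<leftarrow>fs. (X \<omega> \<bullet> f)\<^sup>2 / 2)" for \<omega> by (rule sum_list_nonneg) auto
    have int: "integrable (M \<Otimes>\<^sub>M std_normal_distribution)
        (\<lambda>(\<omega>, \<xi>). cos (X \<omega> \<bullet> (v + \<xi> *\<^sub>R f)) * exp (- (\<Sum>f\<leftarrow>fs. (X \<omega> \<bullet> f)\<^sup>2 / 2)))"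
    proof (rule PP.P.integrable_const_bound[where B = 1])
      have "\<bar>cos (X \<omega> \<bullet> (v + \<xi> *\<^sub>R f))\<bar> * exp (- (\<Sum>f\<leftarrow>fs. (X \<omega> \<bullet> f)\<^sup>2 / 2)) \<le> 1 * 1" for \<omega> \<xi>
        using pos[of \<omega>] by (intro mult_mono) auto
      then show "AE x in M \<Otimes>\<^sub>M std_normal_distribution.
          norm (case x of (\<omega>, \<xi>) \<Rightarrow> cos (X \<omega> \<bullet> (v + \<xi> *\<^sub>R f)) * exp (- (\<Sum>f\<leftarrow>fs. (X \<omega> \<bullet> f)\<^sup>2 / 2))) \<le> 1"
        by (auto intro!: AE_I2 simp: abs_mult)
      have "(\<lambda>(\<omega>, \<xi>). cos (X \<omega> \<bullet> (v + \<xi> *\<^sub>R f)) * exp (- (\<Sum>f\<leftarrow>fs. (X \<omega> \<bullet> f)\<^sup>2 / 2))) \<in> borel_measurable (M \<Otimes>\<^sub>M borel)"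
        by measurable
      then show "(\<lambda>(\<omega>, \<xi>). cos (X \<omega> \<bullet> (v + \<xi> *\<^sub>R f)) * exp (- (\<Sum>f\<leftarrow>fs. (X \<omega> \<bullet> f)\<^sup>2 / 2))) \<in> borel_measurable (M \<Otimes>\<^sub>M std_normal_distribution)"
        by (simp cong: measurable_cong_sets)
    qed
    have "cos (X \<omega> \<bullet> v) * exp (- (\<Sum>f\<leftarrow>f # fs. (X \<omega> \<bullet> f)\<^sup>2 / 2))
        = (\<integral>\<xi>. cos (X \<omega> \<bullet> (v + \<xi> *\<^sub>R f)) * exp (- (\<Sum>f\<leftarrow>fs. (X \<omega> \<bullet> f)\<^sup>2 / 2)) \<partial>std_normal_distribution)" for \<omega>
    proof -
      have "exp (- (p + q)) = exp (- p) * exp (- q)" for p q :: real by (simp flip: exp_add)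
      then show ?thesis using integral_cos_std_normal[of "X \<omega> \<bullet> v" "X \<omega> \<bullet> f"] by (simp add: inner_add_right)
    qed
    then show ?thesis using P.Fubini_integral[OF int] by simp
  qed
  show ?case unfolding step[OF assms(1)] step[OF assms(2)] Cons.IH ..
qed

text \<open>The sum is \<open>x \<bullet> p\<close> for the orthogonal projection \<open>p\<close>
  of \<open>x\<close> to the span, so the defect is the squared distance from \<open>x\<close> to
  \<open>p\<close>, the nearest point of the span.\<close>

lemma orthogonal_set_Bessel:
  fixes C :: "'v::real_inner set"
  assumes C: "finite C" "pairwise orthogonal C" and y: "y \<in> span C"
  shows "(\<Sum>c\<in>C. (x \<bullet> (c /\<^sub>R norm c))\<^sup>2) \<le> (norm x)\<^sup>2"
    and "(norm x)\<^sup>2 - (\<Sum>c\<in>C. (x \<bullet> (c /\<^sub>R norm c))\<^sup>2) \<le> (norm (x - y))\<^sup>2"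
proof -
  \<comment> \<open>\<open>C\<close> may contain 0; division by zero then gives it the coefficient
    0.\<close>
  define p where "p = (\<Sum>c\<in>C. ((x \<bullet> c) / (c \<bullet> c)) *\<^sub>R c)"
  have pc: "p \<bullet> c = x \<bullet> c" if "c \<in> C" for c
  proof -
    have "p \<bullet> c = (\<Sum>b\<in>C. ((x \<bullet> b) / (b \<bullet> b)) * (b \<bullet> c))" by (simp add: p_def inner_sum_left)
    also have "\<dots> = (\<Sum>b\<in>C. if b = c then x \<bullet> c else 0)"
      using C(2) that by (intro sum.cong) (auto simp: pairwise_def orthogonal_def)
    finally show ?thesis using that C(1) by simp
  qed
  have orth: "(x - p) \<bullet> z = 0" if "z \<in> span C" for z
    using that by (induction rule: span_induct_alt) (auto simp: inner_add_right inner_diff_left pc)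
  have p: "p \<in> span C" unfolding p_def by (intro span_sum span_scale span_base)
  have "(x \<bullet> (c /\<^sub>R norm c))\<^sup>2 = ((x \<bullet> c) / (c \<bullet> c)) * (x \<bullet> c)" for c
    by (simp add: power_mult_distrib power_inverse power2_norm_eq_inner power2_eq_square[of "x \<bullet> c"] divide_inverse mult_ac)
  then have sum: "(\<Sum>c\<in>C. (x \<bullet> (c /\<^sub>R norm c))\<^sup>2) = x \<bullet> p" by (simp add: p_def inner_sum_right)
  have xp: "(norm x)\<^sup>2 - x \<bullet> p = (norm (x - p))\<^sup>2"
    using orth[OF p] by (simp add: power2_norm_eq_inner inner_diff_left inner_diff_right inner_commute)
  then show "(\<Sum>c\<in>C. (x \<bullet> (c /\<^sub>R norm c))\<^sup>2) \<le> (norm x)\<^sup>2" unfolding sum by (metis diff_ge_0_iff_ge zero_le_power2)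
  have "(norm (x - y))\<^sup>2 = (norm (x - p))\<^sup>2 + (norm (p - y))\<^sup>2"
    using orth[OF span_diff[OF p y]] 
    by (simp add: power2_norm_eq_inner inner_diff_left inner_diff_right inner_commute)
  then show "(norm x)\<^sup>2 - (\<Sum>c\<in>C. (x \<bullet> (c /\<^sub>R norm c))\<^sup>2) \<le> (norm (x - y))\<^sup>2" unfolding sum xp by simp
qed

text \<open>Orthogonalising the first \<open>m + 1\<close> points of a dense sequence gives
  \<open>fs m\<close>; the Bessel defect is at most the squared distance from \<open>x\<close> to
  any of these points. Lists suit the induction in \<open>gaussian_weights_eq\<close>.\<close>

lemma norm_square_approx:
  "\<exists>fs :: nat \<Rightarrow> 'v::{real_inner,second_countable_topology} list.
    \<forall>x. (\<lambda>m. \<Sum>f\<leftarrow>fs m. (x \<bullet> f)\<^sup>2) \<longlonglongrightarrow> (norm x)\<^sup>2"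
proof -
  obtain D :: "'v set" where D: "countable D" "\<And>X. open X \<Longrightarrow> X \<noteq> {} \<Longrightarrow> \<exists>d\<in>D. d \<in> X"
    using countable_dense_exists by blast
  have "D \<noteq> {}" using D(2)[of UNIV] by auto
  define d where "d = from_nat_into D"
  have ran: "range d = D" unfolding d_def using D(1) \<open>D \<noteq> {}\<close> by simp
  have "\<exists>fs :: 'v list. \<forall>x. \<forall>k\<le>m. (\<Sum>f\<leftarrow>fs. (x \<bullet> f)\<^sup>2) \<le> (norm x)\<^sup>2 \<and> (norm x)\<^sup>2 - (\<Sum>f\<leftarrow>fs. (x \<bullet> f)\<^sup>2) \<le> (norm (x - d k))\<^sup>2" for m
  proof -
    obtain C where C: "finite C" "span C = span (d ` {..m})" "pairwise orthogonal C"
      using basis_orthogonal[of "d ` {..m}"] by auto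
    obtain cs where cs: "set cs = C" "distinct cs" using finite_distinct_list[OF C(1)] by blast
    have sum: "(\<Sum>f\<leftarrow>map (\<lambda>c. c /\<^sub>R norm c) cs. (x \<bullet> f)\<^sup>2) = (\<Sum>c\<in>C. (x \<bullet> (c /\<^sub>R norm c))\<^sup>2)" for x
      using sum_list_distinct_conv_sum_set[OF cs(2), of "\<lambda>c. (x \<bullet> (c /\<^sub>R norm c))\<^sup>2"] cs(1) by (simp add: o_def)
    have "d k \<in> span C" if "k \<le> m" for k unfolding C(2) using that by (intro span_base) auto
    then show ?thesis
      using orthogonal_set_Bessel[OF C(1,3)]
      by (intro exI[of _ "map (\<lambda>c. c /\<^sub>R norm c) cs"]) (simp only: sum, blast)
  qed
  then obtain fs :: "nat \<Rightarrow> 'v list" where fs: "\<And>m x k. k \<le> m \<Longrightarrow> (\<Sum>f\<leftarrow>fs m. (x \<bullet> f)\<^sup>2) \<le> (norm x)\<^sup>2"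
    "\<And>m x k. k \<le> m \<Longrightarrow> (norm x)\<^sup>2 - (\<Sum>f\<leftarrow>fs m. (x \<bullet> f)\<^sup>2) \<le> (norm (x - d k))\<^sup>2" by metis
  show ?thesis
  proof (intro exI[of _ fs] allI LIMSEQ_I)
    fix x :: 'v and e :: real assume e: "e > 0"
    have "\<exists>y\<in>D. y \<in> ball x (sqrt e)" using D(2)[of "ball x (sqrt e)"] e by auto
    then obtain k where k: "norm (x - d k) < sqrt e" unfolding ran[symmetric] by (auto simp: dist_norm)
    have "(norm (x - d k))\<^sup>2 < e" using power_strict_mono[OF k, of 2] e by simp
    then have "norm ((\<Sum>f\<leftarrow>fs m. (x \<bullet> f)\<^sup>2) - (norm x)\<^sup>2) < e" if "m \<ge> k" for m
      using fs[OF that, of x] by simp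
    then show "\<exists>no. \<forall>m\<ge>no. norm ((\<Sum>f\<leftarrow>fs m. (x \<bullet> f)\<^sup>2) - (norm x)\<^sup>2) < e" by blast
  qed
qed

text \<open>The expectation of \<open>psi\<close> is an average of characteristic functions, since \<open>exp (- (norm x)\<^sup>2 / 2)\<close> is
  a Gaussian mean of \<open>cos (x \<bullet> v)\<close>, and it metrises convergence in probability.\<close>

definition psi :: "'v::real_inner \<Rightarrow> real" where
  "psi x = 1 - exp (- ((norm x)\<^sup>2 / 2))"

lemma psi_bounds [simp]: "0 \<le> psi x" "psi x \<le> 1" "\<bar>psi x\<bar> \<le> 1" "psi 0 = 0"
  by (auto simp: psi_def abs_le_iff intro: order_trans[of _ 0])

lemma psi_mono: "norm x \<le> norm y \<Longrightarrow> psi x \<le> psi y"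
  by (simp add: psi_def power_mono)

lemma psi_minus: "psi (- x) = psi x" "psi (x - y) = psi (y - x)"
  by (simp_all add: psi_def norm_minus_commute)

text \<open>A substitute for the triangle inequality. The squared norm of a sum is at most twice the
  sum of the squared norms, which squares the exponentials;
  \<open>1 - u * u \<le> 2 * (1 - u)\<close> undoes this at the price of the factor 2.\<close>

lemma psi_add: "psi (x + y) \<le> 2 * psi x + 2 * psi y"
proof -
  define a b where "a = (norm x)\<^sup>2 / 2" and "b = (norm y)\<^sup>2 / 2"
  define u w where "u = exp (- a)" and "w = exp (- b)"
  have uw: "0 < u" "u \<le> 1" "0 < w" "w \<le> 1" by (simp_all add: u_def w_def a_def b_def)
  have "(norm (x + y))\<^sup>2 \<le> (norm x + norm y)\<^sup>2" by (intro power_mono norm_triangle_ineq) simp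
  also have "\<dots> \<le> 2 * (norm x)\<^sup>2 + 2 * (norm y)\<^sup>2"
    using zero_le_power2[of "norm x - norm y"] by (simp add: power2_eq_square algebra_simps)
  finally have "(norm (x + y))\<^sup>2 / 2 \<le> a + a + (b + b)" by (simp add: a_def b_def)
  then have "psi (x + y) \<le> 1 - exp (- (a + a + (b + b)))" by (simp add: psi_def)
  also have "exp (- (a + a + (b + b))) = (u * u) * (w * w)"
    by (simp add: u_def w_def exp_add[symmetric])
  also have "1 - (u * u) * (w * w) \<le> 2 * (1 - u) + 2 * (1 - w)"
  proof -
    have "0 \<le> (1 - u * u) * (1 - w * w)" using uw by (intro mult_nonneg_nonneg) (auto simp: mult_le_one)
    then have "1 - (u * u) * (w * w) \<le> (1 - u * u) + (1 - w * w)" by (simp add: algebra_simps)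
    moreover have "1 - u * u \<le> 2 * (1 - u)" using zero_le_power2[of "1 - u"] by (simp add: power2_eq_square algebra_simps)
    moreover have "1 - w * w \<le> 2 * (1 - w)" using zero_le_power2[of "1 - w"] by (simp add: power2_eq_square algebra_simps)
    ultimately show ?thesis by linarith
  qed
  finally show ?thesis by (simp add: psi_def u_def w_def a_def b_def)
qed

lemma psi_continuous [continuous_intros]:
  "continuous_on A f \<Longrightarrow> continuous_on A (\<lambda>x. psi (f x))"
  unfolding psi_def by (intro continuous_intros) auto

lemma psi_measurable [measurable]: "psi \<in> borel_measurable borel"
  by (intro borel_measurable_continuous_onI continuous_intros)

lemma psi_tendsto_0:
  fixes X :: "'i \<Rightarrow> 'v::real_inner"
  assumes "(X \<longlongrightarrow> 0) F"
  shows "((\<lambda>i. psi (X i)) \<longlongrightarrow> 0) F"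
proof -
  have "((\<lambda>i. 1 - exp (- ((norm (X i))\<^sup>2 / 2))) \<longlongrightarrow> 1 - exp (- ((norm (0::'v))\<^sup>2 / 2))) F"
    using assms by (intro tendsto_intros) auto
  then show ?thesis by (simp add: psi_def)
qed

context weak_cauchy
begin

text \<open>Gaussian weights along the vectors \<open>adjoint C f\<close> approximate
  \<open>exp (- ((norm (C x))\<^sup>2 / 2))\<close>. The operator \<open>C\<close> is carried along
  for the estimate from the left, where it is \<open>S h\<close> minus the identity.\<close>

lemma psi_R:
  fixes C :: "'v \<Rightarrow>\<^sub>L 'v"
  assumes h: "h > 0" and s: "0 \<le> s" "s + h \<le> T"
  shows "expectation (\<lambda>\<omega>. psi (C (R s h \<omega>))) = expectation (\<lambda>\<omega>. psi (C (R 0 h \<omega>)))"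
proof -
  obtain fs :: "nat \<Rightarrow> 'v list" where fs: "\<And>x. (\<lambda>m. \<Sum>f\<leftarrow>fs m. (x \<bullet> f)\<^sup>2) \<longlonglongrightarrow> (norm x)\<^sup>2"
    using norm_square_approx by blast
  define G where "G m = map (adjoint C) (fs m)" for m
  have G: "(\<Sum>f\<leftarrow>G m. (x \<bullet> f)\<^sup>2 / 2) = (\<Sum>f\<leftarrow>fs m. (C x \<bullet> f)\<^sup>2) / 2" for m x
  proof -
    have "(\<Sum>f\<leftarrow>map (adjoint C) xs. (x \<bullet> f)\<^sup>2 / 2) = (\<Sum>f\<leftarrow>xs. (C x \<bullet> f)\<^sup>2) / 2" for xs
      by (induction xs) (simp_all add: inner_adjoint blinfun.bounded_linear_right add_divide_distrib)
    then show ?thesis by (simp only: G_def)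
  qed
  have [measurable]: "(\<lambda>\<omega>. C (R s h \<omega>)) \<in> borel_measurable M" for s
    by (rule measurable_compose[OF R_measurable]) (intro borel_measurable_continuous_onI continuous_intros)
  have Gm [measurable]: "(\<lambda>\<omega>. \<Sum>f\<leftarrow>xs. (R s h \<omega> \<bullet> f)\<^sup>2 / 2) \<in> borel_measurable M" for xs s
    by (induction xs) auto
  have lim: "(\<lambda>m. expectation (\<lambda>\<omega>. exp (- (\<Sum>f\<leftarrow>G m. (R s h \<omega> \<bullet> f)\<^sup>2 / 2))))
      \<longlonglongrightarrow> expectation (\<lambda>\<omega>. exp (- ((norm (C (R s h \<omega>)))\<^sup>2 / 2)))" for s
  proof (rule integral_dominated_convergence[where w = "\<lambda>_. 1"])
    show "AE \<omega> in M. (\<lambda>m. exp (- (\<Sum>f\<leftarrow>G m. (R s h \<omega> \<bullet> f)\<^sup>2 / 2))) \<longlonglongrightarrow> exp (- ((norm (C (R s h \<omega>)))\<^sup>2 / 2))"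
      unfolding G by (intro AE_I2 tendsto_intros fs) simp
    have "0 \<le> (\<Sum>f\<leftarrow>xs. (x \<bullet> f)\<^sup>2 / 2)" for xs and x :: 'v by (rule sum_list_nonneg) auto
    then show "AE \<omega> in M. norm (exp (- (\<Sum>f\<leftarrow>G m. (R s h \<omega> \<bullet> f)\<^sup>2 / 2))) \<le> 1" for m by (intro AE_I2) simp
  qed measurable
  have "expectation (\<lambda>\<omega>. exp (- (\<Sum>f\<leftarrow>G m. (R s h \<omega> \<bullet> f)\<^sup>2 / 2)))
      = expectation (\<lambda>\<omega>. exp (- (\<Sum>f\<leftarrow>G m. (R 0 h \<omega> \<bullet> f)\<^sup>2 / 2)))" for m
    using gaussian_weights_eq[of "R s h" "R 0 h" 0 "G m"] cos_R[OF h s] by simp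
  then have eq: "expectation (\<lambda>\<omega>. exp (- ((norm (C (R s h \<omega>)))\<^sup>2 / 2))) = expectation (\<lambda>\<omega>. exp (- ((norm (C (R 0 h \<omega>)))\<^sup>2 / 2)))"
    using lim[of s] lim[of 0] by (auto intro: LIMSEQ_unique)
  have "integrable M (\<lambda>\<omega>. exp (- ((norm (C (R s h \<omega>)))\<^sup>2 / 2)))" for s
    by (rule integrable_const_bound[where B = 1]) auto
  then show ?thesis unfolding psi_def using eq by (simp add: prob_space)
qed

end

subsection \<open>Continuity of translations\<close>

lemma LIMSEQ_0_less:
  fixes f :: "nat \<Rightarrow> real"
  assumes "f \<longlonglongrightarrow> 0" "e > 0"
  shows "\<exists>n0. \<forall>n\<ge>n0. f n < e"
  using order_tendstoD(2)[OF assms] by (simp add: eventually_sequentially)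

lemma set_integral_lborel_const: "(LINT s:{0..c}|lborel. k :: real) = max 0 c * k"
  by (cases "0 \<le> c") (simp_all add: set_lebesgue_integral_def)

lemma set_integrable_bounded:
  fixes f :: "real \<Rightarrow> real"
  assumes "f \<in> borel_measurable borel" "\<And>x. \<bar>f x\<bar> \<le> B"
  shows "set_integrable lborel {a..b} f"
  unfolding set_integrable_def
  by (rule integrableI_bounded_set[where A = "{a..b}" and B = B])
    (use assms in \<open>auto intro!: AE_I2 simp: emeasure_lborel_Icc_eq\<close>)

lemma set_integral_bounded_tendsto_0:
  fixes f :: "nat \<Rightarrow> real \<Rightarrow> real"
  assumes [measurable]: "\<And>n. f n \<in> borel_measurable borel" and B: "\<And>n x. \<bar>f n x\<bar> \<le> B"
    and lim: "AE x in lborel. x \<in> {a..b} \<longrightarrow> (\<lambda>n. f n x) \<longlonglongrightarrow> 0"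
  shows "(\<lambda>n. LINT x:{a..b}|lborel. f n x) \<longlonglongrightarrow> 0"
proof -
  have "(\<lambda>n. LINT x:{a..b}|lborel. f n x) \<longlonglongrightarrow> (LINT x:{a..b}|lborel. 0)"
    unfolding set_lebesgue_integral_def
  proof (rule integral_dominated_convergence[where w = "\<lambda>x. indicator {a..b} x * B"])
    show "integrable lborel (\<lambda>x. indicator {a..b} x * B)"
      by (intro integrable_mult_left) (simp add: integrable_indicator_iff emeasure_lborel_Icc_eq)
    show "AE x in lborel. (\<lambda>n. indicator {a..b} x *\<^sub>R f n x) \<longlonglongrightarrow> indicator {a..b} x *\<^sub>R 0"
      using lim by eventually_elim (auto simp: indicator_def)
    show "AE x in lborel. norm (indicator {a..b} x *\<^sub>R f n x) \<le> indicator {a..b} x * B" for n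
      using B by (auto simp: indicator_def intro!: AE_I2)
  qed measurable
  then show ?thesis by simp
qed

lemma set_integral_bounded_mono:
  fixes f g :: "real \<Rightarrow> real"
  assumes "f \<in> borel_measurable borel" "g \<in> borel_measurable borel" "\<And>x. \<bar>f x\<bar> \<le> B" "\<And>x. \<bar>g x\<bar> \<le> C"
    and "\<And>x. x \<in> {a..b} \<Longrightarrow> f x \<le> g x"
  shows "(LINT x:{a..b}|lborel. f x) \<le> (LINT x:{a..b}|lborel. g x)"
  using assms by (intro set_integral_mono set_integrable_bounded)

lemma set_integral_nonneg_subset:
  fixes f :: "real \<Rightarrow> real"
  assumes [measurable]: "f \<in> borel_measurable borel" and B: "\<And>x. \<bar>f x\<bar> \<le> B" and nn: "\<And>x. 0 \<le> f x" and "{a..b} \<subseteq> {c..d}"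
  shows "(LINT x:{a..b}|lborel. f x) \<le> (LINT x:{c..d}|lborel. f x)"
  unfolding set_lebesgue_integral_def
  by (rule integral_mono)
    (use set_integrable_bounded[OF assms(1) B] nn assms(4) in \<open>auto simp: indicator_def set_integrable_def\<close>)

text \<open>A measurable function is almost everywhere a limit of continuous ones, for which the
  claim is dominated convergence. The truncation at 1 supplies integrability, and the shifted
  approximation error is an integral over \<open>{h n..h n + c}\<close>, still inside
  \<open>{0..T}\<close>.\<close>

lemma real_translation_tendsto_0:
  fixes g :: "real \<Rightarrow> real"
  assumes g [measurable]: "g \<in> borel_measurable borel" and h: "h \<longlonglongrightarrow> 0" "\<And>n. 0 \<le> h n" "\<And>n. c + h n \<le> T"
  shows "(\<lambda>n. LINT s:{0..c}|lborel. min 1 \<bar>g (s + h n) - g s\<bar>) \<longlonglongrightarrow> 0"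
proof -
  have "g measurable_on UNIV" by (rule lebesgue_measurable_imp_measurable_on_real) (auto simp: measurable_completion)
  then obtain N k where N: "negligible N" and k: "\<And>n. continuous_on UNIV (k n)" "\<And>x. x \<notin> N \<Longrightarrow> (\<lambda>n. k n x) \<longlonglongrightarrow> g x"
    unfolding measurable_on_def by auto
  have km [measurable]: "k n \<in> borel_measurable borel" for n using k(1) by (rule borel_measurable_continuous_onI)
  have "AE x in lebesgue. x \<notin> N" using N by (intro AE_not_in) (simp add: negligible_iff_null_sets)
  then have N': "AE x in lborel. x \<notin> N" by (simp add: AE_completion_iff)
  have lim: "(\<lambda>m. LINT s:{0..T}|lborel. min 1 \<bar>g s - k m s\<bar>) \<longlonglongrightarrow> 0"
  proof (rule set_integral_bounded_tendsto_0[where B = 1])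
    show "AE s in lborel. s \<in> {0..T} \<longrightarrow> (\<lambda>m. min 1 \<bar>g s - k m s\<bar>) \<longlonglongrightarrow> 0" using N'
    proof eventually_elim
      case (elim s)
      have "(\<lambda>m. min 1 \<bar>g s - k m s\<bar>) \<longlonglongrightarrow> min 1 \<bar>g s - g s\<bar>" by (intro tendsto_intros k elim)
      then show ?case by simp
    qed
  qed auto
  show ?thesis
  proof (rule LIMSEQ_I)
    fix e :: real assume e: "e > 0"
    obtain m where m: "(LINT s:{0..T}|lborel. min 1 \<bar>g s - k m s\<bar>) < e / 4"
      using order_tendstoD(2)[OF lim, of "e / 4"] e by (auto simp: eventually_sequentially)
    have "(\<lambda>n. LINT s:{0..c}|lborel. min 1 \<bar>k m (s + h n) - k m s\<bar>) \<longlonglongrightarrow> 0"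
    proof (rule set_integral_bounded_tendsto_0[where B = 1])
      have "(\<lambda>n. min 1 \<bar>k m (s + h n) - k m s\<bar>) \<longlonglongrightarrow> min 1 \<bar>k m (s + 0) - k m s\<bar>" for s
        by (intro tendsto_intros continuous_on_tendsto_compose[OF k(1)[of m]] h(1)) auto
      then show "AE s in lborel. s \<in> {0..c} \<longrightarrow> (\<lambda>n. min 1 \<bar>k m (s + h n) - k m s\<bar>) \<longlonglongrightarrow> 0" by simp
    qed auto
    from LIMSEQ_0_less[OF this, of "e / 4"] e
    obtain n0 where n0: "\<And>n. n \<ge> n0 \<Longrightarrow> (LINT s:{0..c}|lborel. min 1 \<bar>k m (s + h n) - k m s\<bar>) < e / 4" by auto
    have "norm ((LINT s:{0..c}|lborel. min 1 \<bar>g (s + h n) - g s\<bar>) - 0) < e" if n: "n \<ge> n0" for n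
    proof -
      define D where "D s = min 1 \<bar>g s - k m s\<bar>" for s
      define E where "E s = min 1 \<bar>k m (s + h n) - k m s\<bar>" for s
      have [measurable]: "D \<in> borel_measurable borel" "E \<in> borel_measurable borel" unfolding D_def[abs_def] E_def[abs_def] by measurable
      have DE: "\<bar>D s\<bar> \<le> 1" "\<bar>E s\<bar> \<le> 1" "0 \<le> D s" for s by (auto simp: D_def E_def)
      have "(LINT s:{0..c}|lborel. min 1 \<bar>g (s + h n) - g s\<bar>) \<le> (LINT s:{0..c}|lborel. D (h n + s) + (D s + E s))"
      proof (rule set_integral_bounded_mono[where B = 1 and C = 3])
        show "\<bar>D (h n + s) + (D s + E s)\<bar> \<le> 3" for s using DE[of s] DE[of "h n + s"] by linarith
      qed (auto simp: D_def E_def add.commute min_def)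
      also have "\<dots> = (LINT s:{0..c}|lborel. D (h n + s)) + ((LINT s:{0..c}|lborel. D s) + (LINT s:{0..c}|lborel. E s))"
      proof -
        have "set_integrable lborel {0..c} (\<lambda>s. D (h n + s))" "set_integrable lborel {0..c} D" "set_integrable lborel {0..c} E"
          by (rule set_integrable_bounded[where B = 1]; use DE in simp)+
        then show ?thesis by (simp add: set_integral_add)
      qed
      also have "(LINT s:{0..c}|lborel. D (h n + s)) = (LINT s:{h n + 0..h n + c}|lborel. D s)" by (rule set_integral_lborel_shift)
      also have "\<dots> \<le> (LINT s:{0..T}|lborel. D s)"
        by (rule set_integral_nonneg_subset[where B = 1]) (use DE h(2)[of n] h(3)[of n] in auto)
      also have "(LINT s:{0..c}|lborel. D s) \<le> (LINT s:{0..T}|lborel. D s)"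
        by (rule set_integral_nonneg_subset[where B = 1]) (use DE h(2)[of n] h(3)[of n] in auto)
      finally have "(LINT s:{0..c}|lborel. min 1 \<bar>g (s + h n) - g s\<bar>) < e"
        using m n0[OF n] e by (simp add: D_def E_def)
      moreover have "0 \<le> (LINT s:{0..c}|lborel. min 1 \<bar>g (s + h n) - g s\<bar>)"
        unfolding set_lebesgue_integral_def by (rule integral_nonneg_AE) auto
      ultimately show ?thesis by simp
    qed
    then show "\<exists>n0. \<forall>n\<ge>n0. norm ((LINT s:{0..c}|lborel. min 1 \<bar>g (s + h n) - g s\<bar>) - 0) < e" by blast
  qed
qed

text \<open>A path with values in a separable space stays, up to a small set of times, in finitely many
  small balls; there the increment is controlled by those of the distances to the centres.\<close>

lemma translation_psi_tendsto_0:
  fixes y :: "real \<Rightarrow> 'v::{real_inner,second_countable_topology}"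
  assumes y [measurable]: "y \<in> borel_measurable borel"
    and h: "h \<longlonglongrightarrow> 0" "\<And>n. 0 \<le> h n" "\<And>n. c + h n \<le> T"
  shows "(\<lambda>n. LINT s:{0..c}|lborel. psi (y (s + h n) - y s)) \<longlonglongrightarrow> 0"
proof (rule LIMSEQ_I)
  fix e :: real assume e: "e > 0"
  obtain D :: "'v set" where D: "countable D" "\<And>X. open X \<Longrightarrow> X \<noteq> {} \<Longrightarrow> \<exists>d\<in>D. d \<in> X"
    using countable_dense_exists by blast
  have "D \<noteq> {}" using D(2)[of UNIV] by auto
  define d where "d = from_nat_into D"
  have ran: "range d = D" unfolding d_def using D(1) \<open>D \<noteq> {}\<close> by simp
  \<comment> \<open>\<open>c\<close> may be negative or 0; \<open>L\<close> is positive and at least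
    \<open>max 0 c\<close>.\<close>
  define L where "L = \<bar>c\<bar> + 1"
  have "\<exists>r>0. \<forall>x::'v. norm x \<le> 3 * r \<longrightarrow> psi x \<le> e / (4 * L)"
  proof -
    have "((\<lambda>x::'v. psi x) \<longlongrightarrow> 0) (nhds 0)" by (rule psi_tendsto_0) (rule filterlim_ident)
    then have "\<forall>\<^sub>F x::'v in nhds 0. psi x < e / (4 * L)" using e by (intro order_tendstoD) (auto simp: L_def)
    then obtain r where "r > 0" "\<And>x::'v. dist x 0 < r \<Longrightarrow> psi x < e / (4 * L)" unfolding eventually_nhds_metric by blast
    then show ?thesis by (intro exI[of _ "r / 4"]) (auto intro!: less_imp_le)
  qed
  \<comment> \<open>The radius \<open>3 * r\<close> is reached because a path point lies within
    \<open>r\<close> of a centre and its translate within \<open>2 * r\<close> of the same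
    centre.\<close>
  then obtain r where r: "r > 0" "\<And>x::'v. norm x \<le> 3 * r \<Longrightarrow> psi x \<le> e / (4 * L)" by blast
  define bad where "bad K s = (if \<forall>k<K. r \<le> dist (y s) (d k) then 1 else 0 :: real)" for K s
  have [measurable]: "bad K \<in> borel_measurable borel" for K unfolding bad_def[abs_def] by measurable
  have "(\<lambda>K. LINT s:{0..c}|lborel. bad K s) \<longlonglongrightarrow> 0"
  proof (rule set_integral_bounded_tendsto_0[where B = 1])
    have "(\<lambda>K. bad K s) \<longlonglongrightarrow> 0" for s
    proof -
      have "\<exists>x\<in>D. x \<in> ball (y s) r" using D(2)[of "ball (y s) r"] r(1) by auto
      then obtain k where "dist (y s) (d k) < r" unfolding ran[symmetric] by auto
      then have "bad K s = 0" if "K \<ge> Suc k" for K using that unfolding bad_def by (auto simp: not_le Suc_le_eq)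
      then show ?thesis by (intro tendsto_eventually) (auto simp: eventually_sequentially)
    qed
    then show "AE s in lborel. s \<in> {0..c} \<longrightarrow> (\<lambda>K. bad K s) \<longlonglongrightarrow> 0" by simp
  qed (auto simp: bad_def)
  from LIMSEQ_0_less[OF this, of "e / 4"] e obtain K where K: "(LINT s:{0..c}|lborel. bad K s) < e / 4" by auto
  \<comment> \<open>Scaled by \<open>r\<close>: an increment below 1 means that the distance to the
    centre changes by less than \<open>r\<close>, while an increment of at least 1 contributes a
    full unit, which already dominates \<open>psi\<close>.\<close>
  define g where "g k s = dist (y s) (d k) / r" for k s
  have [measurable]: "g k \<in> borel_measurable borel" for k unfolding g_def[abs_def] by measurable
  define I where "I k n = (LINT s:{0..c}|lborel. min 1 \<bar>g k (s + h n) - g k s\<bar>)" for k n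
  have "(\<lambda>n. \<Sum>k<K. I k n) \<longlonglongrightarrow> (\<Sum>k<K. 0)"
    unfolding I_def by (intro tendsto_sum real_translation_tendsto_0[where T = T] h) auto
  then have "(\<lambda>n. \<Sum>k<K. I k n) \<longlonglongrightarrow> 0" by simp
  from LIMSEQ_0_less[OF this, of "e / 4"] e obtain n0 where n0: "\<And>n. n \<ge> n0 \<Longrightarrow> (\<Sum>k<K. I k n) < e / 4" by auto
  have "norm ((LINT s:{0..c}|lborel. psi (y (s + h n) - y s)) - 0) < e" if n: "n \<ge> n0" for n
  proof -
    define G where "G s = (\<Sum>k<K. min 1 \<bar>g k (s + h n) - g k s\<bar>)" for s
    have [measurable]: "G \<in> borel_measurable borel" unfolding G_def[abs_def] by measurable
    have Gb1: "0 \<le> G s" for s unfolding G_def by (rule sum_nonneg) simp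
    have "G s \<le> real K" for s
      using sum_bounded_above[of "{..<K}" "\<lambda>k. min 1 \<bar>g k (s + h n) - g k s\<bar>" 1] by (simp add: G_def)
    with Gb1 have Gb: "0 \<le> G s" "\<bar>G s\<bar> \<le> real K" for s by simp_all
    have le: "psi (y (s + h n) - y s) \<le> e / (4 * L) + (bad K s + G s)" for s
    proof (cases "\<forall>k<K. r \<le> dist (y s) (d k)")
      case True
      then have "bad K s = 1" by (simp add: bad_def)
      moreover have "0 \<le> e / (4 * L)" using e by (simp add: L_def)
      ultimately show ?thesis using psi_bounds(2)[of "y (s + h n) - y s"] Gb(1)[of s] by linarith
    next
      case False
      then obtain k where k: "k < K" "dist (y s) (d k) < r" by (auto simp: not_le)
      have mem: "min 1 \<bar>g k (s + h n) - g k s\<bar> \<le> G s" unfolding G_def using k by (intro member_le_sum) auto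
      have b0: "bad K s \<ge> 0" by (simp add: bad_def)
      have e0: "0 \<le> e / (4 * L)" using e by (simp add: L_def)
      show ?thesis
      proof (cases "\<bar>g k (s + h n) - g k s\<bar> \<ge> 1")
        case True
        then have "G s \<ge> 1" using mem by simp
        then show ?thesis using psi_bounds(2)[of "y (s + h n) - y s"] b0 e0 by linarith
      next
        case False
        then have "\<bar>dist (y (s + h n)) (d k) - dist (y s) (d k)\<bar> < r"
          using r(1) by (simp add: g_def field_simps flip: diff_divide_distrib)
        then have "dist (y (s + h n)) (d k) < 2 * r" using k(2) by linarith
        then have "dist (y (s + h n)) (y s) < 3 * r" using k(2) dist_triangle2[of "y (s + h n)" "y s" "d k"] by linarith
        then have "psi (y (s + h n) - y s) \<le> e / (4 * L)" using r(2) by (simp add: dist_norm)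
        then show ?thesis using b0 Gb(1)[of s] by linarith
      qed
    qed
    have "(LINT s:{0..c}|lborel. psi (y (s + h n) - y s)) \<le> (LINT s:{0..c}|lborel. e / (4 * L) + (bad K s + G s))"
    proof (rule set_integral_bounded_mono[where B = 1 and C = "e / (4 * L) + (1 + real K)"])
      show "\<bar>e / (4 * L) + (bad K s + G s)\<bar> \<le> e / (4 * L) + (1 + real K)" for s
        using Gb[of s] e by (auto simp: bad_def L_def)
    qed (use le in auto)
    also have "\<dots> = (LINT s:{0..c}|lborel. e / (4 * L)) + ((LINT s:{0..c}|lborel. bad K s) + (LINT s:{0..c}|lborel. G s))"
    proof -
      have i: "set_integrable lborel {0..c} (bad K)" "set_integrable lborel {0..c} G" "set_integrable lborel {0..c} (\<lambda>s. e / (4 * L))"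
        by (rule set_integrable_bounded[where B = 1], simp, simp add: bad_def,
            rule set_integrable_bounded[where B = "real K"], simp, rule Gb(2),
            rule set_integrable_bounded[where B = "\<bar>e / (4 * L)\<bar>"], simp, simp)
      show ?thesis using i by (simp add: set_integral_add)
    qed
    also have "(LINT s:{0..c}|lborel. G s) = (\<Sum>k<K. I k n)"
    proof -
      have "set_integrable lborel {0..c} (\<lambda>s. min 1 \<bar>g k (s + h n) - g k s\<bar>)" for k
        by (rule set_integrable_bounded[where B = 1]) auto
      then show ?thesis unfolding G_def I_def set_lebesgue_integral_def set_integrable_def scaleR_sum_right
        by (intro Bochner_Integration.integral_sum)
    qed
    also have "(LINT s:{0..c}|lborel. e / (4 * L)) \<le> e / 4"
    proof -
      have L: "L > 0" "max 0 c \<le> L" by (auto simp: L_def)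
      then have "max 0 c * (e / (4 * L)) \<le> L * (e / (4 * L))" using e by (intro mult_right_mono) auto
      then show ?thesis unfolding set_integral_lborel_const using L(1) by simp
    qed
    finally have "(LINT s:{0..c}|lborel. psi (y (s + h n) - y s)) < e" using K n0[OF n] e by linarith
    moreover have "0 \<le> (LINT s:{0..c}|lborel. psi (y (s + h n) - y s))"
      unfolding set_lebesgue_integral_def by (rule integral_nonneg_AE) auto
    ultimately show ?thesis by simp
  qed
  then show "\<exists>n0. \<forall>n\<ge>n0. norm ((LINT s:{0..c}|lborel. psi (y (s + h n) - y s)) - 0) < e" by blast
qed

subsection \<open>Averaging over the starting time\<close>

lemma set_integral_lborel_reflect:
  fixes f :: "real \<Rightarrow> real"
  shows "(LINT r:{a..b}|lborel. f (c - r)) = (LINT r:{c - b..c - a}|lborel. f r)"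
proof -
  have "indicator {c - b..c - a} (c - r) = (indicator {a..b} r :: real)" for r by (auto simp: indicator_def)
  then show ?thesis using lborel_integral_real_affine[of "-1" "\<lambda>r. indicator {c - b..c - a} r *\<^sub>R f r" c]
    by (simp add: set_lebesgue_integral_def)
qed

context weak_cauchy
begin

definition Epsi :: "('w \<Rightarrow> 'v) \<Rightarrow> real" where
  "Epsi Z = expectation (\<lambda>\<omega>. psi (Z \<omega>))"

lemma integrable_psi: "Z \<in> borel_measurable M \<Longrightarrow> integrable M (\<lambda>\<omega>. psi (Z \<omega>))"
  by (rule integrable_const_bound[where B = 1]) auto

lemma Epsi_bounds: "0 \<le> Epsi Z" "Epsi Z \<le> 1" "\<bar>Epsi Z\<bar> \<le> 1"
proof -
  show 0: "0 \<le> Epsi Z" unfolding Epsi_def by (rule integral_nonneg_AE) simp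
  show "Epsi Z \<le> 1"
  proof (cases "integrable M (\<lambda>\<omega>. psi (Z \<omega>))")
    case True then show ?thesis unfolding Epsi_def by (intro integral_le_const) auto
  qed (simp add: Epsi_def not_integrable_integral_eq)
  then show "\<bar>Epsi Z\<bar> \<le> 1" using 0 by simp
qed

lemma Epsi_mono:
  assumes "X \<in> borel_measurable M" "Z \<in> borel_measurable M" "\<And>\<omega>. norm (X \<omega>) \<le> norm (Z \<omega>)"
  shows "Epsi X \<le> Epsi Z"
  unfolding Epsi_def using assms by (intro integral_mono integrable_psi psi_mono)

lemma Epsi_add:
  assumes [measurable]: "X \<in> borel_measurable M" "Z \<in> borel_measurable M"
  shows "Epsi (\<lambda>\<omega>. X \<omega> + Z \<omega>) \<le> 2 * Epsi X + 2 * Epsi Z"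
proof -
  have "Epsi (\<lambda>\<omega>. X \<omega> + Z \<omega>) \<le> expectation (\<lambda>\<omega>. 2 * psi (X \<omega>) + 2 * psi (Z \<omega>))"
    unfolding Epsi_def
    by (intro integral_mono psi_add Bochner_Integration.integrable_add integrable_mult_right integrable_psi) measurable
  then show ?thesis by (simp add: Epsi_def integrable_psi)
qed

lemma Epsi_tendsto_0:
  assumes [measurable]: "\<And>n. X n \<in> borel_measurable M" and "\<And>\<omega>. (\<lambda>n. X n \<omega>) \<longlonglongrightarrow> 0"
  shows "(\<lambda>n. Epsi (X n)) \<longlonglongrightarrow> 0"
proof -
  have "(\<lambda>n. expectation (\<lambda>\<omega>. psi (X n \<omega>))) \<longlonglongrightarrow> expectation (\<lambda>\<omega>. 0)"
    by (rule integral_dominated_convergence[where w = "\<lambda>_. 1"]) (auto intro!: AE_I2 psi_tendsto_0 assms)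
  then show ?thesis by (simp add: Epsi_def)
qed

definition D :: "real \<Rightarrow> 'v \<Rightarrow>\<^sub>L 'v" where
  "D h = S h - id_blinfun"

lemma D_apply: "D h x = S h x - x"
  by (simp add: D_def blinfun.diff_left)

lemma blinfun_measurable [measurable]: "(\<lambda>x. blinfun_apply C x) \<in> borel_measurable borel" for C :: "'v \<Rightarrow>\<^sub>L 'v"
  by (intro borel_measurable_continuous_onI continuous_intros)

lemma blinfun_Y_measurable [measurable]:
  "(\<lambda>\<omega>. blinfun_apply C (Y s \<omega>)) \<in> borel_measurable M" for C :: "'v \<Rightarrow>\<^sub>L 'v"
  by measurable

lemma D_tendsto_0:
  assumes "h \<longlonglongrightarrow> 0" "\<And>n. 0 < h n"
  shows "(\<lambda>n. D (h n) x) \<longlonglongrightarrow> 0"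
proof -
  have "filterlim h (at_right 0) sequentially"
    unfolding filterlim_at using assms by (auto intro!: always_eventually simp: less_imp_neq[THEN not_sym])
  then have "(\<lambda>n. S (h n) x) \<longlonglongrightarrow> x" using S_right_0 filterlim_compose by blast
  then show ?thesis unfolding D_apply by (rule LIM_zero)
qed

text \<open>\<open>K\<close> will be a bound for \<open>norm (S r)\<close>. Since \<open>D h\<close>
  commutes with \<open>S r\<close>, \<open>beta\<close> then dominates the effect of
  \<open>D h\<close> on every \<open>S r (Y s \<omega>)\<close>.\<close>

definition beta :: "real \<Rightarrow> real \<Rightarrow> real \<Rightarrow> real" where
  "beta K h s = Epsi (\<lambda>\<omega>. K *\<^sub>R D h (Y s \<omega>))"

lemma Epsi_process_measurable:
  assumes Z: "(\<lambda>(s, \<omega>). Z s \<omega>) \<in> borel_measurable (borel \<Otimes>\<^sub>M M)"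
  shows "(\<lambda>s. Epsi (Z s)) \<in> borel_measurable borel"
  unfolding Epsi_def by (rule borel_measurable_lebesgue_integral) (use Z in measurable)

lemma beta_measurable [measurable]: "(\<lambda>s. beta K h s) \<in> borel_measurable borel"
proof -
  have [measurable]: "(\<lambda>(s, \<omega>). Y s \<omega>) \<in> borel_measurable (borel \<Otimes>\<^sub>M M)" by (rule Y_measurable)
  show ?thesis unfolding beta_def by (rule Epsi_process_measurable) measurable
qed

lemma beta_bounds: "0 \<le> beta K h s" "\<bar>beta K h s\<bar> \<le> 1"
  unfolding beta_def using Epsi_bounds by auto

lemma beta_tendsto_0:
  assumes "h \<longlonglongrightarrow> 0" "\<And>n. 0 < h n"
  shows "(\<lambda>n. beta K (h n) s) \<longlonglongrightarrow> 0"
  unfolding beta_def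
proof (rule Epsi_tendsto_0)
  show "(\<lambda>n. K *\<^sub>R D (h n) (Y s \<omega>)) \<longlonglongrightarrow> 0" for \<omega>
    using tendsto_scaleR[OF tendsto_const[of K] D_tendsto_0[OF assms]] by simp
qed measurable

lemma beta_integral_tendsto_0:
  assumes "h \<longlonglongrightarrow> 0" "\<And>n. 0 < h n"
  shows "(\<lambda>n. LINT s:{0..c}|lborel. beta K (h n) s) \<longlonglongrightarrow> 0"
  by (rule set_integral_bounded_tendsto_0[where B = 1]) (use beta_bounds beta_tendsto_0[OF assms] in auto)

lemma Epsi_R:
  assumes "h > 0" "0 \<le> s" "s + h \<le> T"
  shows "Epsi (\<lambda>\<omega>. blinfun_apply C (R s h \<omega>)) = Epsi (\<lambda>\<omega>. C (R 0 h \<omega>))"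
  unfolding Epsi_def using assms by (rule psi_R)

text \<open>Translation is continuous in measure along each path; Fubini and dominated convergence
  carry this over to the average over starting times.\<close>

lemma Epsi_translation_tendsto_0:
  assumes h: "h \<longlonglongrightarrow> 0" "\<And>n. 0 < h n" "\<And>n. c + h n \<le> T"
  shows "(\<lambda>n. LINT s:{0..c}|lborel. Epsi (\<lambda>\<omega>. Y (s + h n) \<omega> - Y s \<omega>)) \<longlonglongrightarrow> 0"
proof -
  note [measurable] = Y_measurable
  have [measurable]: "(\<lambda>(s, \<omega>). Y (s + t) \<omega>) \<in> borel_measurable (borel \<Otimes>\<^sub>M M)" for t
    using Y_shift_measurable[of t] by (simp add: add.commute)
  have m: "(\<lambda>(s, \<omega>). psi (Y (s + h n) \<omega> - Y s \<omega>)) \<in> borel_measurable (borel \<Otimes>\<^sub>M M)" for n by measurable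
  have eq: "(LINT s:{0..c}|lborel. Epsi (\<lambda>\<omega>. Y (s + h n) \<omega> - Y s \<omega>))
      = expectation (\<lambda>\<omega>. LINT s:{0..c}|lborel. psi (Y (s + h n) \<omega> - Y s \<omega>))" for n
    unfolding Epsi_def by (rule expectation_set_integral[symmetric, OF m, where B = 1]) (auto simp: emeasure_lborel_Icc_eq)
  have "(\<lambda>n. expectation (\<lambda>\<omega>. LINT s:{0..c}|lborel. psi (Y (s + h n) \<omega> - Y s \<omega>))) \<longlonglongrightarrow> expectation (\<lambda>\<omega>. 0)"
  proof (rule integral_dominated_convergence[where w = "\<lambda>_. \<bar>c\<bar>"])
    show "(\<lambda>\<omega>. LINT s:{0..c}|lborel. psi (Y (s + h n) \<omega> - Y s \<omega>)) \<in> borel_measurable M" for n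
      by (rule set_integral_lborel_measurable[OF m]) simp
    show "AE \<omega> in M. (\<lambda>n. LINT s:{0..c}|lborel. psi (Y (s + h n) \<omega> - Y s \<omega>)) \<longlonglongrightarrow> 0"
    proof (rule AE_I2)
      fix \<omega> assume "\<omega> \<in> space M"
      then show "(\<lambda>n. LINT s:{0..c}|lborel. psi (Y (s + h n) \<omega> - Y s \<omega>)) \<longlonglongrightarrow> 0"
        by (intro translation_psi_tendsto_0[where T = T] Y_measurable_path h less_imp_le)
    qed
    show "AE \<omega> in M. norm (LINT s:{0..c}|lborel. psi (Y (s + h n) \<omega> - Y s \<omega>)) \<le> \<bar>c\<bar>" for n
    proof (rule AE_I2)
      fix \<omega> assume "\<omega> \<in> space M"
      note [measurable] = Y_measurable_path[OF this]
      have "(LINT s:{0..c}|lborel. psi (Y (s + h n) \<omega> - Y s \<omega>)) \<le> (LINT s:{0..c}|lborel. 1)"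
        by (rule set_integral_bounded_mono[where B = 1 and C = 1]) auto
      also have "\<dots> \<le> \<bar>c\<bar>" by (simp add: set_integral_lborel_const)
      finally have "(LINT s:{0..c}|lborel. psi (Y (s + h n) \<omega> - Y s \<omega>)) \<le> \<bar>c\<bar>" .
      moreover have "0 \<le> (LINT s:{0..c}|lborel. psi (Y (s + h n) \<omega> - Y s \<omega>))"
        unfolding set_lebesgue_integral_def by (rule integral_nonneg_AE) auto
      ultimately show "norm (LINT s:{0..c}|lborel. psi (Y (s + h n) \<omega> - Y s \<omega>)) \<le> \<bar>c\<bar>" by simp
    qed
  qed simp_all
  then show ?thesis unfolding eq by simp
qed

lemma Epsi_R0_tendsto_0:
  assumes h: "h \<longlonglongrightarrow> 0" "\<And>n. 0 < h n" "\<And>n. h n \<le> T / 2"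
  shows "(\<lambda>n. Epsi (R 0 (h n))) \<longlonglongrightarrow> 0"
proof -
  \<comment> \<open>Starting times up to \<open>T / 2\<close> leave room for every step
    \<open>h n \<le> T / 2\<close>.\<close>
  define c where "c = T / 2"
  have c: "c > 0" "\<And>n. c + h n \<le> T" using T by (simp add: c_def, use h(3) in \<open>simp add: c_def field_simps\<close>)
  have [measurable]: "(\<lambda>(s, \<omega>). Y (s + t) \<omega>) \<in> borel_measurable (borel \<Otimes>\<^sub>M M)" for t
    using Y_shift_measurable[of t] by (simp add: add.commute)
  note [measurable] = Y_measurable
  define A where "A n s = Epsi (\<lambda>\<omega>. Y (s + h n) \<omega> - Y s \<omega>)" for n s
  have A [measurable]: "A n \<in> borel_measurable borel" for n unfolding A_def by (rule Epsi_process_measurable) measurable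
  have Ab: "\<bar>A n s\<bar> \<le> 1" for n s unfolding A_def by (rule Epsi_bounds)
  have le: "c * Epsi (R 0 (h n)) \<le> 2 * (LINT s:{0..c}|lborel. A n s) + 2 * (LINT s:{0..c}|lborel. beta 1 (h n) s)" for n
  proof -
    have p: "Epsi (R 0 (h n)) \<le> 2 * A n s + 2 * beta 1 (h n) s" if s: "s \<in> {0..c}" for s
    proof -
      have "Epsi (R 0 (h n)) = Epsi (R s (h n))"
        using Epsi_R[of "h n" s id_blinfun] s h(2)[of n] c(2)[of n] by (simp add: Epsi_def)
      also have "\<dots> = Epsi (\<lambda>\<omega>. (Y (s + h n) \<omega> - Y s \<omega>) + (- D (h n) (Y s \<omega>)))"
        by (simp add: R_def D_apply Epsi_def)
      also have "\<dots> \<le> 2 * A n s + 2 * Epsi (\<lambda>\<omega>. - D (h n) (Y s \<omega>))" unfolding A_def by (rule Epsi_add) measurable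
      also have "Epsi (\<lambda>\<omega>. - D (h n) (Y s \<omega>)) = beta 1 (h n) s" by (simp add: beta_def Epsi_def psi_minus)
      finally show ?thesis .
    qed
    have "c * Epsi (R 0 (h n)) = (LINT s:{0..c}|lborel. Epsi (R 0 (h n)))"
      using c(1) by (simp add: set_integral_lborel_const)
    also have "\<dots> \<le> (LINT s:{0..c}|lborel. 2 * A n s + 2 * beta 1 (h n) s)"
    proof (rule set_integral_bounded_mono[where B = 1 and C = 4])
      show "\<bar>2 * A n s + 2 * beta 1 (h n) s\<bar> \<le> 4" for s using Ab[of n s] beta_bounds(2)[of 1 "h n" s] by linarith
    qed (use p Epsi_bounds in auto)
    also have "\<dots> = 2 * (LINT s:{0..c}|lborel. A n s) + 2 * (LINT s:{0..c}|lborel. beta 1 (h n) s)"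
    proof -
      have "set_integrable lborel {0..c} (A n)" "set_integrable lborel {0..c} (beta 1 (h n))"
        by (rule set_integrable_bounded[where B = 1]; use Ab beta_bounds in simp)+
      then show ?thesis by (simp add: set_integral_add)
    qed
    finally show ?thesis .
  qed
  have "(\<lambda>n. 2 * (LINT s:{0..c}|lborel. A n s) + 2 * (LINT s:{0..c}|lborel. beta 1 (h n) s)) \<longlonglongrightarrow> 2 * 0 + 2 * 0"
    unfolding A_def by (intro tendsto_intros beta_integral_tendsto_0 Epsi_translation_tendsto_0 h c)
  then have lim: "(\<lambda>n. 2 * (LINT s:{0..c}|lborel. A n s) + 2 * (LINT s:{0..c}|lborel. beta 1 (h n) s)) \<longlonglongrightarrow> 0" by simp
  have "(\<lambda>n. c * Epsi (R 0 (h n))) \<longlonglongrightarrow> 0"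
    by (rule Lim_null_comparison[OF always_eventually[OF allI] lim]) (use le c(1) Epsi_bounds in \<open>simp add: abs_mult\<close>)
  then have "(\<lambda>n. (1 / c) * (c * Epsi (R 0 (h n)))) \<longlonglongrightarrow> (1 / c) * 0" by (intro tendsto_intros)
  then show ?thesis using c(1) by simp
qed

section \<open>One-sided continuity in probability at a fixed time\<close>

lemma Epsi_increment_le:
  assumes "0 < h" "0 \<le> s" "s + h \<le> T"
  shows "Epsi (\<lambda>\<omega>. Y (s + h) \<omega> - Y s \<omega>) \<le> 2 * Epsi (R 0 h) + 2 * Epsi (\<lambda>\<omega>. D h (Y s \<omega>))"
proof -
  have "Epsi (\<lambda>\<omega>. Y (s + h) \<omega> - Y s \<omega>) = Epsi (\<lambda>\<omega>. R s h \<omega> + D h (Y s \<omega>))" by (simp add: R_def D_apply Epsi_def)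
  also have "\<dots> \<le> 2 * Epsi (R s h) + 2 * Epsi (\<lambda>\<omega>. D h (Y s \<omega>))" by (rule Epsi_add) measurable
  also have "Epsi (R s h) = Epsi (R 0 h)" using Epsi_R[OF assms, of id_blinfun] by (simp add: Epsi_def)
  finally show ?thesis .
qed

lemma right_continuous:
  assumes t: "t \<ge> 0" and h: "h \<longlonglongrightarrow> 0" "\<And>n. 0 < h n" "\<And>n. h n \<le> T / 2" "\<And>n. t + h n \<le> T"
  shows "(\<lambda>n. Epsi (\<lambda>\<omega>. Y (t + h n) \<omega> - Y t \<omega>)) \<longlonglongrightarrow> 0"
proof -
  have "(\<lambda>n. 2 * Epsi (R 0 (h n)) + 2 * Epsi (\<lambda>\<omega>. D (h n) (Y t \<omega>))) \<longlonglongrightarrow> 2 * 0 + 2 * 0"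
    by (intro tendsto_intros Epsi_R0_tendsto_0 Epsi_tendsto_0 D_tendsto_0 h) measurable
  then have lim: "(\<lambda>n. 2 * Epsi (R 0 (h n)) + 2 * Epsi (\<lambda>\<omega>. D (h n) (Y t \<omega>))) \<longlonglongrightarrow> 0" by simp
  show ?thesis
    by (rule Lim_null_comparison[OF always_eventually[OF allI] lim])
      (use Epsi_increment_le[OF h(2) t h(4)] Epsi_bounds in simp)
qed

lemma left_continuous:
  assumes t: "0 < t" "t \<le> T" and h: "h \<longlonglongrightarrow> 0" "\<And>n. 0 < h n" "\<And>n. h n \<le> t / 2"
  shows "(\<lambda>n. Epsi (\<lambda>\<omega>. Y t \<omega> - Y (t - h n) \<omega>)) \<longlonglongrightarrow> 0"
proof -
  obtain K0 where K0: "\<And>r. r \<in> {0..T} \<Longrightarrow> norm (S r) \<le> K0" using S_bounded by blast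
  define K where "K = max 1 K0"
  have K: "K \<ge> 1" "\<And>r. r \<in> {0..T} \<Longrightarrow> norm (S r) \<le> K" using K0 by (auto simp: K_def le_max_iff_disj)
  \<comment> \<open>As \<open>t - h n \<ge> t / 2\<close> and \<open>s \<le> t / 4\<close>, the
    remaining time \<open>t - h n - s\<close> is positive, which \<open>Epsi_R\<close>
    requires.\<close>
  define c where "c = t / 4"
  have c: "c > 0" using t by (simp add: c_def)
  define B where "B n = (LINT s:{0..T}|lborel. beta K (h n) s)" for n
  have q: "c * Epsi (\<lambda>\<omega>. D (h n) (Y (t - h n) \<omega>)) \<le> 6 * B n + 4 * c * beta K (h n) 0" for n
  proof -
    define u where "u = t - h n"
    have u: "t / 2 \<le> u" "u \<le> T" "u \<ge> c" using h(2)[of n] h(3)[of n] t by (auto simp: u_def c_def)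
    let ?b = "beta K (h n)"
    have SD: "norm (D (h n) (S r x)) \<le> norm (K *\<^sub>R D (h n) x)" if "r \<in> {0..T}" for r x
    proof -
      have "D (h n) (S r x) = S r (D (h n) x)"
        using S_add[of "h n" r x] S_add[of r "h n" x] that h(2)[of n]
        by (simp add: D_apply blinfun.diff_right add.commute)
      also have "norm \<dots> \<le> norm (S r) * norm (D (h n) x)" by (rule norm_blinfun)
      also have "\<dots> \<le> K * norm (D (h n) x)" using K(2)[OF that] by (intro mult_right_mono) auto
      finally show ?thesis using K(1) by simp
    qed
    have Dle: "norm (D (h n) x) \<le> norm (K *\<^sub>R D (h n) x)" for x
      using mult_right_mono[OF K(1) norm_ge_zero[of "D (h n) x"]] K(1) by simp
    \<comment> \<open>\<open>R 0 r\<close> is \<open>Y r\<close> minus \<open>S r (Y 0)\<close>, so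
      replacing the law of \<open>R s r\<close> leaves only \<open>Y r\<close>, \<open>Y 0\<close>
      and \<open>Y s\<close> under \<open>D (h n)\<close>. Two uses of \<open>Epsi_add\<close>
      produce the factors 4, 4 and 2.\<close>
    have p: "Epsi (\<lambda>\<omega>. D (h n) (Y u \<omega>)) \<le> 4 * ?b (u - s) + (4 * ?b 0 + 2 * ?b s)" if s: "s \<in> {0..c}" for s
    proof -
      define r where "r = u - s"
      have r: "0 < r" "s + r = u" "r \<in> {0..T}" using s u t by (auto simp: r_def c_def)
      have "Epsi (\<lambda>\<omega>. D (h n) (Y u \<omega>)) = Epsi (\<lambda>\<omega>. D (h n) (R s r \<omega>) + D (h n) (S r (Y s \<omega>)))"
        by (simp add: R_def r(2) blinfun.diff_right)
      also have "\<dots> \<le> 2 * Epsi (\<lambda>\<omega>. D (h n) (R s r \<omega>)) + 2 * Epsi (\<lambda>\<omega>. D (h n) (S r (Y s \<omega>)))"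
        by (rule Epsi_add) measurable
      also have "Epsi (\<lambda>\<omega>. D (h n) (R s r \<omega>)) = Epsi (\<lambda>\<omega>. D (h n) (R 0 r \<omega>))"
        using r s u by (intro Epsi_R) auto
      also have "\<dots> = Epsi (\<lambda>\<omega>. D (h n) (Y r \<omega>) + - D (h n) (S r (Y 0 \<omega>)))"
        by (simp add: R_def blinfun.diff_right)
      also have "\<dots> \<le> 2 * Epsi (\<lambda>\<omega>. D (h n) (Y r \<omega>)) + 2 * Epsi (\<lambda>\<omega>. - D (h n) (S r (Y 0 \<omega>)))"
        by (rule Epsi_add) measurable
      also have "Epsi (\<lambda>\<omega>. D (h n) (Y r \<omega>)) \<le> ?b r" unfolding beta_def by (intro Epsi_mono Dle) measurable
      also have "Epsi (\<lambda>\<omega>. - D (h n) (S r (Y 0 \<omega>))) \<le> ?b 0"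
        unfolding beta_def by (intro Epsi_mono) (use SD[OF r(3)] in \<open>auto simp only: norm_minus_cancel, measurable\<close>)
      also have "Epsi (\<lambda>\<omega>. D (h n) (S r (Y s \<omega>))) \<le> ?b s"
        unfolding beta_def by (intro Epsi_mono SD r(3)) measurable
      finally show ?thesis by (simp add: r_def)
    qed
    have "c * Epsi (\<lambda>\<omega>. D (h n) (Y u \<omega>)) = (LINT s:{0..c}|lborel. Epsi (\<lambda>\<omega>. D (h n) (Y u \<omega>)))"
      using c by (simp add: set_integral_lborel_const)
    also have "\<dots> \<le> (LINT s:{0..c}|lborel. 4 * ?b (u - s) + (4 * ?b 0 + 2 * ?b s))"
    proof (rule set_integral_bounded_mono[where B = 1 and C = 10])
      show "\<bar>4 * ?b (u - s) + (4 * ?b 0 + 2 * ?b s)\<bar> \<le> 10" for s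
        using beta_bounds(2)[of K "h n" s] beta_bounds(2)[of K "h n" 0] beta_bounds(2)[of K "h n" "u - s"] by linarith
    qed (use p Epsi_bounds in auto)
    also have "\<dots> = 4 * (LINT s:{0..c}|lborel. ?b (u - s)) + (4 * (c * ?b 0) + 2 * (LINT s:{0..c}|lborel. ?b s))"
    proof -
      have "set_integrable lborel {0..c} (\<lambda>s. ?b (u - s))" "set_integrable lborel {0..c} ?b" "set_integrable lborel {0..c} (\<lambda>s. ?b 0)"
        by (rule set_integrable_bounded[where B = 1]; use beta_bounds in simp)+
      moreover have "(LINT s:{0..c}|lborel. 4 * ?b 0) = 4 * (c * ?b 0)"
        using c by (simp add: set_integral_lborel_const)
      ultimately show ?thesis by (simp add: set_integral_add)
    qed
    \<comment> \<open>\<open>u\<close> moves with \<open>n\<close>, so pointwise convergence of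
      \<open>beta\<close> at \<open>u - s\<close> would not suffice. After reflection the average is
      over \<open>{u - c..u}\<close>, part of the fixed interval \<open>{0..T}\<close>.\<close>
    also have "(LINT s:{0..c}|lborel. ?b (u - s)) = (LINT s:{u - c..u - 0}|lborel. ?b s)" by (rule set_integral_lborel_reflect)
    also have "\<dots> \<le> B n" unfolding B_def
      by (rule set_integral_nonneg_subset[where B = 1]) (use beta_bounds u in auto)
    also have "(LINT s:{0..c}|lborel. ?b s) \<le> B n" unfolding B_def
      by (rule set_integral_nonneg_subset[where B = 1]) (use beta_bounds u in auto)
    finally show ?thesis by (simp add: u_def)
  qed
  have "(\<lambda>n. (1 / c) * (6 * B n + 4 * c * beta K (h n) 0)) \<longlonglongrightarrow> (1 / c) * (6 * 0 + 4 * c * 0)"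
    unfolding B_def by (intro tendsto_intros beta_integral_tendsto_0 beta_tendsto_0 h)
  then have lim1: "(\<lambda>n. (1 / c) * (6 * B n + 4 * c * beta K (h n) 0)) \<longlonglongrightarrow> 0" by simp
  have h': "h n \<le> T / 2" for n using h(3)[of n] t by linarith
  have "(\<lambda>n. 2 * Epsi (R 0 (h n)) + 2 * ((1 / c) * (6 * B n + 4 * c * beta K (h n) 0))) \<longlonglongrightarrow> 2 * 0 + 2 * 0"
    by (intro tendsto_intros Epsi_R0_tendsto_0 h h' lim1)
  then have lim: "(\<lambda>n. 2 * Epsi (R 0 (h n)) + 2 * ((1 / c) * (6 * B n + 4 * c * beta K (h n) 0))) \<longlonglongrightarrow> 0" by simp
  show ?thesis
  proof (rule Lim_null_comparison[OF always_eventually[OF allI] lim])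
    fix n
    have "Epsi (\<lambda>\<omega>. Y t \<omega> - Y (t - h n) \<omega>) \<le> 2 * Epsi (R 0 (h n)) + 2 * Epsi (\<lambda>\<omega>. D (h n) (Y (t - h n) \<omega>))"
      using Epsi_increment_le[of "h n" "t - h n"] h(2)[of n] h(3)[of n] t by simp
    moreover have "Epsi (\<lambda>\<omega>. D (h n) (Y (t - h n) \<omega>)) \<le> (1 / c) * (6 * B n + 4 * c * beta K (h n) 0)"
      using q[of n] c by (simp add: field_simps)
    ultimately show "norm (Epsi (\<lambda>\<omega>. Y t \<omega> - Y (t - h n) \<omega>)) \<le> 2 * Epsi (R 0 (h n)) + 2 * ((1 / c) * (6 * B n + 4 * c * beta K (h n) 0))"
      unfolding real_norm_def abs_of_nonneg[OF Epsi_bounds(1)] by linarith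
  qed
qed

lemma Epsi_continuous:
  assumes t: "t \<in> {0..T}"
  shows "((\<lambda>s. Epsi (\<lambda>\<omega>. Y s \<omega> - Y t \<omega>)) \<longlongrightarrow> 0) (at t within {0..T})"
proof -
  have un: "{0..T} = {0..t} \<union> {t..T}" using t by auto
  have "((\<lambda>s. Epsi (\<lambda>\<omega>. Y s \<omega> - Y t \<omega>)) \<longlongrightarrow> 0) (at t within {t..T})"
    unfolding tendsto_at_iff_sequentially
  proof (intro allI impI)
    fix X :: "nat \<Rightarrow> real" assume X: "\<forall>i. X i \<in> {t..T} - {t}" "X \<longlonglongrightarrow> t"
    have lim: "(\<lambda>i. X i - t) \<longlonglongrightarrow> 0" using X(2) by (rule LIM_zero)
    \<comment> \<open>The one-sided lemmas bound every step size; dropping finitely many terms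
      achieves this.\<close>
    obtain N where N: "\<And>i. i \<ge> N \<Longrightarrow> X i - t < T / 2" using LIMSEQ_0_less[OF lim, of "T / 2"] T by auto
    have pos: "X i - t > 0" "X i \<le> T" for i using X(1)[rule_format, of i] by auto
    have "(\<lambda>i. Epsi (\<lambda>\<omega>. Y (t + (X (i + N) - t)) \<omega> - Y t \<omega>)) \<longlonglongrightarrow> 0"
    proof (rule right_continuous)
      show "(\<lambda>i. X (i + N) - t) \<longlonglongrightarrow> 0" by (rule LIMSEQ_ignore_initial_segment[OF lim])
      show "X (i + N) - t \<le> T / 2" for i using N[of "i + N"] by simp
    qed (use t pos in auto)
    then have "(\<lambda>i. Epsi (\<lambda>\<omega>. Y (X (i + N)) \<omega> - Y t \<omega>)) \<longlonglongrightarrow> 0" by simp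
    then have "(\<lambda>i. Epsi (\<lambda>\<omega>. Y (X i) \<omega> - Y t \<omega>)) \<longlonglongrightarrow> 0" by (rule LIMSEQ_offset)
    then show "((\<lambda>s. Epsi (\<lambda>\<omega>. Y s \<omega> - Y t \<omega>)) \<circ> X) \<longlonglongrightarrow> 0" by (simp add: o_def)
  qed
  moreover have "((\<lambda>s. Epsi (\<lambda>\<omega>. Y s \<omega> - Y t \<omega>)) \<longlongrightarrow> 0) (at t within {0..t})"
    unfolding tendsto_at_iff_sequentially
  proof (intro allI impI)
    fix X :: "nat \<Rightarrow> real" assume X: "\<forall>i. X i \<in> {0..t} - {t}" "X \<longlonglongrightarrow> t"
    have lim: "(\<lambda>i. t - X i) \<longlonglongrightarrow> 0" using tendsto_diff[OF tendsto_const[of t] X(2)] by simp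
    have pos: "t - X i > 0" "0 \<le> X i" for i using X(1)[rule_format, of i] by auto
    \<comment> \<open>A sequence \<open>X\<close> exists only for \<open>t > 0\<close>; at
      \<open>t = 0\<close> there is nothing to approach from the left.\<close>
    have t0: "t > 0" using pos[of 0] by linarith
    obtain N where N: "\<And>i. i \<ge> N \<Longrightarrow> t - X i < t / 2" using LIMSEQ_0_less[OF lim, of "t / 2"] t0 by auto
    have "(\<lambda>i. Epsi (\<lambda>\<omega>. Y t \<omega> - Y (t - (t - X (i + N))) \<omega>)) \<longlonglongrightarrow> 0"
    proof (rule left_continuous[OF t0])
      show "(\<lambda>i. t - X (i + N)) \<longlonglongrightarrow> 0" by (rule LIMSEQ_ignore_initial_segment[OF lim])
      show "t - X (i + N) \<le> t / 2" for i using N[of "i + N"] by simp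
    qed (use t pos in auto)
    then have "(\<lambda>i. Epsi (\<lambda>\<omega>. Y (X (i + N)) \<omega> - Y t \<omega>)) \<longlonglongrightarrow> 0" by (simp add: Epsi_def psi_minus(2)[of "Y t _"])
    then have "(\<lambda>i. Epsi (\<lambda>\<omega>. Y (X i) \<omega> - Y t \<omega>)) \<longlonglongrightarrow> 0" by (rule LIMSEQ_offset)
    then show "((\<lambda>s. Epsi (\<lambda>\<omega>. Y s \<omega> - Y t \<omega>)) \<circ> X) \<longlonglongrightarrow> 0" by (simp add: o_def)
  qed
  ultimately show ?thesis unfolding un at_within_union by (intro filterlim_sup)
qed

lemma stochastically_continuous:
  assumes t: "t \<in> {0..T}"
  shows "conv_in_prob M Y (Y t) (at t within {0..T})"
  unfolding conv_in_prob_def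
proof (intro allI impI)
  fix e :: real assume e: "e > 0"
  \<comment> \<open>The value of \<open>psi\<close> at vectors of norm \<open>e\<close>, as needed
    for Markov's inequality.\<close>
  define \<kappa> where "\<kappa> = 1 - exp (- (e\<^sup>2 / 2))"
  have \<kappa>: "\<kappa> > 0" using e by (simp add: \<kappa>_def)
  have le: "prob {\<omega> \<in> space M. dist (Y s \<omega>) (Y t \<omega>) > e} \<le> (1 / \<kappa>) * Epsi (\<lambda>\<omega>. Y s \<omega> - Y t \<omega>)" for s
  proof -
    have "prob {\<omega> \<in> space M. dist (Y s \<omega>) (Y t \<omega>) > e} = expectation (indicator {\<omega> \<in> space M. dist (Y s \<omega>) (Y t \<omega>) > e})"
      by simp
    also have "\<dots> \<le> expectation (\<lambda>\<omega>. (1 / \<kappa>) * psi (Y s \<omega> - Y t \<omega>))"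
    proof (rule integral_mono)
      fix \<omega>
      show "indicator {\<omega> \<in> space M. dist (Y s \<omega>) (Y t \<omega>) > e} \<omega> \<le> (1 / \<kappa>) * psi (Y s \<omega> - Y t \<omega>)"
      proof (cases "dist (Y s \<omega>) (Y t \<omega>) > e")
        case True
        then have "e\<^sup>2 \<le> (norm (Y s \<omega> - Y t \<omega>))\<^sup>2" using e by (intro power_mono) (auto simp: dist_norm)
        then have "\<kappa> \<le> psi (Y s \<omega> - Y t \<omega>)" by (simp add: \<kappa>_def psi_def)
        then have "1 \<le> (1 / \<kappa>) * psi (Y s \<omega> - Y t \<omega>)" using \<kappa> by (simp add: field_simps)
        then show ?thesis by (simp add: indicator_def)
      qed (use \<kappa> in \<open>simp add: indicator_def\<close>)
    qed (auto intro!: integrable_psi simp: emeasure_eq_measure)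
    finally show ?thesis by (simp add: Epsi_def)
  qed
  have "((\<lambda>s. (1 / \<kappa>) * Epsi (\<lambda>\<omega>. Y s \<omega> - Y t \<omega>)) \<longlongrightarrow> (1 / \<kappa>) * 0) (at t within {0..T})"
    by (intro tendsto_intros Epsi_continuous t)
  then have lim: "((\<lambda>s. (1 / \<kappa>) * Epsi (\<lambda>\<omega>. Y s \<omega> - Y t \<omega>)) \<longlongrightarrow> 0) (at t within {0..T})" by simp
  show "((\<lambda>s. prob {\<omega> \<in> space M. dist (Y s \<omega>) (Y t \<omega>) > e}) \<longlongrightarrow> 0) (at t within {0..T})"
    by (rule Lim_null_comparison[OF always_eventually[OF allI] lim]) (use le in simp)
qed

end

theorem theorem5p2:
  fixes M :: "'w measure"
    and F :: "real \<Rightarrow> 'w measure"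
    and T :: real
    and S :: "real \<Rightarrow> ('v::{real_inner, complete_space, second_countable_topology} \<Rightarrow>\<^sub>L 'v)"
    and DA :: "'v set" and A :: "'v \<Rightarrow> 'v"
    and B :: "'u::{real_inner, complete_space, second_countable_topology} \<Rightarrow>\<^sub>L 'v"
    and L :: "real \<Rightarrow> 'u \<Rightarrow> 'w \<Rightarrow> real"
    and y0 :: 'v
    and Y :: "real \<Rightarrow> 'w \<Rightarrow> 'v"
  assumes "prob_space M"
    and "generates DA A S"
    and "cylindrical_levy M L"
    and "weak_solution M F T DA A B L y0 Y"
  shows "\<forall>t\<in>{0..T}. conv_in_prob M Y (Y t) (at t within {0..T})"
proof (cases "T > 0")
  case True
  \<comment> \<open>Measurability of \<open>Y\<close> is known for times in \<open>{0..T}\<close>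
    only. The extension by 0 is jointly measurable over the whole line and agrees with
    \<open>Y\<close> at all times that matter.\<close>
  define Z where "Z s \<omega> = (if s \<in> {0..T} then Y s \<omega> else 0)" for s \<omega>
  have ZY: "(LINT s:{0..t}|lborel. Z s \<omega> \<bullet> f s) = (LINT s:{0..t}|lborel. Y s \<omega> \<bullet> f s)" if "t \<le> T" for t \<omega> f
    by (rule set_lebesgue_integral_cong) (use that in \<open>auto simp: Z_def\<close>)
  have ZY': "set_integrable lborel {0..T} (\<lambda>s. Z s \<omega> \<bullet> f s) \<longleftrightarrow> set_integrable lborel {0..T} (\<lambda>s. Y s \<omega> \<bullet> f s)" for \<omega> f
    by (rule set_integrable_cong) (auto simp: Z_def)
  interpret prob_space M by fact
  have prog: "progressive M F T Y" and boch: "weakly_bochner_regular M T Y"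
    and weak: "\<And>v t. v \<in> adj_dom DA A \<Longrightarrow> t \<in> {0..T} \<Longrightarrow> AE \<omega> in M. Y t \<omega> \<bullet> v =
          y0 \<bullet> v + (LINT s:{0..t}|lborel. Y s \<omega> \<bullet> adj_op DA A v) + L t (adjoint (blinfun_apply B) v) \<omega>"
    using assms(4) unfolding weak_solution_def by auto
  have Zm: "(\<lambda>(s, \<omega>). Z s \<omega>) \<in> borel_measurable (borel \<Otimes>\<^sub>M M)"
  proof -
    have spF: "space (F T) = space M" and stF: "sets (F T) \<subseteq> sets M"
      and Ym: "(\<lambda>(s, \<omega>). Y s \<omega>) \<in> (restrict_space borel {0..T} \<Otimes>\<^sub>M F T) \<rightarrow>\<^sub>M borel"
      using prog True unfolding progressive_def by (auto simp: filtration_def)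
    have idF: "(\<lambda>\<omega>. \<omega>) \<in> M \<rightarrow>\<^sub>M F T"
      by (rule measurableI) (use spF stF sets.sets_into_space in \<open>auto simp: Int_absorb2\<close>)
    define W where "W = restrict_space (borel \<Otimes>\<^sub>M M) {x. fst x \<in> {0..T}}"
    have "(\<lambda>x. (fst x, snd x)) \<in> W \<rightarrow>\<^sub>M restrict_space borel {0..T} \<Otimes>\<^sub>M F T"
    proof (rule measurable_Pair)
      show "fst \<in> W \<rightarrow>\<^sub>M restrict_space borel {0..T}" unfolding W_def
        by (rule measurable_restrict_space2) (auto simp: space_restrict_space intro: measurable_restrict_space1)
      show "snd \<in> W \<rightarrow>\<^sub>M F T" unfolding W_def
        by (rule measurable_restrict_space1) (rule measurable_compose[OF measurable_snd idF])
    qed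
    from measurable_compose[OF this Ym] have YW: "(\<lambda>x. Y (fst x) (snd x)) \<in> borel_measurable W" by (simp add: split_beta')
    have "(\<lambda>x. if fst x \<in> {0..T} then Y (fst x) (snd x) else 0) \<in> borel_measurable (borel \<Otimes>\<^sub>M M)"
      by (subst measurable_If_restrict_space_iff) (use YW in \<open>auto simp: W_def\<close>)
    then show ?thesis by (simp add: Z_def split_beta')
  qed
  have bochZ: "weakly_bochner_regular M T Z"
    using boch unfolding weakly_bochner_regular_def ZY' ZY[OF order_refl] .
  have weakZ: "AE \<omega> in M. Z t \<omega> \<bullet> v =
      y0 \<bullet> v + (LINT s:{0..t}|lborel. Z s \<omega> \<bullet> adj_op DA A v) + L t (adjoint (blinfun_apply B) v) \<omega>"
    if "v \<in> adj_dom DA A" "t \<in> {0..T}" for v t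
  proof -
    have "Z t \<omega> = Y t \<omega>" for \<omega> using that by (simp add: Z_def)
    then show ?thesis using weak[OF that] that(2) by (simp add: ZY)
  qed
  have levy: "\<forall>(n::nat) (us :: nat \<Rightarrow> 'u). levy_process_Rn M {..<n} (\<lambda>t \<omega> i. L t (us i) \<omega>)"
    using assms(3) unfolding cylindrical_levy_def by (elim conjE) assumption
  interpret weak_cauchy M S DA A T Z y0 "\<lambda>t v. L t (adjoint (blinfun_apply B) v)"
  proof unfold_locales
    show "c0_semigroup S" "generates DA A S" using assms(2) by (auto simp: generates_def)
    show "levy_process_Rn M {..<n} (\<lambda>t \<omega> i. L t (adjoint (blinfun_apply B) (vs i)) \<omega>)" for n vs
      using levy[rule_format, of n "\<lambda>i. adjoint (blinfun_apply B) (vs i)"] .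
  qed (use True Zm bochZ weakZ in auto)
  show ?thesis
  proof
    fix t assume t: "t \<in> {0..T}"
    have eq: "measure M {\<omega> \<in> space M. dist (Z s \<omega>) (Z t \<omega>) > e} = measure M {\<omega> \<in> space M. dist (Y s \<omega>) (Y t \<omega>) > e}"
      if "s \<in> {0..T}" for s e using that t by (simp add: Z_def)
    have ev: "\<forall>\<^sub>F s in at t within {0..T}. s \<in> {0..T}" by (simp add: eventually_at_filter)
    show "conv_in_prob M Y (Y t) (at t within {0..T})" unfolding conv_in_prob_def
    proof (intro allI impI)
      fix e :: real assume "e > 0"
      then have "((\<lambda>s. measure M {\<omega> \<in> space M. dist (Z s \<omega>) (Z t \<omega>) > e}) \<longlongrightarrow> 0) (at t within {0..T})"
        using stochastically_continuous[OF t] unfolding conv_in_prob_def by simp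
      then show "((\<lambda>s. measure M {\<omega> \<in> space M. dist (Y s \<omega>) (Y t \<omega>) > e}) \<longlongrightarrow> 0) (at t within {0..T})"
        by (rule Lim_transform_eventually) (use ev eq in \<open>auto elim: eventually_mono\<close>)
    qed
  qed
next
  case False
  \<comment> \<open>The interval has at most one point, so no other time approaches
    \<open>t\<close>.\<close>
  have "at t within {0..T} = bot" if "t \<in> {0..T}" for t
  proof -
    have "{0..T} - {t} = {}" using that False by auto
    then show ?thesis unfolding at_within_def by (simp only: principal_eq_bot_iff[THEN iffD2, OF refl] inf_bot_right)
  qed
  then show ?thesis by (auto simp: conv_in_prob_def)
qed

end
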